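(* Let $G$ be a finite group, $k$ a field of prime characteristic $p$, $\Omega$ a finite $G$-set, and let $X\subset\Omega$ be closed. Then there is a multiplicity-preserving bijective correspondence between the isomorphism types of indecomposable summands of the permutation $kG$-module $k\Omega$ which admit $X$ as a fixed point set and the isomorphism types of projective indecomposable summands of the permutation $kM_X$-module $kX$.
   Context: For a subset $X\subset\Omega$: $S_X$ is the pointwise stabilizer of $X$ in $G$, $Q_X$ is a Sylow $p$-subgroup of $S_X$, $N_X=\{g\in G: X^g=X\}$, and $M_X=N_X/S_X$, which acts faithfully on $X$. $X$ is closed if $\mathrm{Fix}_\Omega(Q_X)=X$ (this does not depend on the choice of $Q_X$). An indecomposable summand $M$ of $k\Omega$ admits $X$ as a fixed point set if $M$ has a vertex $Q$ with $\mathrm{Fix}_\Omega(Q)=X$. *)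

theory Defs
  imports
    Complex_Main
    "HOL-Algebra.Group_Action"
    "HOL-Library.Function_Algebras"
    "HOL-Computational_Algebra.Primes"
begin

section \<open>Modules over a group algebra\<close>

text \<open>
  A \<open>kG\<close>-module is rendered as a \<open>k\<close>-vector space (a subspace of an ambient type) on which \<open>G\<close>
  acts by \<open>k\<close>-linear maps. The coefficient field is a type \<open>'k\<close> of class \<open>field\<close>; addition is
  that of the ambient type \<open>'v\<close>. Only the values of the action on group elements and on the carrier
  are relevant. A submodule with carrier \<open>A\<close> is the record \<open>M\<lparr>carrier := A\<rparr>\<close>.
\<close>

record ('v, 'k, 'g) gmodule = "'v partial_object" +
  mscale :: "'k \<Rightarrow> 'v \<Rightarrow> 'v"
  mact :: "'g \<Rightarrow> 'v \<Rightarrow> 'v"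

locale kG_module = group G + vector_space "mscale M"
  for G :: "('g, 'm) monoid_scheme" (structure)
    and M :: "('v::ab_group_add, 'k::field, 'g) gmodule" +
  assumes carrier_subspace: "subspace (carrier M)"
    and act_closed: "\<lbrakk>g \<in> carrier G; v \<in> carrier M\<rbrakk> \<Longrightarrow> mact M g v \<in> carrier M"
    and act_add: "\<lbrakk>g \<in> carrier G; v \<in> carrier M; w \<in> carrier M\<rbrakk>
          \<Longrightarrow> mact M g (v + w) = mact M g v + mact M g w"
    and act_scale: "\<lbrakk>g \<in> carrier G; v \<in> carrier M\<rbrakk>
          \<Longrightarrow> mact M g (mscale M c v) = mscale M c (mact M g v)"
    and act_one: "v \<in> carrier M \<Longrightarrow> mact M \<one> v = v"
    and act_mult: "\<lbrakk>g \<in> carrier G; h \<in> carrier G; v \<in> carrier M\<rbrakk>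
          \<Longrightarrow> mact M (g \<otimes> h) v = mact M g (mact M h v)"

definition kG_submodule ::
  "('g, 'm) monoid_scheme \<Rightarrow> ('v::ab_group_add, 'k::field, 'g) gmodule \<Rightarrow> 'v set \<Rightarrow> bool"
  where "kG_submodule G M A \<longleftrightarrow>
    A \<subseteq> carrier M \<and> module.subspace (mscale M) A \<and>
    (\<forall>g \<in> carrier G. \<forall>v \<in> A. mact M g v \<in> A)"

definition kG_hom ::
  "('g, 'm) monoid_scheme \<Rightarrow> ('v::ab_group_add, 'k::field, 'g) gmodule \<Rightarrow>
    ('w::ab_group_add, 'k, 'g) gmodule \<Rightarrow> ('v \<Rightarrow> 'w) set"
  where "kG_hom G M N = {f \<in> carrier M \<rightarrow> carrier N.
    (\<forall>v \<in> carrier M. \<forall>w \<in> carrier M. f (v + w) = f v + f w) \<and>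
    (\<forall>c. \<forall>v \<in> carrier M. f (mscale M c v) = mscale N c (f v)) \<and>
    (\<forall>g \<in> carrier G. \<forall>v \<in> carrier M. f (mact M g v) = mact N g (f v))}"

definition kG_isomorphic ::
  "('g, 'm) monoid_scheme \<Rightarrow> ('v::ab_group_add, 'k::field, 'g) gmodule \<Rightarrow>
    ('w::ab_group_add, 'k, 'g) gmodule \<Rightarrow> bool"
  where "kG_isomorphic G M N \<longleftrightarrow> (\<exists>f \<in> kG_hom G M N. bij_betw f (carrier M) (carrier N))"

definition internal_direct_sum ::
  "('g, 'm) monoid_scheme \<Rightarrow> ('v::ab_group_add, 'k::field, 'g) gmodule \<Rightarrow> 'v set \<Rightarrow> 'v set \<Rightarrow> bool"
  where "internal_direct_sum G M A B \<longleftrightarrow>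
    kG_submodule G M A \<and> kG_submodule G M B \<and>
    A \<inter> B = {0} \<and> carrier M = {a + b | a b. a \<in> A \<and> b \<in> B}"

definition direct_summand ::
  "('g, 'm) monoid_scheme \<Rightarrow> ('v::ab_group_add, 'k::field, 'g) gmodule \<Rightarrow> 'v set \<Rightarrow> bool"
  where "direct_summand G M A \<longleftrightarrow> (\<exists>B. internal_direct_sum G M A B)"

definition isomorphic_to_summand ::
  "('g, 'm) monoid_scheme \<Rightarrow> ('v::ab_group_add, 'k::field, 'g) gmodule \<Rightarrow>
    ('w::ab_group_add, 'k, 'g) gmodule \<Rightarrow> bool"
  where "isomorphic_to_summand G M N \<longleftrightarrow>
    (\<exists>A. direct_summand G N A \<and> kG_isomorphic G M (N\<lparr>carrier := A\<rparr>))"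

definition indecomposable ::
  "('g, 'm) monoid_scheme \<Rightarrow> ('v::ab_group_add, 'k::field, 'g) gmodule \<Rightarrow> bool"
  where "indecomposable G M \<longleftrightarrow>
    carrier M \<noteq> {0} \<and> (\<forall>A B. internal_direct_sum G M A B \<longrightarrow> A = {0} \<or> B = {0})"

text \<open>
  Decompositions into indecomposables are sets, not families: the terms of a direct sum of nonzero
  submodules are pairwise distinct even when they are isomorphic.
\<close>

definition indecomposable_decomposition ::
  "('g, 'm) monoid_scheme \<Rightarrow> ('v::ab_group_add, 'k::field, 'g) gmodule \<Rightarrow> 'v set set \<Rightarrow> bool"
  where "indecomposable_decomposition G M \<D> \<longleftrightarrow>
    finite \<D> \<and>
    (\<forall>A \<in> \<D>. kG_submodule G M A \<and> indecomposable G (M\<lparr>carrier := A\<rparr>)) \<and>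
    (\<forall>v \<in> carrier M. \<exists>!f. f \<in> (\<Pi>\<^sub>E A \<in> \<D>. A) \<and> v = (\<Sum>A \<in> \<D>. f A))"

text \<open>
  The multiplicity of an indecomposable \<open>L\<close> in \<open>M\<close>: the number of terms isomorphic to \<open>L\<close> in a
  decomposition of \<open>M\<close> into indecomposables. For finite-dimensional \<open>M\<close> it exists and does not
  depend on the decomposition (Krull--Schmidt).
\<close>

definition summand_multiplicity ::
  "('g, 'm) monoid_scheme \<Rightarrow> ('v::ab_group_add, 'k::field, 'g) gmodule \<Rightarrow>
    ('w::ab_group_add, 'k, 'g) gmodule \<Rightarrow> nat"
  where "summand_multiplicity G M L = (THE n. \<exists>\<D>. indecomposable_decomposition G M \<D> \<and>
    card {A \<in> \<D>. kG_isomorphic G (M\<lparr>carrier := A\<rparr>) L} = n)"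

text \<open>The isomorphism types represented in a set \<open>\<S>\<close> of submodules of \<open>M\<close>.\<close>

definition iso_types ::
  "('g, 'm) monoid_scheme \<Rightarrow> ('v::ab_group_add, 'k::field, 'g) gmodule \<Rightarrow> 'v set set \<Rightarrow> 'v set set set"
  where "iso_types G M \<S> = \<S> // {(A, B). A \<in> \<S> \<and> B \<in> \<S> \<and>
    kG_isomorphic G (M\<lparr>carrier := A\<rparr>) (M\<lparr>carrier := B\<rparr>)}"


section \<open>Permutation modules, projectivity, vertices\<close>

text \<open>
  An element of \<open>k\<Omega>\<close> is its coefficient function, extended by zero outside \<open>\<Omega>\<close>; thus a group
  element \<open>g\<close> maps the basis element \<open>\<omega>\<close> to the basis element \<open>\<phi> g \<omega>\<close>.
\<close>

definition perm_module ::
  "('g, 'm) monoid_scheme \<Rightarrow> 'a set \<Rightarrow> ('g \<Rightarrow> 'a \<Rightarrow> 'a) \<Rightarrow> ('a \<Rightarrow> 'k::field, 'k, 'g) gmodule"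
  where "perm_module G \<Omega> \<phi> =
    \<lparr>carrier = {f. \<forall>\<omega>. \<omega> \<notin> \<Omega> \<longrightarrow> f \<omega> = 0},
     mscale = (\<lambda>c f \<omega>. c * f \<omega>),
     mact = (\<lambda>g f \<omega>. if \<omega> \<in> \<Omega> then f (\<phi> (inv\<^bsub>G\<^esub> g) \<omega>) else 0)\<rparr>"

lemma perm_module_kG_module:
  fixes G :: "('g, 'm) monoid_scheme"
  assumes G: "group G" and closed: "\<And>g x. g \<in> carrier G \<Longrightarrow> x \<in> \<Omega> \<Longrightarrow> \<phi> g x \<in> \<Omega>"
   and one: "\<And>x. x \<in> \<Omega> \<Longrightarrow> \<phi> \<one>\<^bsub>G\<^esub> x = x"
   and mult: "\<And>g h x. g \<in> carrier G \<Longrightarrow> h \<in> carrier G \<Longrightarrow> x \<in> \<Omega> \<Longrightarrow> \<phi> (g \<otimes>\<^bsub>G\<^esub> h) x = \<phi> g (\<phi> h x)"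
  shows "kG_module G (perm_module G \<Omega> \<phi> :: ('a \<Rightarrow> 'k::field, 'k, 'g) gmodule)"
proof -
  interpret group G by fact
  let ?M = "perm_module G \<Omega> \<phi> :: ('a \<Rightarrow> 'k::field, 'k, 'g) gmodule"
  interpret V: vector_space "mscale ?M"
    by unfold_locales (auto simp: perm_module_def fun_eq_iff algebra_simps)
  have "V.subspace (carrier ?M)"
    unfolding V.subspace_def by (auto simp: perm_module_def)
  then show ?thesis
    by unfold_locales (auto simp: perm_module_def fun_eq_iff closed one mult inv_mult_group)
qed

lemma group_action_kG_module:
  fixes G :: "('g, 'm) monoid_scheme" and \<Omega> :: "'a set"
  assumes "group_action G \<Omega> \<phi>"
  shows "kG_module G (perm_module G \<Omega> \<phi> :: ('a \<Rightarrow> 'k::field, 'k, 'g) gmodule)"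
proof -
  interpret group_action G \<Omega> \<phi> by fact
  show ?thesis
  proof (rule perm_module_kG_module)
    show "group G" by (rule group_hom.axioms(1)[OF group_hom])
    show "\<phi> g x \<in> \<Omega>" if "g \<in> carrier G" "x \<in> \<Omega>" for g x
      using element_image that by blast
    show "\<phi> \<one>\<^bsub>G\<^esub> x = x" if "x \<in> \<Omega>" for x
      using fun_cong[OF id_eq_one, of x] that by simp
    show "\<phi> (g \<otimes>\<^bsub>G\<^esub> h) x = \<phi> g (\<phi> h x)"
      if "g \<in> carrier G" "h \<in> carrier G" "x \<in> \<Omega>" for g h x
      using composition_rule that by blast
  qed
qed

text \<open>The free \<open>kG\<close>-module \<open>(kG)\<^sup>n\<close>, with \<open>kG\<close>-basis indexed by \<open>{..<n}\<close>.\<close>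

definition free_module ::
  "('g, 'm) monoid_scheme \<Rightarrow> nat \<Rightarrow> (nat \<times> 'g \<Rightarrow> 'k::field, 'k, 'g) gmodule"
  where "free_module G n =
    perm_module G ({..<n} \<times> carrier G) (\<lambda>g (i, x). (i, g \<otimes>\<^bsub>G\<^esub> x))"

lemma kG_module_free_module:
  assumes "group G"
  shows "kG_module G (free_module G n :: (nat \<times> 'g \<Rightarrow> 'k::field, 'k, 'g) gmodule)"
proof -
  interpret group G by fact
  show ?thesis
    unfolding free_module_def by (rule perm_module_kG_module) (auto simp: m_assoc)
qed

text \<open>Projectivity of a finitely generated module; for such modules finite rank is no restriction.\<close>

definition projective ::
  "('g, 'm) monoid_scheme \<Rightarrow> ('v::ab_group_add, 'k::field, 'g) gmodule \<Rightarrow> bool"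
  where "projective G M \<longleftrightarrow>
    (\<exists>n. isomorphic_to_summand G M (free_module G n :: (nat \<times> 'g \<Rightarrow> 'k, 'k, 'g) gmodule))"

text \<open>
  The module induced to \<open>G\<close> from a module \<open>V\<close> for a subgroup \<open>H\<close>, for finite \<open>G\<close>: an element
  \<open>F\<close> stands for the sum of \<open>t \<otimes> F t\<close>, \<open>t\<close> running over representatives of the cosets \<open>tH\<close>,
  in the tensor product of \<open>kG\<close> and \<open>V\<close> over \<open>kH\<close>.
\<close>

definition induced_module ::
  "('g, 'm) monoid_scheme \<Rightarrow> 'g set \<Rightarrow> ('v::ab_group_add, 'k::field, 'g) gmodule \<Rightarrow>
    ('g \<Rightarrow> 'v, 'k, 'g) gmodule"
  where "induced_module G H V =
    \<lparr>carrier = {F. (\<forall>x \<in> carrier G. F x \<in> carrier V) \<and> (\<forall>x. x \<notin> carrier G \<longrightarrow> F x = 0) \<and>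
       (\<forall>x \<in> carrier G. \<forall>h \<in> H. F (x \<otimes>\<^bsub>G\<^esub> h) = mact V (inv\<^bsub>G\<^esub> h) (F x))},
     mscale = (\<lambda>c F x. mscale V c (F x)),
     mact = (\<lambda>g F x. if x \<in> carrier G then F (inv\<^bsub>G\<^esub> g \<otimes>\<^bsub>G\<^esub> x) else 0)\<rparr>"

lemma induced_kG_module:
  fixes V :: "('v::ab_group_add, 'k::field, 'g) gmodule"
  assumes G: "group G" and H: "subgroup H G" and V: "kG_module (G\<lparr>carrier := H\<rparr>) V"
  shows "kG_module G (induced_module G H V)"
proof -
  interpret group G by fact
  interpret subgroup H G by fact
  interpret V: kG_module "G\<lparr>carrier := H\<rparr>" V by fact
  let ?M = "induced_module G H V"
  interpret M: vector_space "mscale ?M"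
    by unfold_locales (auto simp: induced_module_def fun_eq_iff V.scale_right_distrib V.scale_left_distrib)
  have z: "mact V g 0 = 0" if "g \<in> H" for g
    using V.act_add[of g 0 0] that V.subspace_0[OF V.carrier_subspace] by simp
  have invH: "inv\<^bsub>G\<^esub> h \<in> H" if "h \<in> H" for h
    using that by simp
  have "M.subspace (carrier ?M)"
    using V.carrier_subspace unfolding M.subspace_def
    by (auto simp: induced_module_def V.subspace_def z V.act_add V.act_scale)
  moreover have "mact ?M g v \<in> carrier ?M" if "g \<in> carrier G" "v \<in> carrier ?M" for g v
    using that by (auto simp: induced_module_def simp flip: m_assoc)
  ultimately show ?thesis
    by unfold_locales (auto simp: induced_module_def fun_eq_iff m_assoc inv_mult_group)
qed

text \<open>
  \<open>M\<close> is relatively \<open>H\<close>-projective if it is a direct summand of a module induced from \<open>H\<close>.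
  That \<open>V\<close> lives on the same ambient type as \<open>M\<close> is no restriction: if \<open>M\<close> is a summand of any
  module induced from \<open>H\<close>, it is a summand of the one induced from its own restriction to \<open>H\<close>.
\<close>

definition relatively_projective ::
  "('g, 'm) monoid_scheme \<Rightarrow> 'g set \<Rightarrow> ('v::ab_group_add, 'k::field, 'g) gmodule \<Rightarrow> bool"
  where "relatively_projective G H M \<longleftrightarrow>
    (\<exists>V :: ('v, 'k, 'g) gmodule. kG_module (G\<lparr>carrier := H\<rparr>) V \<and>
      isomorphic_to_summand G M (induced_module G H V))"

definition is_vertex ::
  "('g, 'm) monoid_scheme \<Rightarrow> ('v::ab_group_add, 'k::field, 'g) gmodule \<Rightarrow> 'g set \<Rightarrow> bool"
  where "is_vertex G M Q \<longleftrightarrow>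
    subgroup Q G \<and> relatively_projective G Q M \<and>
    (\<forall>H. subgroup H G \<and> H \<subset> Q \<longrightarrow> \<not> relatively_projective G H M)"


section \<open>Stabilizers, closed subsets and fixed point sets\<close>

definition pointwise_stabilizer ::
  "('g, 'm) monoid_scheme \<Rightarrow> ('g \<Rightarrow> 'a \<Rightarrow> 'a) \<Rightarrow> 'a set \<Rightarrow> 'g set"
  where "pointwise_stabilizer G \<phi> X = {g \<in> carrier G. \<forall>x \<in> X. \<phi> g x = x}"

definition setwise_stabilizer ::
  "('g, 'm) monoid_scheme \<Rightarrow> ('g \<Rightarrow> 'a \<Rightarrow> 'a) \<Rightarrow> 'a set \<Rightarrow> 'g set"
  where "setwise_stabilizer G \<phi> X = {g \<in> carrier G. \<phi> g ` X = X}"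

definition fixed_points :: "'a set \<Rightarrow> ('g \<Rightarrow> 'a \<Rightarrow> 'a) \<Rightarrow> 'g set \<Rightarrow> 'a set"
  where "fixed_points \<Omega> \<phi> Q = {\<omega> \<in> \<Omega>. \<forall>g \<in> Q. \<phi> g \<omega> = \<omega>}"

definition sylow_subgroup_of ::
  "nat \<Rightarrow> ('g, 'm) monoid_scheme \<Rightarrow> 'g set \<Rightarrow> 'g set \<Rightarrow> bool"
  where "sylow_subgroup_of p G S Q \<longleftrightarrow>
    subgroup Q G \<and> Q \<subseteq> S \<and> card Q = p ^ multiplicity p (card S)"

definition closed_subset ::
  "nat \<Rightarrow> ('g, 'm) monoid_scheme \<Rightarrow> 'a set \<Rightarrow> ('g \<Rightarrow> 'a \<Rightarrow> 'a) \<Rightarrow> 'a set \<Rightarrow> bool"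
  where "closed_subset p G \<Omega> \<phi> X \<longleftrightarrow> X \<subseteq> \<Omega> \<and>
    (\<exists>Q. sylow_subgroup_of p G (pointwise_stabilizer G \<phi> X) Q \<and> fixed_points \<Omega> \<phi> Q = X)"

text \<open>The group \<open>M\<^sub>X = N\<^sub>X / S\<^sub>X\<close> and its action on \<open>X\<close>.\<close>

definition setwise_mod_pointwise ::
  "('g, 'm) monoid_scheme \<Rightarrow> ('g \<Rightarrow> 'a \<Rightarrow> 'a) \<Rightarrow> 'a set \<Rightarrow> 'g set monoid"
  where "setwise_mod_pointwise G \<phi> X =
    G\<lparr>carrier := setwise_stabilizer G \<phi> X\<rparr> Mod pointwise_stabilizer G \<phi> X"

definition quotient_action :: "('g \<Rightarrow> 'a \<Rightarrow> 'a) \<Rightarrow> 'a set \<Rightarrow> 'g set \<Rightarrow> 'a \<Rightarrow> 'a"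
  where "quotient_action \<phi> X C = (\<lambda>x \<in> X. the_elem ((\<lambda>g. \<phi> g x) ` C))"

lemma (in group_hom) image_kernel_coset:
  assumes "g \<in> carrier G"
  shows "h ` (kernel G H h #>\<^bsub>G\<^esub> g) = {h g}"
  using assms by (auto simp: kernel_def r_coset_def intro!: imageI)

lemma quotient_faithful:
  fixes G :: "('g, 'm) monoid_scheme"
  assumes "group_action G \<Omega> \<phi>" and X: "X \<subseteq> \<Omega>"
  shows "faithful_action (setwise_mod_pointwise G \<phi> X) X (quotient_action \<phi> X)"
proof -
  interpret group_action G \<Omega> \<phi> by fact
  interpret gh: group_hom G "BijGroup \<Omega>" \<phi> by (rule group_hom)
  interpret group G by (rule gh.G.group_axioms)
  note [simp del] = gh.hom_mult gh.hom_one gh.hom_inv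
  let ?N = "setwise_stabilizer G \<phi> X" let ?S = "pointwise_stabilizer G \<phi> X"
  have comp: "\<phi> (g \<otimes>\<^bsub>G\<^esub> h) x = \<phi> g (\<phi> h x)" if "g \<in> carrier G" "h \<in> carrier G" "x \<in> X" for g h x
    using composition_rule that X by blast
  have inv: "\<phi> (inv\<^bsub>G\<^esub> g) (\<phi> g x) = x" if "g \<in> carrier G" "x \<in> X" for g x
    using orbit_sym_aux[of g x] that X by auto
  have one: "\<phi> \<one>\<^bsub>G\<^esub> x = x" if "x \<in> X" for x
    using inv[of "\<one>\<^bsub>G\<^esub>" x] comp[of "\<one>\<^bsub>G\<^esub>" "\<one>\<^bsub>G\<^esub>" x] that by simp
  have N: "subgroup ?N G"
  proof
    fix g h assume g: "g \<in> ?N" "h \<in> ?N"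
    then have "\<phi> (g \<otimes>\<^bsub>G\<^esub> h) ` X = (\<lambda>x. \<phi> g (\<phi> h x)) ` X"
      by (intro image_cong) (auto simp: setwise_stabilizer_def comp)
    then have "\<phi> (g \<otimes>\<^bsub>G\<^esub> h) ` X = \<phi> g ` (\<phi> h ` X)"
      by (simp add: image_image)
    with g show "g \<otimes>\<^bsub>G\<^esub> h \<in> ?N" by (auto simp: setwise_stabilizer_def)
  next
    show "\<one>\<^bsub>G\<^esub> \<in> ?N" by (simp add: setwise_stabilizer_def one)
  next
    fix g assume g: "g \<in> ?N"
    then have gX: "g \<in> carrier G" "\<phi> g ` X = X" by (auto simp: setwise_stabilizer_def)
    have "\<phi> (inv\<^bsub>G\<^esub> g) ` (\<phi> g ` X) = (\<lambda>x. x) ` X"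
      unfolding image_image using gX by (intro image_cong) (auto simp: inv)
    then have "\<phi> (inv\<^bsub>G\<^esub> g) ` X = X" by (simp add: gX)
    then show "inv\<^bsub>G\<^esub> g \<in> ?N" using g by (auto simp: setwise_stabilizer_def)
  qed (auto simp: setwise_stabilizer_def)
  interpret N: group "G\<lparr>carrier := ?N\<rparr>" using N by (rule subgroup.subgroup_is_group) (rule gh.G.group_axioms)
  define f where "f g = (\<lambda>x\<in>X. \<phi> g x)" for g
  have inj: "inj_on (\<phi> g) X" if "g \<in> carrier G" for g
    using inj_prop[OF that] X by (rule inj_on_subset)
  have f: "f \<in> hom (G\<lparr>carrier := ?N\<rparr>) (BijGroup X)"
  proof (rule homI)
    fix g assume "g \<in> carrier (G\<lparr>carrier := ?N\<rparr>)"
    then show "f g \<in> carrier (BijGroup X)"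
      by (auto simp: f_def BijGroup_def Bij_def bij_betw_def setwise_stabilizer_def inj inj_on_restrict_eq)
  next
    fix g h assume g: "g \<in> carrier (G\<lparr>carrier := ?N\<rparr>)" and h: "h \<in> carrier (G\<lparr>carrier := ?N\<rparr>)"
    have fB: "f g \<in> Bij X" "f h \<in> Bij X" using g h
      by (auto simp: f_def Bij_def bij_betw_def setwise_stabilizer_def inj inj_on_restrict_eq)
    have "\<phi> h x \<in> X" if "x \<in> X" for x using h that by (auto simp: setwise_stabilizer_def)
    with g h show "f (g \<otimes>\<^bsub>G\<lparr>carrier := ?N\<rparr>\<^esub> h) = f g \<otimes>\<^bsub>BijGroup X\<^esub> f h"
      using fB by (auto simp: BijGroup_def compose_def f_def comp setwise_stabilizer_def fun_eq_iff)
  qed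
  interpret f: group_hom "G\<lparr>carrier := ?N\<rparr>" "BijGroup X" f
    using f N.group_axioms group_BijGroup by (simp add: group_hom_def group_hom_axioms_def)
  have ker: "kernel (G\<lparr>carrier := ?N\<rparr>) (BijGroup X) f = ?S"
    by (auto simp: kernel_def f_def BijGroup_def setwise_stabilizer_def pointwise_stabilizer_def fun_eq_iff split: if_splits)
      
  let ?M = "setwise_mod_pointwise G \<phi> X"
  have M: "?M = (G\<lparr>carrier := ?N\<rparr>) Mod kernel (G\<lparr>carrier := ?N\<rparr>) (BijGroup X) f"
    by (simp add: ker setwise_mod_pointwise_def)
  have eq: "quotient_action \<phi> X C = the_elem (f ` C)" if C: "C \<in> carrier ?M" for C
  proof -
    from C obtain g where g: "g \<in> carrier (G\<lparr>carrier := ?N\<rparr>)"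
        and Cg: "C = kernel (G\<lparr>carrier := ?N\<rparr>) (BijGroup X) f #>\<^bsub>G\<lparr>carrier := ?N\<rparr>\<^esub> g"
      unfolding M by (auto simp: FactGroup_def RCOSETS_def)
    then have fC: "f ` C = {f g}"
      using f.image_kernel_coset[OF g] by simp
    then have "(\<lambda>g. \<phi> g x) ` C = {\<phi> g x}" if "x \<in> X" for x
    proof -
      have "(\<lambda>g. \<phi> g x) ` C = (\<lambda>h. h x) ` (f ` C)" using that by (auto simp: f_def image_iff)
      then show ?thesis using fC that by (simp add: f_def)
    qed
    then show ?thesis using fC by (auto simp: quotient_action_def f_def fun_eq_iff)
  qed
  have Mgrp: "group ?M"
    unfolding M by (rule normal.factorgroup_is_group[OF f.normal_kernel])
  have "quotient_action \<phi> X \<in> hom ?M (BijGroup X)"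
    using group.hom_restrict[OF Mgrp, of "\<lambda>C. the_elem (f ` C)" "BijGroup X" "quotient_action \<phi> X"]
      f.FactGroup_hom eq unfolding M by auto
  moreover have "inj_on (quotient_action \<phi> X) (carrier ?M)"
    using f.FactGroup_inj_on eq by (simp add: inj_on_def M)
  ultimately show ?thesis
    using Mgrp group_BijGroup
    by (simp add: faithful_action_def faithful_action_axioms_def group_action_def group_hom_def
        group_hom_axioms_def)
qed
definition admits_fixed_point_set ::
  "('g, 'm) monoid_scheme \<Rightarrow> 'a set \<Rightarrow> ('g \<Rightarrow> 'a \<Rightarrow> 'a) \<Rightarrow>
    ('v::ab_group_add, 'k::field, 'g) gmodule \<Rightarrow> 'a set \<Rightarrow> bool"
  where "admits_fixed_point_set G \<Omega> \<phi> M X \<longleftrightarrow>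
    (\<exists>Q. is_vertex G M Q \<and> fixed_points \<Omega> \<phi> Q = X)"

definition fixed_point_set_summands ::
  "('g, 'm) monoid_scheme \<Rightarrow> 'a set \<Rightarrow> ('g \<Rightarrow> 'a \<Rightarrow> 'a) \<Rightarrow> 'a set \<Rightarrow> ('a \<Rightarrow> 'k::field) set set"
  where "fixed_point_set_summands G \<Omega> \<phi> X =
    (let k\<Omega> = (perm_module G \<Omega> \<phi> :: ('a \<Rightarrow> 'k, 'k, 'g) gmodule)
     in {A. direct_summand G k\<Omega> A \<and> indecomposable G (k\<Omega>\<lparr>carrier := A\<rparr>) \<and>
            admits_fixed_point_set G \<Omega> \<phi> (k\<Omega>\<lparr>carrier := A\<rparr>) X})"

definition projective_indecomposable_summands ::
  "('g, 'm) monoid_scheme \<Rightarrow> ('v::ab_group_add, 'k::field, 'g) gmodule \<Rightarrow> 'v set set"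
  where "projective_indecomposable_summands G M =
    {A. direct_summand G M A \<and> indecomposable G (M\<lparr>carrier := A\<rparr>) \<and>
        projective G (M\<lparr>carrier := A\<rparr>)}"

end

theory Submission
  imports Defs "HOL-Algebra.Sylow"
begin

text \<open>
  The proof works with endomorphism algebras. An endomorphism of \<open>k\<Omega>\<close> is an \<open>\<Omega> \<times> \<Omega>\<close> matrix
  that is constant on the \<open>G\<close>-orbits of \<open>\<Omega> \<times> \<Omega>\<close>; let \<open>E\<close> be the algebra of these matrices and
  \<open>E'\<close> the algebra of \<open>M\<^sub>X\<close>-invariant \<open>X \<times> X\<close> matrices. Direct summands are images of
  idempotents, indecomposable ones belong to primitive idempotents, and two of them are isomorphic
  exactly if the idempotents \<open>e\<close>, \<open>f\<close> are equivalent, that is \<open>e = u v\<close> and \<open>f = v u\<close>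
  (\<open>isomorphic_iff_equivalent\<close>, \<open>indecomposable_iff_primitive\<close>).

  Let \<open>S\<close> be the pointwise stabilizer of \<open>X\<close> and \<open>Q\<close> a Sylow subgroup of it. Since \<open>Q\<close> is a
  \<open>p\<close>-group with \<open>X\<close> as its set of fixed points, every sum over \<open>\<Omega>\<close> of a function that is constant
  on the \<open>Q\<close>-orbits equals the sum over \<open>X\<close>. Hence restricting a matrix to \<open>X \<times> X\<close> is a ring
  homomorphism from \<open>E\<close> to \<open>E'\<close>: the Brauer homomorphism, written in the permutation basis
  (\<open>restr_mult\<close>). It is not surjective in general. But the same counting, applied to the action of \<open>Q\<close> on the
  cosets of \<open>S\<close>, shows that it maps the ideal \<open>J\<close> of relative traces from \<open>S\<close> to \<open>G\<close> onto the
  ideal \<open>J'\<close> of relative traces from the trivial subgroup to \<open>M\<^sub>X\<close> (\<open>restr_image\<close>). The reason is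
  that a coset \<open>S g\<close> fixed by \<open>Q\<close> satisfies \<open>g Q g\<^sup>-\<^sup>1 \<subseteq> S\<close>, so that \<open>Q\<close> fixes \<open>g\<^sup>-\<^sup>1 X\<close> pointwise
  and therefore \<open>g\<^sup>-\<^sup>1 X = X\<close>.

  By Higman's criterion, an idempotent has an image that is projective relative to \<open>H\<close> exactly if it
  is a relative trace from \<open>H\<close> (\<open>relatively_projective_iff_rel_trace\<close>). So the
  idempotents in \<open>J'\<close> are those with projective image, and the primitive idempotents \<open>e\<close> of \<open>E\<close> whose image admits
  \<open>X\<close> as a fixed point set are those in \<open>J\<close> whose restriction is not zero
  (\<open>admits_fixed_point_set_iff\<close>). For if \<open>e\<close> is such an element of \<open>J\<close>, it is a trace from \<open>Q\<close>,
  because the index of \<open>Q\<close> in \<open>S\<close> is invertible in \<open>k\<close>, whereas traces from smaller groups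
  restrict to zero; so \<open>Q\<close> is a vertex. Conversely, if the restriction of \<open>e\<close> vanished, \<open>e\<close> would
  be a sum of traces from proper subgroups of its vertex, and the locality of \<open>e E e\<close> would make it
  a trace from one of them.

  What remains is ring theory (\<open>ideal_hom\<close>). If \<open>e \<in> J\<close> is primitive with nonzero restriction
  \<open>f\<close>, then \<open>e E e\<close> is a local ring mapped onto \<open>f E' f\<close>, because the latter is contained in
  \<open>J'\<close>. So \<open>f\<close> is primitive, and equations modulo the radicals can be moved between the
  two algebras. This gives the bijection on equivalence classes. It also preserves multiplicities,
  because the multiplicity of \<open>e\<close> is the largest \<open>n\<close> for which there are \<open>a\<^sub>1, \<dots>, a\<^sub>n\<close> in \<open>e E\<close>
  and \<open>b\<^sub>1, \<dots>, b\<^sub>n\<close> in \<open>E e\<close> with \<open>a\<^sub>i b\<^sub>j \<equiv> \<delta>\<^sub>i\<^sub>j e\<close> modulo the radical of \<open>e E e\<close>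
  (\<open>copies_iff_le_card\<close>), a condition on \<open>e E\<close>, \<open>E e\<close> and \<open>e E e\<close> only.
\<close>

section \<open>Primitive idempotents of finite-dimensional algebras\<close>

text \<open>
  The algebra is a subset \<open>E\<close> of an ambient type on which the product is associative and bilinear
  everywhere, so that ring identities need no membership conditions; the unit is neutral on \<open>E\<close> only.
  Matrices have this form: the product is defined for all functions of two arguments, but the unit
  matrix is neutral only for those that vanish outside the index set.
\<close>

locale fin_dim_algebra = vector_space scale
  for scale :: "'k::field \<Rightarrow> 'r::ab_group_add \<Rightarrow> 'r" +
  fixes mul :: "'r \<Rightarrow> 'r \<Rightarrow> 'r" (infixl "\<cdot>" 70)
    and E :: "'r set" and one :: 'r and T :: "'r set"
  assumes assoc: "(a \<cdot> b) \<cdot> c = a \<cdot> (b \<cdot> c)"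
    and distl: "a \<cdot> (b + c) = a \<cdot> b + a \<cdot> c"
    and distr: "(a + b) \<cdot> c = a \<cdot> c + b \<cdot> c"
    and scalel: "scale r a \<cdot> b = scale r (a \<cdot> b)"
    and scaler: "a \<cdot> scale r b = scale r (a \<cdot> b)"
    and subspace_E: "subspace E"
    and mult_closed: "a \<in> E \<Longrightarrow> b \<in> E \<Longrightarrow> a \<cdot> b \<in> E"
    and one_closed: "one \<in> E"
    and one_left: "a \<in> E \<Longrightarrow> one \<cdot> a = a"
    and one_right: "a \<in> E \<Longrightarrow> a \<cdot> one = a"
    and finite_T: "finite T" and E_span: "E \<subseteq> span T"
begin

lemma zero_left [simp]: "0 \<cdot> a = 0"
  using distr[of 0 0 a] by simp

lemma zero_right [simp]: "a \<cdot> 0 = 0"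
  using distl[of a 0 0] by simp

lemma minus_left: "(- a) \<cdot> b = - (a \<cdot> b)"
  using distr[of a "- a" b] by (simp add: eq_neg_iff_add_eq_0 add.commute)

lemma minus_right: "a \<cdot> (- b) = - (a \<cdot> b)"
  using distl[of a b "- b"] by (simp add: eq_neg_iff_add_eq_0 add.commute)

lemma diff_left: "(a - b) \<cdot> c = a \<cdot> c - b \<cdot> c"
  using distr[of a "- b" c] by (simp add: minus_left)

lemma diff_right: "a \<cdot> (b - c) = a \<cdot> b - a \<cdot> c"
  using distl[of a b "- c"] by (simp add: minus_right)

lemma sum_left: "sum f S \<cdot> a = (\<Sum>i\<in>S. f i \<cdot> a)"
  by (induction S rule: infinite_finite_induct) (auto simp: distr)

lemma sum_right: "a \<cdot> sum f S = (\<Sum>i\<in>S. a \<cdot> f i)"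
  by (induction S rule: infinite_finite_induct) (auto simp: distl)

lemmas E_zero = subspace_0[OF subspace_E]
  and E_diff = subspace_diff[OF subspace_E]
  and E_sum = subspace_sum[OF subspace_E]

primrec pw :: "'r \<Rightarrow> nat \<Rightarrow> 'r" where
  "pw a 0 = one"
| "pw a (Suc n) = a \<cdot> pw a n"

lemma pw_closed: "a \<in> E \<Longrightarrow> pw a n \<in> E"
  by (induction n) (auto simp: one_closed mult_closed)

lemma pw_commute: "a \<in> E \<Longrightarrow> b \<in> E \<Longrightarrow> a \<cdot> b = b \<cdot> a \<Longrightarrow> pw a n \<cdot> b = b \<cdot> pw a n"
proof (induction n)
  case (Suc n)
  then show ?case by simp (metis assoc)
qed (simp add: one_left one_right)

lemma pw_add: "a \<in> E \<Longrightarrow> pw a (m + n) = pw a m \<cdot> pw a n"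
  by (induction m) (auto simp: one_left pw_closed assoc)

lemma pw_mult:
  assumes "a \<in> E" "b \<in> E" "a \<cdot> b = b \<cdot> a"
  shows "pw (a \<cdot> b) n = pw a n \<cdot> pw b n"
proof (induction n)
  case (Suc n)
  have "pw (a \<cdot> b) (Suc n) = a \<cdot> (b \<cdot> pw a n) \<cdot> pw b n" by (simp add: Suc assoc)
  also have "b \<cdot> pw a n = pw a n \<cdot> b" using pw_commute assms by simp
  finally show ?case by (simp add: assoc)
qed (simp add: one_left one_closed)

text \<open>
  The ring-theoretic form of Fitting's lemma: as the powers of \<open>a\<close> are linearly dependent, some
  power satisfies \<open>a\<^sup>m = a\<^sup>m\<^sup>+\<^sup>1 q\<close> with \<open>q\<close> a polynomial in \<open>a\<close>. Iterating, a power \<open>b\<close> of \<open>a\<close>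
  has a commuting \<open>u\<close> with \<open>b u b = b\<close>, and \<open>b u\<close> is the idempotent that projects onto the part
  where \<open>a\<close> is invertible.
\<close>

lemma pi_regular:
  assumes a: "a \<in> E"
  obtains n u where "u \<in> E" "a \<cdot> u = u \<cdot> a" "pw a (Suc n) \<cdot> u \<cdot> pw a (Suc n) = pw a (Suc n)"
proof -
  let ?P = "{x \<in> E. a \<cdot> x = x \<cdot> a}"
  have P: "subspace ?P"
    using subspace_E unfolding subspace_def by (auto simp: distl distr scalel scaler)
  have pwP: "pw a i \<in> ?P" for i
    using pw_commute[OF a a refl] by (simp add: pw_closed a)
  \<comment> \<open>By linear dependence some power lies in the span of the higher powers.\<close>
  have "\<exists>m. pw a m \<in> span (pw a ` {m<..})"
  proof (rule ccontr)
    assume "\<not> ?thesis"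
    then have neg: "pw a m \<notin> span (pw a ` {m<..})" for m by blast
    have inj: "inj (pw a)"
    proof (rule linorder_injI)
      fix i j :: nat assume "i < j"
      then have "pw a j \<in> span (pw a ` {i<..})" by (intro span_base imageI) simp
      with neg[of i] show "pw a i \<noteq> pw a j" by metis
    qed
    have ind: "independent (pw a ` {m..m + N})" for m N
    proof (induction N arbitrary: m)
      case 0
      have "pw a m \<noteq> 0" using neg[of m] span_zero[of "pw a ` {m<..}"] by auto
      then show ?case by simp
    next
      case (Suc N)
      have "span (pw a ` {Suc m..Suc m + N}) \<subseteq> span (pw a ` {m<..})"
        by (intro span_mono image_mono) auto
      then have "pw a m \<notin> span (pw a ` {Suc m..Suc m + N})" using neg[of m] by blast
      moreover have "{m..m + Suc N} = insert m {Suc m..Suc m + N}" by auto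
      ultimately show ?case using Suc[of "Suc m"] by (simp add: independent_insert)
    qed
    have "pw a ` {0..0 + card T} \<subseteq> span T" using pwP E_span by auto
    then have "card (pw a ` {0..0 + card T}) \<le> card T"
      using independent_span_bound[OF finite_T ind[of 0 "card T"]] by blast
    then show False using inj by (simp add: card_image inj_on_subset)
  qed
  then obtain m where m: "pw a m \<in> span (pw a ` {m<..})" by blast
  let ?Q = "{x. \<exists>q\<in>?P. x = pw a m \<cdot> a \<cdot> q}"
  have "subspace ?Q"
  proof (rule subspaceI)
    show "0 \<in> ?Q" using subspace_0[OF P] by (auto intro!: bexI[of _ 0])
  next
    fix x y assume "x \<in> ?Q" "y \<in> ?Q"
    then obtain q q' where "q \<in> ?P" "x = pw a m \<cdot> a \<cdot> q" "q' \<in> ?P" "y = pw a m \<cdot> a \<cdot> q'" by blast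
    then show "x + y \<in> ?Q"
      using subspace_add[OF P, of q q'] by (auto simp: distl intro!: bexI[of _ "q + q'"])
  next
    fix c x assume "x \<in> ?Q"
    then obtain q where "q \<in> ?P" "x = pw a m \<cdot> a \<cdot> q" by blast
    then show "scale c x \<in> ?Q"
      using subspace_scale[OF P, of q c] by (auto simp: scaler intro!: bexI[of _ "scale c q"])
  qed
  moreover have "pw a ` {m<..} \<subseteq> ?Q"
  proof clarify
    fix i assume "m < i"
    then obtain j where "i = m + Suc j" using less_iff_Suc_add by auto
    then have "pw a i = pw a m \<cdot> a \<cdot> pw a j" using pw_add[OF a, of m "Suc j"] by (simp add: assoc)
    then show "\<exists>q\<in>?P. pw a i = pw a m \<cdot> a \<cdot> q" using pwP by blast
  qed
  ultimately have "pw a m \<in> ?Q" using m span_minimal by blast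
  then obtain q where q: "q \<in> ?P" "pw a m = pw a m \<cdot> a \<cdot> q" using m by blast
  define b where "b = pw a (Suc m)"
  define u where "u = pw q (Suc m)"
  have qa: "q \<in> E" "q \<cdot> a = a \<cdot> q" using q by auto
  have aqE: "a \<cdot> q \<in> E" using qa a mult_closed by blast
  have bE: "b \<in> E" unfolding b_def by (rule pw_closed[OF a])
  have b: "b = b \<cdot> (a \<cdot> q)"
  proof -
    have "b = a \<cdot> pw a m" by (simp add: b_def)
    also have "\<dots> = a \<cdot> (pw a m \<cdot> a \<cdot> q)" by (rule arg_cong[OF q(2)])
    also have "\<dots> = b \<cdot> (a \<cdot> q)" by (simp add: assoc b_def)
    finally show ?thesis .
  qed
  have bk: "b = b \<cdot> pw (a \<cdot> q) k" for k
  proof (induction k)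
    case (Suc k)
    have "b \<cdot> pw (a \<cdot> q) (Suc k) = (b \<cdot> (a \<cdot> q)) \<cdot> pw (a \<cdot> q) k" by (simp add: assoc)
    also have "\<dots> = b \<cdot> pw (a \<cdot> q) k" by (rule arg_cong[OF b[symmetric], of "\<lambda>x. x \<cdot> pw (a \<cdot> q) k"])
    also have "\<dots> = b" by (rule Suc[symmetric])
    finally show ?case by (rule sym)
  qed (simp add: one_right bE)
  have u: "u \<in> E" "a \<cdot> u = u \<cdot> a"
    unfolding u_def using pw_closed[OF qa(1), of "Suc m"] pw_commute[OF qa(1) a qa(2), of "Suc m"]
    by (simp_all only:)
  have bu: "b \<cdot> u = u \<cdot> b" unfolding b_def by (rule pw_commute[OF a u(1) u(2)])
  have aqm: "pw (a \<cdot> q) (Suc m) = b \<cdot> u"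
    unfolding b_def u_def by (rule pw_mult[OF a qa(1) qa(2)[symmetric]])
  have "b \<cdot> u \<cdot> b = b \<cdot> (u \<cdot> b)" by (rule assoc)
  also have "\<dots> = b \<cdot> pw (a \<cdot> q) (Suc m)" by (simp only: aqm bu)
  also have "\<dots> = b" by (rule bk[symmetric])
  finally show thesis using that[of u m] u unfolding b_def by blast
qed

definition corner :: "'r \<Rightarrow> 'r set" where
  "corner e = {x \<in> E. e \<cdot> x = x \<and> x \<cdot> e = x}"

definition idempotent :: "'r \<Rightarrow> bool" where
  "idempotent e \<longleftrightarrow> e \<in> E \<and> e \<cdot> e = e"

definition primitive :: "'r \<Rightarrow> bool" where
  "primitive e \<longleftrightarrow> idempotent e \<and> e \<noteq> 0 \<and> (\<forall>d \<in> corner e. d \<cdot> d = d \<longrightarrow> d = 0 \<or> d = e)"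

text \<open>Idempotents with isomorphic images.\<close>

definition equivalent :: "'r \<Rightarrow> 'r \<Rightarrow> bool" where
  "equivalent e f \<longleftrightarrow> (\<exists>u\<in>E. \<exists>v\<in>E. u \<cdot> v = e \<and> v \<cdot> u = f)"

definition nonunits :: "'r \<Rightarrow> 'r set" where
  "nonunits e = {x \<in> corner e. \<nexists>y. y \<in> corner e \<and> x \<cdot> y = e \<and> y \<cdot> x = e}"

text \<open>Replacing \<open>u\<close> and \<open>v\<close> by \<open>u v u\<close> and \<open>v u v\<close> makes them maps between the images of \<open>e\<close> and \<open>f\<close>.\<close>

lemma equivalent_normalized:
  assumes "equivalent e f" "e \<cdot> e = e" "f \<cdot> f = f"
  obtains u v where "u \<in> E" "v \<in> E" "u \<cdot> v = e" "v \<cdot> u = f" "e \<cdot> u = u" "u \<cdot> f = u" "f \<cdot> v = v" "v \<cdot> e = v"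
proof -
  obtain u v where uv: "u \<in> E" "v \<in> E" "u \<cdot> v = e" "v \<cdot> u = f"
    using assms(1) unfolding equivalent_def by blast
  have eu: "e \<cdot> u = u \<cdot> f" using uv assoc by metis
  have fv: "f \<cdot> v = v \<cdot> e" using uv assoc by metis
  have 1: "(e \<cdot> u) \<cdot> (f \<cdot> v) = e" using uv assms eu fv assoc by metis
  have 2: "(f \<cdot> v) \<cdot> (e \<cdot> u) = f" using uv assms eu fv assoc by metis
  show thesis
  proof (rule that[of "e \<cdot> u" "f \<cdot> v"])
    show "e \<cdot> u \<in> E" "f \<cdot> v \<in> E" using uv mult_closed by blast+
    show "e \<cdot> (e \<cdot> u) = e \<cdot> u" "f \<cdot> (f \<cdot> v) = f \<cdot> v" using assms assoc by metis+
    show "e \<cdot> u \<cdot> f = e \<cdot> u" using eu assms assoc by metis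
    show "f \<cdot> v \<cdot> e = f \<cdot> v" using fv assms assoc by metis
  qed (fact 1 2)+
qed

lemma equivalent_refl: "idempotent e \<Longrightarrow> equivalent e e"
  unfolding equivalent_def idempotent_def by blast

lemma equivalent_sym: "equivalent e f \<Longrightarrow> equivalent f e"
  unfolding equivalent_def by blast

lemma equivalent_trans:
  assumes "equivalent e f" "equivalent f g" "idempotent e" "idempotent f" "idempotent g"
  shows "equivalent e g"
proof -
  obtain u v where uv: "u \<in> E" "v \<in> E" "u \<cdot> v = e" "v \<cdot> u = f" "e \<cdot> u = u" "u \<cdot> f = u" "f \<cdot> v = v" "v \<cdot> e = v"
    using equivalent_normalized assms unfolding idempotent_def by metis
  obtain s t where st: "s \<in> E" "t \<in> E" "s \<cdot> t = f" "t \<cdot> s = g" "f \<cdot> s = s" "s \<cdot> g = s" "g \<cdot> t = t" "t \<cdot> f = t"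
    using equivalent_normalized[of f g] assms unfolding idempotent_def by metis
  have "(u \<cdot> s) \<cdot> (t \<cdot> v) = e" using uv st assoc by metis
  moreover have "(t \<cdot> v) \<cdot> (u \<cdot> s) = g" using uv st assoc by metis
  ultimately show ?thesis unfolding equivalent_def using uv st mult_closed by blast
qed

lemma primitive_idempotent: "primitive e \<Longrightarrow> idempotent e"
  by (simp add: primitive_def)

lemma corner_mult: "x \<in> corner e \<Longrightarrow> y \<in> corner e \<Longrightarrow> x \<cdot> y \<in> corner e"
  unfolding corner_def using mult_closed by (auto simp: assoc) (metis assoc)

lemma corner_subspace: "subspace (corner e)"
  using subspace_E unfolding subspace_def corner_def by (auto simp: distl distr scalel scaler)

lemma corner_self: "idempotent e \<Longrightarrow> e \<in> corner e"
  by (simp add: idempotent_def corner_def)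

lemma pw_corner:
  assumes "x \<in> corner e" shows "pw x (Suc n) \<in> corner e"
proof (induction n)
  case 0
  show ?case using assms by (simp add: corner_def one_right)
next
  case (Suc n)
  then show ?case using corner_mult[OF assms Suc] by simp
qed

text \<open>
  The corner ring of a primitive idempotent is local: the idempotent attached to an element by
  Fitting's lemma must be \<open>0\<close> or \<open>e\<close>.
\<close>

lemma primitive_nilpotent:
  assumes e: "primitive e" and x: "x \<in> nonunits e"
  shows "\<exists>n. pw x (Suc n) = 0"
proof -
  have xc: "x \<in> corner e" "x \<in> E" using x by (auto simp: nonunits_def corner_def)
  have ee: "e \<in> E" "e \<cdot> e = e" using e by (auto simp: primitive_def idempotent_def)
  obtain n u where u: "u \<in> E" "x \<cdot> u = u \<cdot> x" "pw x (Suc n) \<cdot> u \<cdot> pw x (Suc n) = pw x (Suc n)"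
    using pi_regular[OF xc(2)] by metis
  define b where "b = pw x (Suc n)"
  have b: "b \<in> corner e" "b \<in> E" "e \<cdot> b = b" "b \<cdot> e = b" using pw_corner[OF xc(1), of n] by (auto simp: b_def corner_def)
  have bu: "b \<cdot> u = u \<cdot> b" using pw_commute[OF xc(2) u(1) u(2), of "Suc n"] by (simp add: b_def)
  have bub: "b \<cdot> u \<cdot> b = b" using u(3) by (simp add: b_def)
  have "b \<cdot> u \<in> E" "e \<cdot> (b \<cdot> u) = b \<cdot> u" "b \<cdot> u \<cdot> e = b \<cdot> u" "b \<cdot> u \<cdot> (b \<cdot> u) = b \<cdot> u"
    using b u mult_closed bub bu by (auto simp: assoc) (metis assoc)+
  then have "b \<cdot> u = 0 \<or> b \<cdot> u = e" using e unfolding primitive_def corner_def by blast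
  then show ?thesis
  proof
    assume "b \<cdot> u = 0"
    then have "b = 0" using bub by simp
    then show ?thesis by (auto simp: b_def)
  next
    assume bue: "b \<cdot> u = e"
    let ?y = "e \<cdot> (pw x n \<cdot> u) \<cdot> e"
    have xe: "x \<cdot> e = x" "e \<cdot> x = x" using xc by (auto simp: corner_def)
    have "?y \<in> corner e" using ee u xc by (auto simp: corner_def mult_closed pw_closed) (metis assoc)+
    moreover have "x \<cdot> ?y = b \<cdot> u \<cdot> e" using xe by (simp add: b_def) (metis assoc)
    then have "x \<cdot> ?y = e" by (simp add: bue ee)
    moreover have "?y \<cdot> x = e \<cdot> (pw x n \<cdot> (u \<cdot> x))" using xe by (simp add: assoc)
    then have "?y \<cdot> x = e \<cdot> (pw x n \<cdot> x \<cdot> u)" by (simp add: assoc u(2))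
    then have "?y \<cdot> x = e" using pw_commute[OF xc(2) xc(2) refl, of n] bue ee by (simp add: b_def)
    ultimately show ?thesis using x unfolding nonunits_def by blast
  qed
qed

text \<open>
  One-sided inverses suffice: a nonunit is nilpotent, and a nilpotent element has no one-sided
  inverse because \<open>x y = e\<close> implies \<open>x\<^sup>n y\<^sup>n = e\<close>.
\<close>

lemma primitive_right_inverse:
  assumes e: "primitive e" and x: "x \<in> corner e" and y: "y \<in> corner e" and xy: "x \<cdot> y = e"
  shows "x \<notin> nonunits e" "y \<notin> nonunits e"
proof -
  have e0: "e \<noteq> 0" using e by (simp add: primitive_def)
  have c: "x \<in> E" "y \<in> E" "e \<cdot> x = x" "x \<cdot> e = x" "e \<cdot> y = y" "y \<cdot> e = y"
    using x y by (auto simp: corner_def)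
  have p: "pw x (Suc n) \<cdot> pw y (Suc n) = e" for n
  proof (induction n)
    case (Suc n)
    have "pw x (Suc (Suc n)) \<cdot> pw y (Suc (Suc n)) = pw x (Suc n) \<cdot> (x \<cdot> y) \<cdot> pw y (Suc n)"
      using pw_commute[OF c(1) c(1) refl, of "Suc n"] by (simp only: pw.simps) (metis assoc)
    also have "\<dots> = e" using Suc pw_corner[OF x, of n] xy by (simp add: corner_def)
    finally show ?case .
  qed (simp add: xy one_right c)
  show "x \<notin> nonunits e"
    using primitive_nilpotent[OF e] p e0 zero_left by metis
  show "y \<notin> nonunits e"
    using primitive_nilpotent[OF e] p e0 zero_right by metis
qed

lemma self_not_nonunit: "primitive e \<Longrightarrow> e \<notin> nonunits e"
  unfolding nonunits_def using corner_self primitive_idempotent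
  by (auto simp: primitive_def idempotent_def)

lemma nonunits_mult:
  assumes e: "primitive e" and x: "x \<in> nonunits e" and y: "y \<in> corner e"
  shows "x \<cdot> y \<in> nonunits e" "y \<cdot> x \<in> nonunits e"
proof -
  have xc: "x \<in> corner e" using x by (simp add: nonunits_def)
  show "x \<cdot> y \<in> nonunits e"
  proof (rule ccontr)
    assume "x \<cdot> y \<notin> nonunits e"
    then obtain z where "z \<in> corner e" "x \<cdot> y \<cdot> z = e"
      using corner_mult[OF xc y] by (auto simp: nonunits_def)
    then show False using primitive_right_inverse(1)[OF e xc corner_mult[OF y]] x by (simp add: assoc)
  qed
  show "y \<cdot> x \<in> nonunits e"
  proof (rule ccontr)
    assume "y \<cdot> x \<notin> nonunits e"
    then obtain z where "z \<in> corner e" "z \<cdot> (y \<cdot> x) = e"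
      using corner_mult[OF y xc] by (auto simp: nonunits_def)
    then show False using primitive_right_inverse(2)[OF e corner_mult[OF _ y] xc] x by (simp add: assoc)
  qed
qed

text \<open>The inverse is the geometric series, which ends.\<close>

lemma unit_minus_nilpotent:
  assumes e: "primitive e" and x: "x \<in> nonunits e"
  shows "e - x \<notin> nonunits e"
proof -
  have xc: "x \<in> corner e" using x by (simp add: nonunits_def)
  have ec: "e \<in> corner e" and ex: "e \<cdot> e = e" "e \<cdot> x = x" "x \<cdot> e = x" "x \<in> E"
    using e xc corner_self primitive_idempotent by (auto simp: corner_def idempotent_def)
  note add = subspace_add[OF corner_subspace] and diff = subspace_diff[OF corner_subspace]
  have "\<exists>y\<in>corner e. (e - x) \<cdot> y = e - pw x (Suc n)" for n
  proof (induction n)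
    case 0
    show ?case using ec ex by (auto simp: one_right diff_left intro!: bexI[of _ e])
  next
    case (Suc n)
    then obtain y where y: "y \<in> corner e" "(e - x) \<cdot> y = e - pw x (Suc n)" by blast
    have p: "e \<cdot> pw x (Suc n) = pw x (Suc n)" using pw_corner[OF xc, of n] by (simp add: corner_def)
    have "(e - x) \<cdot> (y + pw x (Suc n)) = e - pw x (Suc n) + (pw x (Suc n) - x \<cdot> pw x (Suc n))"
      using y p by (simp only: distl diff_left)
    then have "(e - x) \<cdot> (y + pw x (Suc n)) = e - pw x (Suc (Suc n))" by simp
    then show ?case using add[OF y(1) pw_corner[OF xc, of n]] by blast
  qed
  moreover obtain n where "pw x (Suc n) = 0" using primitive_nilpotent[OF e x] by blast
  ultimately obtain y where "y \<in> corner e" "(e - x) \<cdot> y = e" by (metis diff_zero)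
  then show ?thesis using primitive_right_inverse(1)[OF e diff[OF ec xc]] by blast
qed

lemma nonunits_add:
  assumes e: "primitive e" and x: "x \<in> nonunits e" and y: "y \<in> nonunits e"
  shows "x + y \<in> nonunits e"
proof (rule ccontr)
  assume neg: "x + y \<notin> nonunits e"
  have c: "x \<in> corner e" "y \<in> corner e" using x y by (auto simp: nonunits_def)
  have "x + y \<in> corner e" using subspace_add[OF corner_subspace] c by blast
  with neg obtain z where z: "z \<in> corner e" "(x + y) \<cdot> z = e" by (auto simp: nonunits_def)
  then have "y \<cdot> z = e - x \<cdot> z" by (simp add: distr algebra_simps)
  then show False
    using unit_minus_nilpotent[OF e nonunits_mult(1)[OF e x z(1)]] nonunits_mult(1)[OF e y z(1)] by simp
qed

lemma nonunits_zero:
  assumes e: "primitive e" shows "0 \<in> nonunits e"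
  using e subspace_0[OF corner_subspace] unfolding nonunits_def primitive_def by auto

lemma nonunits_neg: "primitive e \<Longrightarrow> x \<in> nonunits e \<Longrightarrow> - x \<in> nonunits e"
  using nonunits_mult(1)[of e x "- e"] subspace_neg[OF corner_subspace] corner_self primitive_idempotent
  by (auto simp: minus_right nonunits_def corner_def)

lemma nonunits_diff: "primitive e \<Longrightarrow> x \<in> nonunits e \<Longrightarrow> y \<in> nonunits e \<Longrightarrow> x - y \<in> nonunits e"
  using nonunits_add[of e x "- y"] nonunits_neg by simp

lemma nonunits_sum:
  "primitive e \<Longrightarrow> (\<And>i. i \<in> S \<Longrightarrow> f i \<in> nonunits e) \<Longrightarrow> sum f S \<in> nonunits e"
  by (induction S rule: infinite_finite_induct) (auto simp: nonunits_zero nonunits_add)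

text \<open>
  The identity matrix of size \<open>card I\<close> cannot factor through a free module of smaller rank over the
  corner ring of \<open>e\<close>, even if the factorization holds only modulo the radical. The induction
  eliminates one column of \<open>A\<close>: if it is zero modulo the radical it is dropped, otherwise a unit in
  it serves as the pivot.
\<close>

lemma local_rank_bound:
  assumes e: "primitive e" and "finite C" "finite I"
    and "\<And>i l. i \<in> I \<Longrightarrow> l \<in> C \<Longrightarrow> A i l \<in> corner e"
    and "\<And>l j. l \<in> C \<Longrightarrow> j \<in> I \<Longrightarrow> B l j \<in> corner e"
    and "\<And>i j. i \<in> I \<Longrightarrow> j \<in> I \<Longrightarrow> (\<Sum>l\<in>C. A i l \<cdot> B l j) - (if i = j then e else 0) \<in> nonunits e"
  shows "card I \<le> card C"
  using assms(2-)
proof (induction C arbitrary: I A)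
  case empty
  have "I = {}"
  proof (rule ccontr)
    assume "I \<noteq> {}"
    then obtain i where "i \<in> I" by blast
    then have "- e \<in> nonunits e" using empty(4)[of i i] by simp
    then show False using nonunits_neg[OF e] self_not_nonunit[OF e] by fastforce
  qed
  then show ?case by simp
next
  case (insert m C)
  note A = insert.prems(2) and B = insert.prems(3) and AB = insert.prems(4)
  have S: "(\<Sum>l\<in>insert m C. A i l \<cdot> B l j) = A i m \<cdot> B m j + (\<Sum>l\<in>C. A i l \<cdot> B l j)" for i j
    using insert.hyps by simp
  show ?case
  proof (cases "\<forall>i\<in>I. A i m \<in> nonunits e")
    case True
    have "(\<Sum>l\<in>C. A i l \<cdot> B l j) - (if i = j then e else 0) \<in> nonunits e" if ij: "i \<in> I" "j \<in> I" for i j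
    proof -
      have "A i m \<cdot> B m j \<in> nonunits e" using nonunits_mult(1)[OF e] True B ij by blast
      from nonunits_diff[OF e AB[OF ij] this] show ?thesis
        unfolding S by (simp add: algebra_simps)
    qed
    then have "card I \<le> card C" using insert.IH[of I A] insert.prems(1) A B by auto
    then show ?thesis using insert.hyps by simp
  next
    case False
    then obtain r where r: "r \<in> I" "A r m \<notin> nonunits e" by blast
    then obtain y where y: "y \<in> corner e" "y \<cdot> A r m = e" using A by (auto simp: nonunits_def)
    \<comment> \<open>Subtract multiples of the pivot row \<open>r\<close> so that column \<open>m\<close> vanishes; row \<open>r\<close> is given up.\<close>
    define A' where "A' i l = A i l - A i m \<cdot> (y \<cdot> A r l)" for i l
    have Am: "A i m \<cdot> e = A i m" if "i \<in> I" for i using A that by (auto simp: corner_def)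
    have "card (I - {r}) \<le> card C"
    proof (rule insert.IH)
      show "finite (I - {r})" using insert.prems(1) by simp
      show "A' i l \<in> corner e" if "i \<in> I - {r}" "l \<in> C" for i l
        unfolding A'_def using that r y A
        by (auto intro!: subspace_diff[OF corner_subspace] corner_mult)
      show "B l j \<in> corner e" if "l \<in> C" "j \<in> I - {r}" for l j using B that by auto
      show "(\<Sum>l\<in>C. A' i l \<cdot> B l j) - (if i = j then e else 0) \<in> nonunits e"
        if "i \<in> I - {r}" "j \<in> I - {r}" for i j
      proof -
        have ij: "i \<in> I" "j \<in> I" "j \<noteq> r" using that by auto
        have "A' i m = 0" using y(2) Am[OF ij(1)] by (simp add: A'_def)
        then have "(\<Sum>l\<in>C. A' i l \<cdot> B l j) = (\<Sum>l\<in>insert m C. A' i l \<cdot> B l j)"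
          using insert.hyps by simp
        also have "\<dots> = (\<Sum>l\<in>insert m C. A i l \<cdot> B l j) - A i m \<cdot> (y \<cdot> (\<Sum>l\<in>insert m C. A r l \<cdot> B l j))"
          by (simp only: A'_def diff_left sum_subtractf sum_right assoc)
        finally have eq: "(\<Sum>l\<in>C. A' i l \<cdot> B l j) - (if i = j then e else 0) =
            ((\<Sum>l\<in>insert m C. A i l \<cdot> B l j) - (if i = j then e else 0))
            - A i m \<cdot> (y \<cdot> (\<Sum>l\<in>insert m C. A r l \<cdot> B l j))" by (simp only: algebra_simps)
        have "(\<Sum>l\<in>insert m C. A r l \<cdot> B l j) \<in> nonunits e" using AB[OF r(1) ij(2)] ij(3) by simp
        then have "A i m \<cdot> (y \<cdot> (\<Sum>l\<in>insert m C. A r l \<cdot> B l j)) \<in> nonunits e"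
          using nonunits_mult(2)[OF e] y(1) A[OF ij(1)] by blast
        then show ?thesis unfolding eq using nonunits_diff[OF e AB[OF ij(1,2)]] by blast
      qed
    qed
    moreover have "card I = Suc (card (I - {r}))" using card_Suc_Diff1[OF insert.prems(1) r(1)] by simp
    ultimately show ?thesis using insert.hyps by simp
  qed
qed

text \<open>
  Without the radical the equations would say that the sum of \<open>n\<close> copies of the image of \<open>e\<close> is a
  direct summand. Asking for them modulo the radical only gives the same numbers \<open>n\<close>, and this
  form can be transported along a homomorphism that is surjective on \<open>e E\<close> and \<open>E e\<close>.
\<close>

definition copies :: "'r \<Rightarrow> nat \<Rightarrow> bool" where
  "copies e n \<longleftrightarrow> (\<exists>a b. (\<forall>i<n. a i \<in> E \<and> e \<cdot> a i = a i \<and> b i \<in> E \<and> b i \<cdot> e = b i) \<and>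
     (\<forall>i<n. \<forall>j<n. a i \<cdot> b j - (if i = j then e else 0) \<in> nonunits e))"

definition primitive_decomposition :: "'r set \<Rightarrow> bool" where
  "primitive_decomposition S \<longleftrightarrow> finite S \<and> (\<forall>e\<in>S. primitive e) \<and>
     (\<forall>e\<in>S. \<forall>f\<in>S. e \<noteq> f \<longrightarrow> e \<cdot> f = 0) \<and> sum id S = one"

text \<open>
  If the identity of the image of \<open>e\<close> factors through the image of \<open>f\<close>, the composite in the other
  order is a nonzero idempotent of the corner of \<open>f\<close>, hence \<open>f\<close> itself.
\<close>

lemma factor_equivalent:
  assumes e: "primitive e" and f: "primitive f"
    and a: "a \<in> E" "e \<cdot> a = a" and b: "b \<in> E" "b \<cdot> e = b"
    and nu: "a \<cdot> f \<cdot> b \<notin> nonunits e"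
  shows "equivalent f e"
proof -
  have ee: "e \<in> E" "e \<cdot> e = e" "e \<noteq> 0" using e by (auto simp: primitive_def idempotent_def)
  have ff: "f \<in> E" "f \<cdot> f = f" using f by (auto simp: primitive_def idempotent_def)
  have "a \<cdot> f \<cdot> b \<in> corner e" using a b ff mult_closed by (simp add: corner_def) (metis assoc)
  then obtain y where y: "y \<in> corner e" "a \<cdot> f \<cdot> b \<cdot> y = e" using nu by (auto simp: nonunits_def)
  define u where "u = a \<cdot> f"
  define v where "v = f \<cdot> (b \<cdot> y)"
  have y': "y \<in> E" "y \<cdot> e = y" using y by (auto simp: corner_def)
  have uv: "u \<in> E" "v \<in> E" "u \<cdot> v = e" "v \<cdot> e = v" "f \<cdot> v = v" "u \<cdot> f = u"
    using y a b ff y' mult_closed by (auto simp: u_def v_def) (metis assoc)+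
  have "v \<cdot> u \<in> corner f" using uv mult_closed by (simp add: corner_def) (metis assoc)
  moreover have "(v \<cdot> u) \<cdot> (v \<cdot> u) = v \<cdot> u" using uv by (metis assoc)
  ultimately have "v \<cdot> u = 0 \<or> v \<cdot> u = f" using f unfolding primitive_def by blast
  moreover have "v \<cdot> u \<noteq> 0"
  proof
    assume "v \<cdot> u = 0"
    then have "u \<cdot> v \<cdot> (u \<cdot> v) = 0" by (metis assoc zero_left zero_right)
    then show False using uv ee by simp
  qed
  ultimately show ?thesis unfolding equivalent_def using uv by blast
qed

text \<open>
  The Krull--Schmidt theorem: the left-hand side does not mention \<open>S\<close>, so the number of terms
  equivalent to \<open>e\<close> is the same for all decompositions. Inserting \<open>1 = \<Sum>S\<close> between \<open>a i\<close> and
  \<open>b j\<close>, the terms not equivalent to \<open>e\<close> contribute nonunits, and the others factor the identity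
  matrix through a free module whose rank is their number.
\<close>

theorem copies_iff_le_card:
  assumes S: "primitive_decomposition S" and e: "primitive e"
  shows "copies e n \<longleftrightarrow> n \<le> card {f \<in> S. equivalent f e}"
proof
  let ?C = "{f \<in> S. equivalent f e}"
  have fin: "finite S" and prim: "\<And>f. f \<in> S \<Longrightarrow> primitive f"
    and orth: "\<And>f g. f \<in> S \<Longrightarrow> g \<in> S \<Longrightarrow> f \<noteq> g \<Longrightarrow> f \<cdot> g = 0" and sum: "(\<Sum>f\<in>S. f) = one"
    using S by (auto simp: primitive_decomposition_def id_def)
  have ee: "e \<in> E" "e \<cdot> e = e" using e by (auto simp: primitive_def idempotent_def)
  define inverse_pair where "inverse_pair f u v \<longleftrightarrow> u \<in> E \<and> v \<in> E \<and> u \<cdot> v = e \<and> v \<cdot> u = f \<and>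
    e \<cdot> u = u \<and> u \<cdot> f = u \<and> f \<cdot> v = v \<and> v \<cdot> e = v" for f u v
  have "\<exists>u v. inverse_pair f u v" if "f \<in> ?C" for f
  proof -
    have "equivalent e f" "f \<cdot> f = f"
      using that prim[of f] equivalent_sym by (auto simp: primitive_def idempotent_def)
    then obtain u v where "u \<in> E" "v \<in> E" "u \<cdot> v = e" "v \<cdot> u = f" "e \<cdot> u = u" "u \<cdot> f = u" "f \<cdot> v = v" "v \<cdot> e = v"
      using equivalent_normalized ee(2) by blast
    then show ?thesis unfolding inverse_pair_def by blast
  qed
  then obtain u v where "\<And>f. f \<in> ?C \<Longrightarrow> inverse_pair f (u f) (v f)" by metis
  note uv = this[unfolded inverse_pair_def]
  {
    assume "copies e n"
    then obtain a b where ab: "\<And>i. i < n \<Longrightarrow> a i \<in> E \<and> e \<cdot> a i = a i \<and> b i \<in> E \<and> b i \<cdot> e = b i"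
      "\<And>i j. i < n \<Longrightarrow> j < n \<Longrightarrow> a i \<cdot> b j - (if i = j then e else 0) \<in> nonunits e"
      unfolding copies_def by blast
    have "card {..<n} \<le> card ?C"
    proof (rule local_rank_bound[OF e, where A = "\<lambda>i l. a i \<cdot> v l" and B = "\<lambda>l j. u l \<cdot> b j"])
      show "a i \<cdot> v l \<in> corner e" if "i \<in> {..<n}" "l \<in> ?C" for i l
        using ab(1)[of i] uv[OF that(2)] that(1) mult_closed by (simp add: corner_def) (metis assoc)
      show "u l \<cdot> b j \<in> corner e" if "l \<in> ?C" "j \<in> {..<n}" for l j
        using ab(1)[of j] uv[OF that(1)] that(2) mult_closed by (simp add: corner_def) (metis assoc)
      show "(\<Sum>l\<in>?C. (a i \<cdot> v l) \<cdot> (u l \<cdot> b j)) - (if i = j then e else 0) \<in> nonunits e"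
        if ij: "i \<in> {..<n}" "j \<in> {..<n}" for i j
      proof -
        have "a i \<cdot> b j = a i \<cdot> (\<Sum>f\<in>S. f) \<cdot> b j" using ab(1)[of i] ij one_right sum by simp
        also have "\<dots> = (\<Sum>f\<in>S. a i \<cdot> f \<cdot> b j)" by (simp add: sum_left sum_right)
        also have "\<dots> = (\<Sum>f\<in>S - ?C. a i \<cdot> f \<cdot> b j) + (\<Sum>f\<in>?C. a i \<cdot> f \<cdot> b j)"
          by (rule sum.subset_diff) (use fin in auto)
        also have "(\<Sum>f\<in>?C. a i \<cdot> f \<cdot> b j) = (\<Sum>l\<in>?C. (a i \<cdot> v l) \<cdot> (u l \<cdot> b j))"
          by (rule sum.cong[OF refl]) (metis uv assoc)
        finally have eq: "(\<Sum>l\<in>?C. (a i \<cdot> v l) \<cdot> (u l \<cdot> b j)) - (if i = j then e else 0)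
            = (a i \<cdot> b j - (if i = j then e else 0)) - (\<Sum>f\<in>S - ?C. a i \<cdot> f \<cdot> b j)" by simp
        have "(\<Sum>f\<in>S - ?C. a i \<cdot> f \<cdot> b j) \<in> nonunits e"
        proof (rule nonunits_sum[OF e])
          fix f assume "f \<in> S - ?C"
          then show "a i \<cdot> f \<cdot> b j \<in> nonunits e"
            using factor_equivalent[OF e prim[of f], of "a i" "b j"] ab(1)[of i] ab(1)[of j] ij by blast
        qed
        then show ?thesis unfolding eq using nonunits_diff[OF e ab(2)] ij by blast
      qed
    qed (use fin in auto)
    then show "n \<le> card ?C" by simp
  next
    assume n: "n \<le> card ?C"
    have "finite ?C" using fin by simp
    then obtain h where h: "bij_betw h {..<card ?C} ?C"
      using ex_bij_betw_nat_finite[of ?C] by (auto simp: atLeast0LessThan)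
    have hC: "h i \<in> ?C" if "i < n" for i using h n that by (auto simp: bij_betw_def)
    have hne: "h i \<noteq> h j" if "i < n" "j < n" "i \<noteq> j" for i j
      using h n that by (auto simp: bij_betw_def inj_on_def)
    have "u (h i) \<cdot> v (h j) = (if i = j then e else 0)" if "i < n" "j < n" for i j
    proof (cases "i = j")
      case False
      have "u (h i) \<cdot> v (h j) = u (h i) \<cdot> (h i \<cdot> h j) \<cdot> v (h j)"
        using uv[OF hC[OF that(1)]] uv[OF hC[OF that(2)]] by (metis assoc)
      then show ?thesis using orth[of "h i" "h j"] hC that hne[OF that False] False by simp
    qed (use uv hC that in auto)
    moreover have "u (h i) \<in> E \<and> e \<cdot> u (h i) = u (h i) \<and> v (h i) \<in> E \<and> v (h i) \<cdot> e = v (h i)" if "i < n" for i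
      using uv[OF hC[OF that]] by blast
    ultimately show "copies e n" unfolding copies_def
      using nonunits_zero[OF e] by (intro exI[of _ "\<lambda>i. u (h i)"] exI[of _ "\<lambda>i. v (h i)"]) auto
  }
qed

lemma orthogonal_idempotents_independent:
  assumes idem: "\<And>s. s \<in> S \<Longrightarrow> s \<cdot> s = s \<and> s \<noteq> 0"
    and orth: "\<And>s t. s \<in> S \<Longrightarrow> t \<in> S \<Longrightarrow> s \<noteq> t \<Longrightarrow> s \<cdot> t = 0"
  shows "independent S"
  unfolding dependent_explicit
proof (intro notI, elim exE conjE bexE)
  fix t u v assume t: "finite t" "t \<subseteq> S" and sum: "(\<Sum>v\<in>t. scale (u v) v) = 0"
    and v: "v \<in> t" "u v \<noteq> 0"
  have "0 = v \<cdot> (\<Sum>w\<in>t. scale (u w) w)" by (simp add: sum)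
  also have "\<dots> = (\<Sum>w\<in>t. scale (u w) (v \<cdot> w))" by (simp add: sum_right scaler)
  also have "\<dots> = (\<Sum>w\<in>t. if w = v then scale (u v) v else 0)"
    by (rule sum.cong[OF refl]) (use idem orth v t in \<open>auto simp: subset_iff\<close>)
  also have "\<dots> = scale (u v) v" using t v by simp
  finally show False using v idem t by auto
qed

text \<open>
  Orthogonal idempotents are linearly independent, so there is a decomposition of the unit with the
  largest possible number of terms. A term that is not primitive could be split in two.
\<close>

theorem primitive_decomposition_exists: "\<exists>S. primitive_decomposition S"
proof -
  define Q where "Q S \<longleftrightarrow> finite S \<and> (\<forall>s\<in>S. s \<in> E \<and> s \<cdot> s = s \<and> s \<noteq> 0) \<and>
     (\<forall>s\<in>S. \<forall>t\<in>S. s \<noteq> t \<longrightarrow> s \<cdot> t = 0) \<and> (\<Sum>s\<in>S. s) = one" for S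
  have ex: "Q (if one = 0 then {} else {one})"
    by (auto simp: Q_def one_closed one_left)
  have bound: "card S \<le> card T" if "Q S" for S
  proof -
    have "independent S" using that by (intro orthogonal_idempotents_independent) (auto simp: Q_def)
    then show ?thesis using independent_span_bound[OF finite_T, of S] E_span that by (auto simp: Q_def)
  qed
  obtain S where S: "Q S" and max: "\<And>S'. Q S' \<Longrightarrow> card S' \<le> card S"
    using ex_has_greatest_nat[of Q _ card "Suc (card T)"] ex bound by (metis le_imp_less_Suc)
  have "primitive e" if e: "e \<in> S" for e
    unfolding primitive_def
  proof (intro conjI ballI impI)
    show "idempotent e" "e \<noteq> 0" using S e by (auto simp: Q_def idempotent_def)
    fix d assume d: "d \<in> corner e" "d \<cdot> d = d"
    show "d = 0 \<or> d = e"
    proof (rule ccontr)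
      assume n: "\<not> (d = 0 \<or> d = e)"
      have dE: "d \<in> E" "e \<cdot> d = d" "d \<cdot> e = d" using d by (auto simp: corner_def)
      have fin: "finite S" and ee: "e \<in> E" "e \<cdot> e = e" and
        orth: "\<And>s t. s \<in> S \<Longrightarrow> t \<in> S \<Longrightarrow> s \<noteq> t \<Longrightarrow> s \<cdot> t = 0" and
        idem: "\<And>s. s \<in> S \<Longrightarrow> s \<in> E \<and> s \<cdot> s = s \<and> s \<noteq> 0" and sum: "(\<Sum>s\<in>S. s) = one"
        using S e by (auto simp: Q_def)
      have ds: "d \<cdot> s = 0" "s \<cdot> d = 0" if "s \<in> S - {e}" for s
        using dE orth[of e s] orth[of s e] e that assoc by (metis DiffD1 DiffD2 insertI1 zero_left zero_right)+
      let ?c = "e - d"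
      have c: "?c \<cdot> ?c = ?c" "d \<cdot> ?c = 0" "?c \<cdot> d = 0" "?c \<in> E" "?c \<noteq> 0"
        using dE d ee n E_diff by (auto simp: diff_left diff_right)
      have cs: "?c \<cdot> s = 0" "s \<cdot> ?c = 0" if "s \<in> S - {e}" for s
        using ds[OF that] orth[of e s] orth[of s e] e that by (auto simp: diff_left diff_right)
      have dS: "d \<notin> S - {e}" using ds(1)[of d] d(2) n by metis
      have cS: "?c \<notin> S - {e}" using cs(1)[of ?c] c(1,5) by metis
      have dc: "d \<noteq> ?c" using c d(2) n by auto
      let ?S = "insert d (insert ?c (S - {e}))"
      have "(\<Sum>s\<in>?S. s) = d + ?c + (\<Sum>s\<in>S - {e}. s)"
        using fin dS cS dc by (simp add: add.assoc)
      also have "\<dots> = one" using sum sum.remove[OF fin e, of "\<lambda>s. s"] by simp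
      finally have "Q ?S"
        unfolding Q_def using fin dE d n c ds cs orth idem by auto
      moreover have "card ?S = Suc (card S)"
      proof -
        have "card ?S = Suc (Suc (card (S - {e})))" using fin dS cS dc by simp
        then show ?thesis using card_Suc_Diff1[OF fin e] by simp
      qed
      ultimately show False using max by fastforce
    qed
  qed
  then have "primitive_decomposition S"
    using S unfolding primitive_decomposition_def Q_def id_def by blast
  then show ?thesis ..
qed

text \<open>
  Rosenberg's lemma: in the local corner ring of \<open>e\<close>, a sum of nonunits is a nonunit, so one of the
  terms \<open>e (x c) e\<close> is invertible and \<open>e\<close> is a multiple of it.
\<close>

lemma primitive_sum_ideals:
  assumes e: "primitive e" and fin: "finite C" and sum: "e = (\<Sum>c\<in>C. x c)"
    and ideal: "\<And>c a b. c \<in> C \<Longrightarrow> a \<in> E \<Longrightarrow> b \<in> E \<Longrightarrow> a \<cdot> x c \<cdot> b \<in> I c"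
    and x: "\<And>c. c \<in> C \<Longrightarrow> x c \<in> E"
  shows "\<exists>c\<in>C. e \<in> I c"
proof -
  have ee: "e \<in> E" "e \<cdot> e = e" using e by (auto simp: primitive_def idempotent_def)
  have "(\<Sum>c\<in>C. e \<cdot> x c \<cdot> e) = e \<cdot> (\<Sum>c\<in>C. x c) \<cdot> e" by (simp add: sum_left sum_right)
  also have "\<dots> = e \<cdot> e \<cdot> e" by (simp only: sum[symmetric])
  also have "\<dots> = e" by (simp only: ee)
  finally have "(\<Sum>c\<in>C. e \<cdot> x c \<cdot> e) \<notin> nonunits e" using self_not_nonunit[OF e] by simp
  then obtain c where c: "c \<in> C" "e \<cdot> x c \<cdot> e \<notin> nonunits e" using nonunits_sum[OF e, of C "\<lambda>c. e \<cdot> x c \<cdot> e"] by blast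
  have "e \<cdot> (e \<cdot> x c \<cdot> e) = e \<cdot> x c \<cdot> e" by (simp only: assoc[symmetric] ee)
  moreover have "e \<cdot> x c \<cdot> e \<cdot> e = e \<cdot> x c \<cdot> e" by (simp only: assoc ee)
  ultimately have "e \<cdot> x c \<cdot> e \<in> corner e"
    using mult_closed[OF mult_closed[OF ee(1) x[OF c(1)]] ee(1)] by (simp add: corner_def)
  with c obtain y where y: "y \<in> corner e" "e \<cdot> x c \<cdot> e \<cdot> y = e" by (auto simp: nonunits_def)
  have "e \<cdot> x c \<cdot> (e \<cdot> y) = e" using y(2) by (simp only: assoc)
  moreover have "e \<cdot> y \<in> E" using y(1) mult_closed[OF ee(1)] by (simp add: corner_def)
  ultimately have "e \<in> I c" using ideal[OF c(1) ee(1), of "e \<cdot> y"] by simp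
  with c(1) show ?thesis ..
qed

end


section \<open>Primitive idempotents in an ideal mapped onto an ideal\<close>

text \<open>
  Surjectivity onto \<open>E'\<close> would be too much to ask of the Brauer homomorphism. Lifting the multiples of
  elements of \<open>J'\<close> is enough to compare the idempotents of \<open>J\<close> and \<open>J'\<close>.
\<close>

locale ideal_hom =
  A: fin_dim_algebra scale mul E one T + B: fin_dim_algebra scale' mul' E' one' T'
  for scale :: "'k::field \<Rightarrow> 'r::ab_group_add \<Rightarrow> 'r"
    and mul (infixl "\<cdot>" 70) and E one T
    and scale' :: "'k2::field \<Rightarrow> 's::ab_group_add \<Rightarrow> 's"
    and mul' (infixl "\<star>" 70) and E' one' T' +
  fixes \<beta> :: "'r \<Rightarrow> 's" and J :: "'r set" and J' :: "'s set"
  assumes hom_closed: "a \<in> E \<Longrightarrow> \<beta> a \<in> E'"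
    and hom_add: "a \<in> E \<Longrightarrow> b \<in> E \<Longrightarrow> \<beta> (a + b) = \<beta> a + \<beta> b"
    and hom_mult: "a \<in> E \<Longrightarrow> b \<in> E \<Longrightarrow> \<beta> (a \<cdot> b) = \<beta> a \<star> \<beta> b"
    and hom_one: "\<beta> one = one'"
    and J_sub: "J \<subseteq> E"
    and J_left: "a \<in> E \<Longrightarrow> b \<in> J \<Longrightarrow> a \<cdot> b \<in> J"
    and J_right: "a \<in> J \<Longrightarrow> b \<in> E \<Longrightarrow> a \<cdot> b \<in> J"
    and J_image: "\<beta> ` J = J'"
    and J'_left: "c \<in> E' \<Longrightarrow> d \<in> J' \<Longrightarrow> c \<star> d \<in> J'"
    and J'_right: "c \<in> J' \<Longrightarrow> d \<in> E' \<Longrightarrow> c \<star> d \<in> J'"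
begin

lemma hom_zero: "\<beta> 0 = 0"
  using hom_add[of 0 0] A.E_zero by simp

lemma hom_diff:
  assumes "a \<in> E" "b \<in> E" shows "\<beta> (a - b) = \<beta> a - \<beta> b"
  using hom_add[of "a - b" b] A.E_diff assms by (simp add: algebra_simps)

lemma hom_sum: "(\<And>i. i \<in> S \<Longrightarrow> f i \<in> E) \<Longrightarrow> \<beta> (sum f S) = (\<Sum>i\<in>S. \<beta> (f i))"
proof (induction S rule: infinite_finite_induct)
  case (insert i S)
  then show ?case using hom_add[of "f i" "sum f S"] A.E_sum[of S f] by simp
qed (simp_all add: hom_zero)

text \<open>
  These idempotents stand for the summands that the homomorphism sees: the image of \<open>e\<close> in \<open>E'\<close>
  lies in \<open>J'\<close>, so all of \<open>\<beta> e E'\<close> and \<open>E' \<beta> e\<close> can be lifted.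
\<close>

abbreviation visible :: "'r \<Rightarrow> bool" where
  "visible e \<equiv> A.primitive e \<and> e \<in> J \<and> \<beta> e \<noteq> 0"

lemma lift_left:
  assumes e: "visible e" and x: "x \<in> E'" "\<beta> e \<star> x = x"
  obtains y where "y \<in> E" "e \<cdot> y = y" "\<beta> y = x"
proof -
  have eE: "e \<in> E" "e \<cdot> e = e" using e by (auto simp: A.primitive_def A.idempotent_def)
  have "\<beta> e \<in> J'" using e J_image by blast
  then have "x \<in> J'" using J'_right[of "\<beta> e" x] x by simp
  then obtain z where z: "z \<in> J" "\<beta> z = x" using J_image by blast
  have "e \<cdot> (e \<cdot> z) = e \<cdot> z" using eE A.assoc by metis
  moreover have "\<beta> (e \<cdot> z) = x" using hom_mult eE z J_sub x by auto
  moreover have "e \<cdot> z \<in> E" using A.mult_closed eE z J_sub by blast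
  ultimately show thesis using that by blast
qed

lemma lift_right:
  assumes e: "visible e" and x: "x \<in> E'" "x \<star> \<beta> e = x"
  obtains y where "y \<in> E" "y \<cdot> e = y" "\<beta> y = x"
proof -
  have eE: "e \<in> E" "e \<cdot> e = e" using e by (auto simp: A.primitive_def A.idempotent_def)
  have "\<beta> e \<in> J'" using e J_image by blast
  then have "x \<in> J'" using J'_left[of x "\<beta> e"] x by simp
  then obtain z where z: "z \<in> J" "\<beta> z = x" using J_image by blast
  have "(z \<cdot> e) \<cdot> e = z \<cdot> e" using eE A.assoc by metis
  moreover have "\<beta> (z \<cdot> e) = x" using hom_mult eE z J_sub x by auto
  moreover have "z \<cdot> e \<in> E" using A.mult_closed eE z J_sub by blast
  ultimately show thesis using that by blast
qed

lemma lift_corner: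
  assumes e: "visible e" and x: "x \<in> B.corner (\<beta> e)"
  obtains y where "y \<in> A.corner e" "\<beta> y = x"
proof -
  have eE: "e \<in> E" "e \<cdot> e = e" using e by (auto simp: A.primitive_def A.idempotent_def)
  obtain y where y: "y \<in> E" "e \<cdot> y = y" "\<beta> y = x" using lift_left[OF e, of x] x by (auto simp: B.corner_def)
  have "y \<cdot> e \<in> A.corner e" using y eE A.mult_closed by (simp add: A.corner_def) (metis A.assoc)
  moreover have "\<beta> (y \<cdot> e) = x" using hom_mult y eE x by (simp add: B.corner_def)
  ultimately show thesis using that by blast
qed

lemma hom_corner:
  assumes "A.idempotent e" and "x \<in> A.corner e"
  shows "\<beta> x \<in> B.corner (\<beta> e)"
proof -
  have x: "e \<in> E" "x \<in> E" "e \<cdot> x = x" "x \<cdot> e = x"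
    using assms by (auto simp: A.corner_def A.idempotent_def)
  then show ?thesis
    using hom_mult[OF x(1,2)] hom_mult[OF x(2,1)] hom_closed by (simp add: B.corner_def)
qed

lemma hom_pw: "a \<in> E \<Longrightarrow> \<beta> (A.pw a n) = B.pw (\<beta> a) n"
  by (induction n) (auto simp: hom_one hom_mult A.pw_closed)

lemma idempotent_not_nilpotent:
  assumes "x \<star> x = x" "x \<noteq> 0" "x \<in> E'" shows "B.pw x (Suc n) \<noteq> 0"
proof -
  have "B.pw x (Suc n) = x" by (induction n) (use assms B.one_right in auto)
  then show ?thesis using assms by simp
qed

text \<open>
  The corner ring of \<open>e\<close> maps onto that of \<open>\<beta> e\<close>, and a nilpotent element cannot become a unit
  because \<open>\<beta> e \<noteq> 0\<close>.
\<close>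

lemma nonunit_image:
  assumes e: "visible e" and x: "x \<in> A.nonunits e" shows "\<beta> x \<in> B.nonunits (\<beta> e)"
proof -
  have id: "A.idempotent e" using e A.primitive_idempotent by blast
  have eE: "e \<in> E" "e \<cdot> e = e" using id by (auto simp: A.idempotent_def)
  have xc: "x \<in> A.corner e" using x by (simp add: A.nonunits_def)
  show ?thesis
  proof (rule ccontr)
    assume "\<beta> x \<notin> B.nonunits (\<beta> e)"
    then obtain y where y: "y \<in> B.corner (\<beta> e)" "\<beta> x \<star> y = \<beta> e"
      using hom_corner[OF id xc] by (auto simp: B.nonunits_def)
    obtain z where z: "z \<in> A.corner e" "\<beta> z = y" using lift_corner[OF e y(1)] .
    have xzE: "x \<cdot> z \<in> E" using xc z A.mult_closed by (auto simp: A.corner_def)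
    have "\<beta> (x \<cdot> z) = \<beta> e" using hom_mult xc z y by (auto simp: A.corner_def)
    moreover have "x \<cdot> z \<in> A.nonunits e" using A.nonunits_mult(1) e x z by blast
    then obtain n where "A.pw (x \<cdot> z) (Suc n) = 0" using A.primitive_nilpotent e by blast
    ultimately have "B.pw (\<beta> e) (Suc n) = 0" using hom_pw[OF xzE, of "Suc n"] hom_zero by simp
    then show False using idempotent_not_nilpotent[of "\<beta> e" n] e eE hom_mult[of e e] hom_closed by simp
  qed
qed

lemma unit_of_unit_image:
  assumes e: "A.primitive e" "\<beta> e \<noteq> 0" and x: "x \<in> A.corner e" "\<beta> x \<in> B.nonunits (\<beta> e)"
  shows "x \<in> A.nonunits e"
proof (rule ccontr)
  assume "x \<notin> A.nonunits e"
  then obtain y where y: "y \<in> A.corner e" "x \<cdot> y = e" "y \<cdot> x = e"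
    using x by (auto simp: A.nonunits_def)
  have id: "A.idempotent e" using e A.primitive_idempotent by blast
  have E: "x \<in> E" "y \<in> E" using x y by (auto simp: A.corner_def)
  have "\<beta> x \<star> \<beta> y = \<beta> e" "\<beta> y \<star> \<beta> x = \<beta> e" using hom_mult E y by metis+
  then show False using x(2) hom_corner[OF id y(1)] unfolding B.nonunits_def by blast
qed

text \<open>A lift of an idempotent \<open>d\<close> of the corner of \<open>\<beta> e\<close> is nilpotent or invertible, and so is \<open>d\<close>.\<close>

theorem visible_image_primitive:
  assumes e: "visible e" shows "B.primitive (\<beta> e)"
proof -
  have id: "A.idempotent e" using e A.primitive_idempotent by blast
  have eE: "e \<in> E" "e \<cdot> e = e" using id by (auto simp: A.idempotent_def)
  have be: "\<beta> e \<in> E'" "\<beta> e \<star> \<beta> e = \<beta> e" using eE hom_closed hom_mult by metis+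
  have "d = 0 \<or> d = \<beta> e" if d: "d \<in> B.corner (\<beta> e)" "d \<star> d = d" for d
  proof (rule ccontr)
    assume n: "\<not> ?thesis"
    have dE: "d \<in> E'" "\<beta> e \<star> d = d" "d \<star> \<beta> e = d" using d by (auto simp: B.corner_def)
    obtain x where x: "x \<in> A.corner e" "\<beta> x = d" using lift_corner[OF e d(1)] .
    have xE: "x \<in> E" using x by (simp add: A.corner_def)
    show False
    proof (cases "x \<in> A.nonunits e")
      case True
      then obtain m where "A.pw x (Suc m) = 0" using A.primitive_nilpotent e by blast
      then have "B.pw d (Suc m) = 0" using hom_pw[OF xE, of "Suc m"] x hom_zero by simp
      then show False using idempotent_not_nilpotent d(2) n dE by blast
    next
      case False
      then obtain y where y: "y \<in> A.corner e" "y \<cdot> x = e" using x by (auto simp: A.nonunits_def)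
      have "\<beta> y \<star> d = \<beta> e" using hom_mult[of y x] y x by (auto simp: A.corner_def)
      then have "\<beta> e \<star> d = \<beta> e" using d(2) B.assoc by metis
      then show False using dE n by simp
    qed
  qed
  then show ?thesis using be e unfolding B.primitive_def B.idempotent_def by blast
qed

text \<open>Lift the two factors of \<open>\<beta> e\<close>: their product is invertible modulo the kernel, hence invertible.\<close>

theorem equivalent_visible_iff:
  assumes e: "visible e" and f: "visible f"
  shows "B.equivalent (\<beta> e) (\<beta> f) \<longleftrightarrow> A.equivalent e f"
proof
  assume "A.equivalent e f"
  then show "B.equivalent (\<beta> e) (\<beta> f)" unfolding A.equivalent_def B.equivalent_def
    using hom_mult hom_closed by metis
next
  assume eq: "B.equivalent (\<beta> e) (\<beta> f)"
  have pe: "B.primitive (\<beta> e)" "B.primitive (\<beta> f)" using visible_image_primitive e f by auto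
  have eE: "e \<in> E" "e \<cdot> e = e" and fE: "f \<in> E" "f \<cdot> f = f"
    using e f by (auto simp: A.primitive_def A.idempotent_def)
  obtain u v where uv: "u \<in> E'" "v \<in> E'" "u \<star> v = \<beta> e" "v \<star> u = \<beta> f" "\<beta> e \<star> u = u" "u \<star> \<beta> f = u" "\<beta> f \<star> v = v" "v \<star> \<beta> e = v"
    using B.equivalent_normalized[OF eq] pe unfolding B.primitive_def B.idempotent_def by metis
  obtain a where a: "a \<in> E" "e \<cdot> a = a" "\<beta> a = u" using lift_left[OF e uv(1,5)] .
  obtain b where b: "b \<in> E" "b \<cdot> e = b" "\<beta> b = v" using lift_right[OF e uv(2,8)] .
  have "\<beta> (a \<cdot> f \<cdot> b) = \<beta> e" using hom_mult A.mult_closed a b fE uv by metis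
  moreover have "\<beta> e \<notin> B.nonunits (\<beta> e)" using B.self_not_nonunit pe by blast
  ultimately have "a \<cdot> f \<cdot> b \<notin> A.nonunits e" using nonunit_image[OF e] by metis
  then have "A.equivalent f e" using A.factor_equivalent e f a b by blast
  then show "A.equivalent e f" using A.equivalent_sym by blast
qed

text \<open>
  Decompose the unit of \<open>E\<close> into primitive idempotents. For one of them, \<open>s\<close>, the
  idempotent \<open>f\<close> is equivalent to an idempotent of the corner of \<open>\<beta> s\<close>. The latter lies in
  \<open>J'\<close> and so lifts to an element of \<open>J\<close> in the local corner of \<open>s\<close>. The lift is not nilpotent,
  hence invertible; this puts \<open>s\<close> into \<open>J\<close> and makes \<open>\<beta> s\<close> primitive.
\<close>

theorem primitive_of_ideal_visible:
  assumes f: "B.primitive f" "f \<in> J'"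
  shows "\<exists>e. visible e \<and> B.equivalent (\<beta> e) f"
proof -
  obtain S where S: "A.primitive_decomposition S" using A.primitive_decomposition_exists by blast
  then have SE: "s \<in> E" "s \<cdot> s = s" "A.primitive s" if "s \<in> S" for s
    using that unfolding A.primitive_decomposition_def A.primitive_def A.idempotent_def by auto
  have ff: "f \<in> E'" "f \<star> f = f" "f \<noteq> 0" using f by (auto simp: B.primitive_def B.idempotent_def)
  have "f = f \<star> one' \<star> f" using ff B.one_right by simp
  also have "one' = \<beta> (\<Sum>s\<in>S. s)" using S hom_one unfolding A.primitive_decomposition_def by (simp add: id_def)
  also have "\<dots> = (\<Sum>s\<in>S. \<beta> s)" by (rule hom_sum) (use SE in auto)
  finally have "(\<Sum>s\<in>S. f \<star> \<beta> s \<star> f) = f" by (simp add: B.sum_left B.sum_right)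
  then have "(\<Sum>s\<in>S. f \<star> \<beta> s \<star> f) \<notin> B.nonunits f" using B.self_not_nonunit f(1) by metis
  then obtain s where s: "s \<in> S" "f \<star> \<beta> s \<star> f \<notin> B.nonunits f"
    using B.nonunits_sum[OF f(1), of S "\<lambda>s. f \<star> \<beta> s \<star> f"] by blast
  have bs: "\<beta> s \<in> E'" "\<beta> s \<star> \<beta> s = \<beta> s" using SE[OF s(1)] hom_closed hom_mult by metis+
  have "f \<star> \<beta> s \<star> f \<in> B.corner f"
    using ff bs B.mult_closed by (simp add: B.corner_def) (metis B.assoc)
  then obtain c where c: "c \<in> B.corner f" "f \<star> \<beta> s \<star> f \<star> c = f" using s by (auto simp: B.nonunits_def)
  have cE: "c \<in> E'" "c \<star> f = c" using c by (auto simp: B.corner_def)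
  define u where "u = f \<star> \<beta> s"
  define v where "v = \<beta> s \<star> (f \<star> c)"
  have uv: "u \<in> E'" "v \<in> E'" "u \<star> v = f" "\<beta> s \<star> v = v" "u \<star> \<beta> s = u" "f \<star> u = u" "v \<star> f = v"
    unfolding u_def v_def using c cE ff bs B.mult_closed by (metis B.assoc)+
  have w: "(v \<star> u) \<star> (v \<star> u) = v \<star> u" using uv B.assoc by metis
  have w0: "v \<star> u \<noteq> 0"
  proof
    assume "v \<star> u = 0"
    then have "u \<star> v \<star> (u \<star> v) = 0" by (metis B.assoc B.zero_left B.zero_right)
    then show False using uv ff by simp
  qed
  have wE: "v \<star> u \<in> E'" using uv B.mult_closed by blast
  have "u \<in> J'" using J'_right[OF f(2) bs(1)] by (simp add: u_def)
  then have "v \<star> u \<in> J'" using J'_left uv by blast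
  then have "v \<star> u \<in> \<beta> ` J" by (simp only: J_image)
  then obtain z0 where z0: "z0 \<in> J" "\<beta> z0 = v \<star> u" by (rule imageE) simp
  note sE = SE[OF s(1)]
  define z where "z = s \<cdot> z0 \<cdot> s"
  have zJ: "z \<in> J" unfolding z_def using J_right[OF J_left[OF sE(1) z0(1)] sE(1)] .
  then have zE: "z \<in> E" using J_sub by blast
  have "s \<cdot> z = z" unfolding z_def by (simp only: A.assoc[symmetric] sE)
  moreover have "z \<cdot> s = z" unfolding z_def by (simp only: A.assoc sE)
  ultimately have zc: "z \<in> A.corner s" using zE by (simp add: A.corner_def)
  have z0E: "z0 \<in> E" using z0 J_sub by blast
  have "\<beta> z = \<beta> s \<star> (v \<star> u) \<star> \<beta> s"
    using hom_mult A.mult_closed sE z0E z0 by (simp add: z_def)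
  also have "\<dots> = (\<beta> s \<star> v) \<star> (u \<star> \<beta> s)" by (simp only: B.assoc)
  also have "\<dots> = v \<star> u" by (simp only: uv)
  finally have bz: "\<beta> z = v \<star> u" .
  have "z \<notin> A.nonunits s"
  proof
    assume "z \<in> A.nonunits s"
    then obtain n where "A.pw z (Suc n) = 0" using A.primitive_nilpotent sE by blast
    then have "B.pw (v \<star> u) (Suc n) = 0" using hom_pw[OF zE, of "Suc n"] bz hom_zero by simp
    then show False using idempotent_not_nilpotent w w0 wE by blast
  qed
  then obtain y where "y \<in> A.corner s" "z \<cdot> y = s" using zc by (auto simp: A.nonunits_def)
  then have sJ: "s \<in> J" using J_right zJ by (auto simp: A.corner_def)
  have "\<beta> s \<noteq> 0" using bz w0 uv by force
  then have vis: "visible s" using sE sJ by blast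
  have "B.primitive (\<beta> s)" using visible_image_primitive[OF vis] .
  moreover have "v \<star> u \<in> B.corner (\<beta> s)" using uv wE by (simp add: B.corner_def) (metis B.assoc)
  ultimately have "v \<star> u = \<beta> s" using w w0 unfolding B.primitive_def by blast
  then have "B.equivalent (\<beta> s) f" using uv unfolding B.equivalent_def by blast
  then show ?thesis using vis by blast
qed

theorem copies_visible_iff:
  assumes e: "visible e"
  shows "B.copies (\<beta> e) n \<longleftrightarrow> A.copies e n"
proof
  have eE: "e \<in> E" "e \<cdot> e = e" using e by (auto simp: A.primitive_def A.idempotent_def)
  {
    assume "A.copies e n"
    then obtain a b where ab: "\<And>i. i < n \<Longrightarrow> a i \<in> E \<and> e \<cdot> a i = a i \<and> b i \<in> E \<and> b i \<cdot> e = b i"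
      "\<And>i j. i < n \<Longrightarrow> j < n \<Longrightarrow> a i \<cdot> b j - (if i = j then e else 0) \<in> A.nonunits e"
      unfolding A.copies_def by blast
    have "\<forall>i<n. \<forall>j<n. \<beta> (a i) \<star> \<beta> (b j) - (if i = j then \<beta> e else 0) \<in> B.nonunits (\<beta> e)"
    proof (intro allI impI)
      fix i j assume that: "i < n" "j < n"
      have "\<beta> (a i \<cdot> b j - (if i = j then e else 0)) = \<beta> (a i) \<star> \<beta> (b j) - (if i = j then \<beta> e else 0)"
        using ab(1)[OF that(1)] ab(1)[OF that(2)] eE
        by (simp add: hom_diff hom_mult A.mult_closed A.E_zero hom_zero)
      then show "\<beta> (a i) \<star> \<beta> (b j) - (if i = j then \<beta> e else 0) \<in> B.nonunits (\<beta> e)"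
        using nonunit_image[OF e ab(2)[OF that]] by simp
    qed
    moreover have "\<forall>i<n. \<beta> (a i) \<in> E' \<and> \<beta> e \<star> \<beta> (a i) = \<beta> (a i) \<and> \<beta> (b i) \<in> E' \<and> \<beta> (b i) \<star> \<beta> e = \<beta> (b i)"
      using ab(1) hom_mult[OF eE(1)] hom_mult[OF _ eE(1)] hom_closed by metis
    ultimately show "B.copies (\<beta> e) n" unfolding B.copies_def
      by (intro exI[of _ "\<lambda>i. \<beta> (a i)"] exI[of _ "\<lambda>i. \<beta> (b i)"] conjI)
  next
    assume "B.copies (\<beta> e) n"
    then obtain a' b' where ab': "\<And>i. i < n \<Longrightarrow> a' i \<in> E' \<and> \<beta> e \<star> a' i = a' i \<and> b' i \<in> E' \<and> b' i \<star> \<beta> e = b' i"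
      "\<And>i j. i < n \<Longrightarrow> j < n \<Longrightarrow> a' i \<star> b' j - (if i = j then \<beta> e else 0) \<in> B.nonunits (\<beta> e)"
      unfolding B.copies_def by blast
    have "\<exists>y. y \<in> E \<and> e \<cdot> y = y \<and> \<beta> y = a' i" if "i < n" for i
      using lift_left[OF e, of "a' i"] ab'(1)[OF that] by metis
    then obtain a where a: "\<And>i. i < n \<Longrightarrow> a i \<in> E \<and> e \<cdot> a i = a i \<and> \<beta> (a i) = a' i" by metis
    have "\<exists>y. y \<in> E \<and> y \<cdot> e = y \<and> \<beta> y = b' i" if "i < n" for i
      using lift_right[OF e, of "b' i"] ab'(1)[OF that] by metis
    then obtain b where b: "\<And>i. i < n \<Longrightarrow> b i \<in> E \<and> b i \<cdot> e = b i \<and> \<beta> (b i) = b' i" by metis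
    have "\<forall>i<n. \<forall>j<n. a i \<cdot> b j - (if i = j then e else 0) \<in> A.nonunits e"
    proof (intro allI impI, rule unit_of_unit_image)
      fix i j assume that: "i < n" "j < n"
      show "A.primitive e" "\<beta> e \<noteq> 0" using e by auto
      have "a i \<cdot> b j \<in> A.corner e"
        using a[OF that(1)] b[OF that(2)] A.mult_closed by (simp add: A.corner_def) (metis A.assoc)
      moreover have "(if i = j then e else 0) \<in> A.corner e"
        using A.corner_self e A.primitive_idempotent A.subspace_0[OF A.corner_subspace] by auto
      ultimately show "a i \<cdot> b j - (if i = j then e else 0) \<in> A.corner e"
        using A.subspace_diff[OF A.corner_subspace] by blast
      have "\<beta> (a i \<cdot> b j - (if i = j then e else 0)) = a' i \<star> b' j - (if i = j then \<beta> e else 0)"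
        using a[OF that(1)] b[OF that(2)] eE
        by (simp add: hom_diff hom_mult A.mult_closed A.E_zero hom_zero)
      then show "\<beta> (a i \<cdot> b j - (if i = j then e else 0)) \<in> B.nonunits (\<beta> e)"
        using ab'(2)[OF that] by simp
    qed
    moreover have "\<forall>i<n. a i \<in> E \<and> e \<cdot> a i = a i \<and> b i \<in> E \<and> b i \<cdot> e = b i" using a b by simp
    ultimately show "A.copies e n" unfolding A.copies_def by (intro exI[of _ a] exI[of _ b] conjI)
  }
qed

end


section \<open>Permutation modules and invariant matrices\<close>

text \<open>
  A matrix over \<open>\<Omega>\<close> is a function of two arguments that vanishes outside \<open>\<Omega> \<times> \<Omega>\<close>; the product
  sums over \<open>\<Omega>\<close> and is associative on all functions.
\<close>

definition matrices :: "'a set \<Rightarrow> ('a \<Rightarrow> 'a \<Rightarrow> 'k::field) set" where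
  "matrices \<Omega> = {a. \<forall>x y. x \<notin> \<Omega> \<or> y \<notin> \<Omega> \<longrightarrow> a x y = 0}"

definition mat_mult :: "'a set \<Rightarrow> ('a \<Rightarrow> 'a \<Rightarrow> 'k::field) \<Rightarrow> ('a \<Rightarrow> 'a \<Rightarrow> 'k) \<Rightarrow> ('a \<Rightarrow> 'a \<Rightarrow> 'k)" where
  "mat_mult \<Omega> a b = (\<lambda>x y. \<Sum>w\<in>\<Omega>. a x w * b w y)"

definition mat_one :: "'a set \<Rightarrow> 'a \<Rightarrow> 'a \<Rightarrow> 'k::field" where
  "mat_one \<Omega> = (\<lambda>x y. if x = y \<and> x \<in> \<Omega> then 1 else 0)"

definition mat_scale :: "'k::field \<Rightarrow> ('a \<Rightarrow> 'a \<Rightarrow> 'k) \<Rightarrow> ('a \<Rightarrow> 'a \<Rightarrow> 'k)" where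
  "mat_scale c a = (\<lambda>x y. c * a x y)"

definition mat_apply :: "'a set \<Rightarrow> ('a \<Rightarrow> 'a \<Rightarrow> 'k::field) \<Rightarrow> ('a \<Rightarrow> 'k) \<Rightarrow> ('a \<Rightarrow> 'k)" where
  "mat_apply \<Omega> a v = (\<lambda>x. \<Sum>y\<in>\<Omega>. a x y * v y)"

definition mat_unit :: "'a \<times> 'a \<Rightarrow> 'a \<Rightarrow> 'a \<Rightarrow> 'k::field" where
  "mat_unit z = (\<lambda>x y. if (x, y) = z then 1 else 0)"

definition invariant_matrices :: "('g \<Rightarrow> 'a \<Rightarrow> 'a) \<Rightarrow> 'g set \<Rightarrow> 'a set \<Rightarrow> ('a \<Rightarrow> 'a \<Rightarrow> 'k::field) set" where
  "invariant_matrices \<phi> H \<Omega> =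
     {a \<in> matrices \<Omega>. \<forall>g\<in>H. \<forall>x\<in>\<Omega>. \<forall>y\<in>\<Omega>. a (\<phi> g x) (\<phi> g y) = a x y}"

definition basis_vec :: "'a \<Rightarrow> 'a \<Rightarrow> 'k::field" where
  "basis_vec y = (\<lambda>x. if x = y then 1 else 0)"

definition matrix_of :: "'a set \<Rightarrow> (('a \<Rightarrow> 'k::field) \<Rightarrow> ('a \<Rightarrow> 'k)) \<Rightarrow> 'a \<Rightarrow> 'a \<Rightarrow> 'k" where
  "matrix_of \<Omega> h = (\<lambda>x y. if x \<in> \<Omega> \<and> y \<in> \<Omega> then h (basis_vec y) x else 0)"

lemma vector_space_mat_scale: "vector_space (mat_scale :: 'k::field \<Rightarrow> ('a \<Rightarrow> 'a \<Rightarrow> 'k) \<Rightarrow> _)"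
  by unfold_locales (auto simp: mat_scale_def fun_eq_iff algebra_simps)

lemma sum_fun_apply: "(\<Sum>i\<in>S. f i) x = (\<Sum>i\<in>S. f i x)"
  for f :: "'i \<Rightarrow> 'a \<Rightarrow> 'b::comm_monoid_add"
  by (induction S rule: infinite_finite_induct) auto

lemma mat_mult_assoc: "mat_mult \<Omega> (mat_mult \<Omega> a b) c = mat_mult \<Omega> a (mat_mult \<Omega> b c)"
proof (intro ext)
  fix x y
  have "mat_mult \<Omega> (mat_mult \<Omega> a b) c x y = (\<Sum>w\<in>\<Omega>. \<Sum>z\<in>\<Omega>. a x z * b z w * c w y)"
    by (simp add: mat_mult_def sum_distrib_right)
  also have "\<dots> = (\<Sum>z\<in>\<Omega>. \<Sum>w\<in>\<Omega>. a x z * b z w * c w y)" by (rule sum.swap)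
  finally show "mat_mult \<Omega> (mat_mult \<Omega> a b) c x y = mat_mult \<Omega> a (mat_mult \<Omega> b c) x y"
    by (simp add: mat_mult_def sum_distrib_left mult.assoc)
qed

lemma mat_apply_mult: "mat_apply \<Omega> (mat_mult \<Omega> a b) v = mat_apply \<Omega> a (mat_apply \<Omega> b v)"
proof (intro ext)
  fix x
  have "mat_apply \<Omega> (mat_mult \<Omega> a b) v x = (\<Sum>w\<in>\<Omega>. \<Sum>z\<in>\<Omega>. a x z * b z w * v w)"
    by (simp add: mat_mult_def mat_apply_def sum_distrib_right)
  also have "\<dots> = (\<Sum>z\<in>\<Omega>. \<Sum>w\<in>\<Omega>. a x z * b z w * v w)" by (rule sum.swap)
  finally show "mat_apply \<Omega> (mat_mult \<Omega> a b) v x = mat_apply \<Omega> a (mat_apply \<Omega> b v) x"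
    by (simp add: mat_apply_def sum_distrib_left mult.assoc)
qed

lemma mat_apply_add: "mat_apply \<Omega> a (v + w) = mat_apply \<Omega> a v + mat_apply \<Omega> a w"
  by (simp add: mat_apply_def fun_eq_iff algebra_simps sum.distrib)

lemma mat_apply_add_left: "mat_apply \<Omega> (a + b) v = mat_apply \<Omega> a v + mat_apply \<Omega> b v"
  by (simp add: mat_apply_def fun_eq_iff algebra_simps sum.distrib)

lemma mat_apply_diff_left: "mat_apply \<Omega> (a - b) v = mat_apply \<Omega> a v - mat_apply \<Omega> b v"
  by (simp add: mat_apply_def fun_eq_iff algebra_simps sum_subtractf)

lemma mat_apply_scale: "mat_apply \<Omega> a (\<lambda>x. c * v x) = (\<lambda>x. c * mat_apply \<Omega> a v x)"
  by (simp add: mat_apply_def fun_eq_iff algebra_simps sum_distrib_left)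

lemma mat_apply_zero: "mat_apply \<Omega> a 0 = 0"
  by (simp add: mat_apply_def fun_eq_iff)

lemma mat_apply_zero_left: "mat_apply \<Omega> 0 v = 0"
  by (simp add: mat_apply_def fun_eq_iff)

lemma mat_apply_sum: "mat_apply \<Omega> a (\<Sum>i\<in>S. f i) = (\<Sum>i\<in>S. mat_apply \<Omega> a (f i))"
proof (induction S rule: infinite_finite_induct)
  case (insert i S)
  then show ?case by (simp only: sum.insert[OF insert.hyps] mat_apply_add)
qed (simp_all only: sum.infinite sum.empty simp_thms not_False_eq_True mat_apply_zero)

lemma mat_apply_sum_left: "mat_apply \<Omega> (\<Sum>i\<in>S. f i) v = (\<Sum>i\<in>S. mat_apply \<Omega> (f i) v)"
proof (induction S rule: infinite_finite_induct)
  case (insert i S)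
  then show ?case by (simp only: sum.insert[OF insert.hyps] mat_apply_add_left)
qed (simp_all only: sum.infinite sum.empty simp_thms not_False_eq_True mat_apply_zero_left)

lemma mat_apply_basis_vec:
  assumes "finite \<Omega>" "y \<in> \<Omega>" shows "mat_apply \<Omega> a (basis_vec y) x = a x y"
proof -
  have "mat_apply \<Omega> a (basis_vec y) x = (\<Sum>w\<in>\<Omega>. if w = y then a x w else 0)"
    unfolding mat_apply_def basis_vec_def by (rule sum.cong) auto
  then show ?thesis using assms by simp
qed

lemma matrices_eqI:
  assumes "finite \<Omega>" "a \<in> matrices \<Omega>" "b \<in> matrices \<Omega>"
    and "\<And>y. y \<in> \<Omega> \<Longrightarrow> mat_apply \<Omega> a (basis_vec y) = mat_apply \<Omega> b (basis_vec y)"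
  shows "a = b"
proof (intro ext)
  fix x y show "a x y = b x y"
  proof (cases "y \<in> \<Omega>")
    case True
    then show ?thesis using mat_apply_basis_vec[OF assms(1) True] assms(4)[OF True] by metis
  qed (use assms(2,3) in \<open>auto simp: matrices_def\<close>)
qed

lemma matrix_of_in_matrices: "matrix_of \<Omega> h \<in> matrices \<Omega>"
  by (simp add: matrix_of_def matrices_def)

locale permutation_module = group_action G \<Omega> \<phi>
  for G :: "('g, 'm) monoid_scheme" (structure) and \<Omega> :: "'a set" and \<phi> :: "'g \<Rightarrow> 'a \<Rightarrow> 'a" +
  fixes k\<Omega> :: "('a \<Rightarrow> 'k::field, 'k, 'g) gmodule"
  assumes k\<Omega>_eq: "k\<Omega> = perm_module G \<Omega> \<phi>"
    and finite_set: "finite \<Omega>" and finite_group: "finite (carrier G)"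
begin

sublocale Gr: group G
  using group_hom by (simp add: group_hom_def)

lemma carrier_k\<Omega>: "v \<in> carrier k\<Omega> \<longleftrightarrow> (\<forall>x. x \<notin> \<Omega> \<longrightarrow> v x = 0)"
  by (simp add: k\<Omega>_eq perm_module_def)

lemma mscale_k\<Omega>: "mscale k\<Omega> c v = (\<lambda>x. c * v x)"
  by (simp add: k\<Omega>_eq perm_module_def)

lemma mact_k\<Omega>: "mact k\<Omega> g v = (\<lambda>x. if x \<in> \<Omega> then v (\<phi> (inv g) x) else 0)"
  by (simp add: k\<Omega>_eq perm_module_def)

sublocale Mod: kG_module G k\<Omega>
  unfolding k\<Omega>_eq by (rule group_action_kG_module) unfold_locales

lemma act_closed: "g \<in> carrier G \<Longrightarrow> x \<in> \<Omega> \<Longrightarrow> \<phi> g x \<in> \<Omega>"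
  using element_image by blast

lemma act_mult: "g \<in> carrier G \<Longrightarrow> h \<in> carrier G \<Longrightarrow> x \<in> \<Omega> \<Longrightarrow> \<phi> (g \<otimes> h) x = \<phi> g (\<phi> h x)"
  using composition_rule by blast

lemma act_one: "x \<in> \<Omega> \<Longrightarrow> \<phi> \<one> x = x"
  using fun_cong[OF id_eq_one, of x] by simp

lemma act_inv:
  assumes "g \<in> carrier G" "x \<in> \<Omega>"
  shows "\<phi> (inv g) (\<phi> g x) = x" "\<phi> g (\<phi> (inv g) x) = x"
  using act_mult[of "inv g" g x] act_mult[of g "inv g" x] act_one assms by simp_all

lemma act_bij: "g \<in> carrier G \<Longrightarrow> bij_betw (\<phi> g) \<Omega> \<Omega>"
  by (rule bij_betw_byWitness[where f' = "\<phi> (inv g)"]) (auto simp: act_inv act_closed)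

lemma act_sum: "g \<in> carrier G \<Longrightarrow> (\<Sum>x\<in>\<Omega>. f (\<phi> g x)) = (\<Sum>x\<in>\<Omega>. f x)"
  using sum.reindex_bij_betw[OF act_bij] .

abbreviation E :: "('a \<Rightarrow> 'a \<Rightarrow> 'k) set" where
  "E \<equiv> invariant_matrices \<phi> (carrier G) \<Omega>"

lemma mat_mult_invariant:
  assumes a: "a \<in> invariant_matrices \<phi> H \<Omega>" and b: "b \<in> invariant_matrices \<phi> H \<Omega>"
    and H: "H \<subseteq> carrier G"
  shows "mat_mult \<Omega> a b \<in> invariant_matrices \<phi> H \<Omega>"
proof -
  have "mat_mult \<Omega> a b (\<phi> g x) (\<phi> g y) = mat_mult \<Omega> a b x y" if g: "g \<in> H" "x \<in> \<Omega>" "y \<in> \<Omega>" for g x y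
  proof -
    have "mat_mult \<Omega> a b (\<phi> g x) (\<phi> g y) = (\<Sum>w\<in>\<Omega>. a (\<phi> g x) (\<phi> g w) * b (\<phi> g w) (\<phi> g y))"
      unfolding mat_mult_def using g(1) H by (intro act_sum[symmetric]) blast
    also have "\<dots> = mat_mult \<Omega> a b x y" unfolding mat_mult_def
      using a b g by (intro sum.cong refl) (simp add: invariant_matrices_def)
    finally show ?thesis .
  qed
  moreover have "mat_mult \<Omega> a b \<in> matrices \<Omega>"
    using a b by (auto simp: invariant_matrices_def matrices_def mat_mult_def intro!: sum.neutral)
  ultimately show ?thesis by (simp add: invariant_matrices_def)
qed

text \<open>
  The invariant matrices form the endomorphism algebra of \<open>k\<Omega>\<close>, with the matrix units as a finite
  set whose span contains it.
\<close>

sublocale alg: fin_dim_algebra mat_scale "mat_mult \<Omega>" E "mat_one \<Omega>" "mat_unit ` (\<Omega> \<times> \<Omega>)"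
proof -
  interpret V: vector_space "mat_scale :: 'k \<Rightarrow> ('a \<Rightarrow> 'a \<Rightarrow> 'k) \<Rightarrow> _" by (rule vector_space_mat_scale)
  show "fin_dim_algebra mat_scale (mat_mult \<Omega>) E (mat_one \<Omega>) (mat_unit ` (\<Omega> \<times> \<Omega>))"
  proof
    fix a b c :: "'a \<Rightarrow> 'a \<Rightarrow> 'k" and r :: 'k
    show "mat_mult \<Omega> (mat_mult \<Omega> a b) c = mat_mult \<Omega> a (mat_mult \<Omega> b c)" by (rule mat_mult_assoc)
    show "mat_mult \<Omega> a (b + c) = mat_mult \<Omega> a b + mat_mult \<Omega> a c"
      "mat_mult \<Omega> (a + b) c = mat_mult \<Omega> a c + mat_mult \<Omega> b c"
      by (simp_all add: mat_mult_def fun_eq_iff algebra_simps sum.distrib)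
    show "mat_mult \<Omega> (mat_scale r a) b = mat_scale r (mat_mult \<Omega> a b)"
      "mat_mult \<Omega> a (mat_scale r b) = mat_scale r (mat_mult \<Omega> a b)"
      by (simp_all add: mat_mult_def mat_scale_def fun_eq_iff algebra_simps sum_distrib_left)
    show "V.subspace E" unfolding V.subspace_def
      by (auto simp: invariant_matrices_def matrices_def mat_scale_def)
    show "mat_mult \<Omega> a b \<in> E" if "a \<in> E" "b \<in> E" using mat_mult_invariant that by blast
    show "mat_one \<Omega> \<in> E"
    proof -
      have "\<phi> g x = \<phi> g y \<longleftrightarrow> x = y" if "g \<in> carrier G" "x \<in> \<Omega>" "y \<in> \<Omega>" for g x y
        using act_inv(1) that by metis
      then show ?thesis using act_closed by (auto simp: mat_one_def invariant_matrices_def matrices_def)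
    qed
    show "mat_mult \<Omega> (mat_one \<Omega>) a = a" if "a \<in> E"
    proof (intro ext)
      fix x y
      have "mat_mult \<Omega> (mat_one \<Omega>) a x y = (\<Sum>w\<in>\<Omega>. if w = x then a x y else 0)"
        unfolding mat_mult_def mat_one_def by (rule sum.cong) auto
      then show "mat_mult \<Omega> (mat_one \<Omega>) a x y = a x y"
        using that finite_set by (simp add: invariant_matrices_def matrices_def)
    qed
    show "mat_mult \<Omega> a (mat_one \<Omega>) = a" if "a \<in> E"
    proof (intro ext)
      fix x y
      have "mat_mult \<Omega> a (mat_one \<Omega>) x y = (\<Sum>w\<in>\<Omega>. if w = y then a x y else 0)"
        unfolding mat_mult_def mat_one_def by (rule sum.cong) auto
      then show "mat_mult \<Omega> a (mat_one \<Omega>) x y = a x y"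
        using that finite_set by (simp add: invariant_matrices_def matrices_def)
    qed
    show "finite (mat_unit ` (\<Omega> \<times> \<Omega>))" using finite_set by simp
    show "E \<subseteq> V.span (mat_unit ` (\<Omega> \<times> \<Omega>))"
    proof
      fix a assume "a \<in> E"
      then have a: "a \<in> matrices \<Omega>" by (simp add: invariant_matrices_def)
      have "a = (\<Sum>z\<in>\<Omega> \<times> \<Omega>. mat_scale (a (fst z) (snd z)) (mat_unit z))"
      proof (intro ext)
        fix x y
        have "(\<Sum>z\<in>\<Omega> \<times> \<Omega>. mat_scale (a (fst z) (snd z)) (mat_unit z)) x y =
            (\<Sum>z\<in>\<Omega> \<times> \<Omega>. if z = (x, y) then a x y else 0)"
          unfolding sum_fun_apply by (rule sum.cong) (auto simp: mat_scale_def mat_unit_def)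
        then show "a x y = (\<Sum>z\<in>\<Omega> \<times> \<Omega>. mat_scale (a (fst z) (snd z)) (mat_unit z)) x y"
          using a finite_set by (auto simp: matrices_def)
      qed
      also have "\<dots> \<in> V.span (mat_unit ` (\<Omega> \<times> \<Omega>))"
        by (intro V.span_sum V.span_scale V.span_base imageI)
      finally show "a \<in> V.span (mat_unit ` (\<Omega> \<times> \<Omega>))" .
    qed
  qed
qed

lemma E_matrices: "a \<in> E \<Longrightarrow> a \<in> matrices \<Omega>"
  by (simp add: invariant_matrices_def)

lemma mat_apply_closed: "a \<in> matrices \<Omega> \<Longrightarrow> mat_apply \<Omega> a v \<in> carrier k\<Omega>"
  by (auto simp: carrier_k\<Omega> mat_apply_def matrices_def intro!: sum.neutral)

lemma mat_apply_act:
  assumes a: "a \<in> invariant_matrices \<phi> H \<Omega>" and g: "g \<in> H" and H: "H \<subseteq> carrier G"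
  shows "mat_apply \<Omega> a (mact k\<Omega> g v) = mact k\<Omega> g (mat_apply \<Omega> a v)"
proof (intro ext)
  fix x
  have gG: "g \<in> carrier G" using g H by blast
  show "mat_apply \<Omega> a (mact k\<Omega> g v) x = mact k\<Omega> g (mat_apply \<Omega> a v) x"
  proof (cases "x \<in> \<Omega>")
    case True
    have "mat_apply \<Omega> a (mact k\<Omega> g v) x = (\<Sum>y\<in>\<Omega>. a x (\<phi> g y) * mact k\<Omega> g v (\<phi> g y))"
      unfolding mat_apply_def using gG by (intro act_sum[symmetric])
    also have "\<dots> = (\<Sum>y\<in>\<Omega>. a (\<phi> (inv g) x) y * v y)"
    proof (intro sum.cong refl arg_cong2[where f = "(*)"])
      fix y assume y: "y \<in> \<Omega>"
      have "a (\<phi> g (\<phi> (inv g) x)) (\<phi> g y) = a (\<phi> (inv g) x) y"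
        using a g y act_closed[of "inv g" x] True gG by (simp add: invariant_matrices_def)
      then show "a x (\<phi> g y) = a (\<phi> (inv g) x) y" using act_inv[OF gG True] by simp
      show "mact k\<Omega> g v (\<phi> g y) = v y" using y gG by (simp add: mact_k\<Omega> act_inv act_closed)
    qed
    finally show ?thesis using True by (simp add: mact_k\<Omega> mat_apply_def)
  next
    case False
    then show ?thesis using a by (simp add: mact_k\<Omega> mat_apply_def invariant_matrices_def matrices_def)
  qed
qed

lemma vector_expansion:
  assumes "v \<in> carrier k\<Omega>"
  shows "v = (\<Sum>y\<in>\<Omega>. mscale k\<Omega> (v y) (basis_vec y))"
proof
  fix x
  have "(\<Sum>y\<in>\<Omega>. mscale k\<Omega> (v y) (basis_vec y)) x = (\<Sum>y\<in>\<Omega>. if y = x then v x else 0)"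
    unfolding sum_fun_apply by (rule sum.cong) (auto simp: mscale_k\<Omega> basis_vec_def)
  then show "v x = (\<Sum>y\<in>\<Omega>. mscale k\<Omega> (v y) (basis_vec y)) x"
    using assms finite_set by (simp add: carrier_k\<Omega>)
qed

lemma basis_vec_closed: "y \<in> \<Omega> \<Longrightarrow> basis_vec y \<in> carrier k\<Omega>"
  by (auto simp: carrier_k\<Omega> basis_vec_def)

lemma mact_basis_vec:
  assumes "g \<in> carrier G" "y \<in> \<Omega>"
  shows "mact k\<Omega> g (basis_vec y) = basis_vec (\<phi> g y)"
proof
  fix x show "mact k\<Omega> g (basis_vec y) x = basis_vec (\<phi> g y) x"
    using act_inv[OF assms(1)] act_closed assms by (auto simp: mact_k\<Omega> basis_vec_def)
qed

text \<open>
  Only the restriction of \<open>h\<close> to \<open>k\<Omega>\<close> is assumed to be linear, so the argument expands a vector in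
  the permutation basis.
\<close>

lemma matrix_of_apply:
  assumes closed: "\<And>v. v \<in> carrier k\<Omega> \<Longrightarrow> h v \<in> carrier k\<Omega>"
    and add: "\<And>v w. v \<in> carrier k\<Omega> \<Longrightarrow> w \<in> carrier k\<Omega> \<Longrightarrow> h (v + w) = h v + h w"
    and scale: "\<And>c v. v \<in> carrier k\<Omega> \<Longrightarrow> h (mscale k\<Omega> c v) = mscale k\<Omega> c (h v)"
    and v: "v \<in> carrier k\<Omega>"
  shows "mat_apply \<Omega> (matrix_of \<Omega> h) v = h v"
proof -
  have z: "0 \<in> carrier k\<Omega>" by (simp add: carrier_k\<Omega>)
  have h0: "h 0 = 0" using add[OF z z] by simp
  have sum: "h (\<Sum>i\<in>S. f i) = (\<Sum>i\<in>S. h (f i))" if "\<And>i. i \<in> S \<Longrightarrow> f i \<in> carrier k\<Omega>"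
    for S and f :: "'a \<Rightarrow> 'a \<Rightarrow> 'k"
    using that
  proof (induction S rule: infinite_finite_induct)
    case (insert i S)
    have "h (f i + sum f S) = h (f i) + h (sum f S)"
      using insert.prems by (intro add Mod.subspace_sum[OF Mod.carrier_subspace]) blast+
    also have "h (sum f S) = (\<Sum>i\<in>S. h (f i))" using insert by blast
    finally show ?case by (simp only: sum.insert[OF insert.hyps])
  qed (simp_all only: sum.infinite sum.empty simp_thms not_False_eq_True h0)
  have "h v = h (\<Sum>y\<in>\<Omega>. mscale k\<Omega> (v y) (basis_vec y))" using vector_expansion[OF v] by simp
  also have "\<dots> = (\<Sum>y\<in>\<Omega>. mscale k\<Omega> (v y) (h (basis_vec y)))"
    using sum[of \<Omega> "\<lambda>y. mscale k\<Omega> (v y) (basis_vec y)"] scale basis_vec_closed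
      Mod.subspace_scale[OF Mod.carrier_subspace] by simp
  also have "\<dots> = mat_apply \<Omega> (matrix_of \<Omega> h) v"
  proof
    fix x
    have "(\<Sum>y\<in>\<Omega>. mscale k\<Omega> (v y) (h (basis_vec y))) x = (\<Sum>y\<in>\<Omega>. h (basis_vec y) x * v y)"
      unfolding sum_fun_apply by (simp add: mscale_k\<Omega> mult.commute)
    also have "\<dots> = mat_apply \<Omega> (matrix_of \<Omega> h) v x"
    proof (cases "x \<in> \<Omega>")
      case False
      then have "h (basis_vec y) x = 0" if "y \<in> \<Omega>" for y
        using closed[OF basis_vec_closed[OF that]] by (simp add: carrier_k\<Omega>)
      then show ?thesis using False by (simp add: mat_apply_def matrix_of_def)
    qed (simp add: mat_apply_def matrix_of_def)
    finally show "(\<Sum>y\<in>\<Omega>. mscale k\<Omega> (v y) (h (basis_vec y))) x = mat_apply \<Omega> (matrix_of \<Omega> h) v x" .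
  qed
  finally show ?thesis ..
qed

lemma matrix_of_invariant:
  assumes act: "\<And>g v. g \<in> H \<Longrightarrow> v \<in> carrier k\<Omega> \<Longrightarrow> h (mact k\<Omega> g v) = mact k\<Omega> g (h v)"
    and H: "H \<subseteq> carrier G"
  shows "matrix_of \<Omega> h \<in> invariant_matrices \<phi> H \<Omega>"
proof -
  have "matrix_of \<Omega> h (\<phi> g x) (\<phi> g y) = matrix_of \<Omega> h x y" if g: "g \<in> H" "x \<in> \<Omega>" "y \<in> \<Omega>" for g x y
  proof -
    have gG: "g \<in> carrier G" using g H by blast
    have "h (basis_vec (\<phi> g y)) (\<phi> g x) = mact k\<Omega> g (h (basis_vec y)) (\<phi> g x)"
      using act[OF g(1) basis_vec_closed[OF g(3)]] mact_basis_vec[OF gG g(3)] by simp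
    then show ?thesis using g gG by (simp add: matrix_of_def mact_k\<Omega> act_closed act_inv)
  qed
  then show ?thesis by (simp add: invariant_matrices_def matrix_of_in_matrices)
qed

text \<open>
  For an idempotent this is the image. As a set of fixed vectors it needs no image operator, and its
  closure properties hold for all invariant matrices.
\<close>

definition img :: "('a \<Rightarrow> 'a \<Rightarrow> 'k) \<Rightarrow> ('a \<Rightarrow> 'k) set" where
  "img e = {v \<in> carrier k\<Omega>. mat_apply \<Omega> e v = v}"

abbreviation summand :: "('a \<Rightarrow> 'a \<Rightarrow> 'k) \<Rightarrow> ('a \<Rightarrow> 'k, 'k, 'g) gmodule" where
  "summand e \<equiv> k\<Omega>\<lparr>carrier := img e\<rparr>"

lemma mat_apply_in_img: "alg.idempotent e \<Longrightarrow> mat_apply \<Omega> e v \<in> img e"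
  using mat_apply_closed E_matrices unfolding img_def alg.idempotent_def
  by (simp flip: mat_apply_mult)

lemma img_subset: "img e \<subseteq> carrier k\<Omega>"
  by (auto simp: img_def)

lemma mat_apply_img: "v \<in> img e \<Longrightarrow> mat_apply \<Omega> e v = v"
  by (simp add: img_def)

lemma mat_one_apply:
  assumes "v \<in> carrier k\<Omega>" shows "mat_apply \<Omega> (mat_one \<Omega>) v = v"
proof
  fix x
  have "mat_apply \<Omega> (mat_one \<Omega>) v x = (\<Sum>y\<in>\<Omega>. if y = x then v x else 0)"
    unfolding mat_apply_def mat_one_def by (rule sum.cong) auto
  then show "mat_apply \<Omega> (mat_one \<Omega>) v x = v x" using assms finite_set by (simp add: carrier_k\<Omega>)
qed

lemma img_one: "img (mat_one \<Omega>) = carrier k\<Omega>"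
  using mat_one_apply by (auto simp: img_def)

lemma summand_one: "summand (mat_one \<Omega>) = k\<Omega>"
  by (simp add: img_one)

lemma idempotent_one: "alg.idempotent (mat_one \<Omega>)"
  by (simp add: alg.idempotent_def alg.one_closed alg.one_left)

lemma E_eqI:
  assumes "a \<in> matrices \<Omega>" "b \<in> matrices \<Omega>"
    and "\<And>v. v \<in> carrier k\<Omega> \<Longrightarrow> mat_apply \<Omega> a v = mat_apply \<Omega> b v"
  shows "a = b"
  using matrices_eqI[OF finite_set assms(1,2)] assms(3) basis_vec_closed by blast

lemma img_closed:
  assumes "v \<in> img e" "w \<in> img e"
  shows "v + w \<in> img e"
  using assms Mod.subspace_add[OF Mod.carrier_subspace] by (simp add: img_def mat_apply_add)

lemma img_scale:
  assumes "v \<in> img e" shows "mscale k\<Omega> c v \<in> img e"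
  using assms Mod.subspace_scale[OF Mod.carrier_subspace] by (simp add: img_def mscale_k\<Omega> mat_apply_scale)

lemma img_act:
  assumes "e \<in> E" "v \<in> img e" "g \<in> carrier G" shows "mact k\<Omega> g v \<in> img e"
  using assms Mod.act_closed[of g v] mat_apply_act[OF assms(1,3) subset_refl, of v] by (simp add: img_def)

lemma img_zero: "0 \<in> img e"
  by (simp add: img_def mat_apply_zero carrier_k\<Omega>)

lemma submodule_img: "e \<in> E \<Longrightarrow> kG_submodule G k\<Omega> (img e)"
  unfolding kG_submodule_def Mod.subspace_def
  using img_closed img_scale img_act img_subset img_zero by blast

lemma img_zero_iff:
  assumes "alg.idempotent e" shows "img e = {0} \<longleftrightarrow> e = 0"
proof
  assume z: "img e = {0}"
  show "e = 0"
  proof (rule E_eqI)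
    show "e \<in> matrices \<Omega>" using assms E_matrices by (simp add: alg.idempotent_def)
    show "0 \<in> matrices \<Omega>" by (simp add: matrices_def)
    fix v
    have "mat_apply \<Omega> e v \<in> {0}" using mat_apply_in_img[OF assms, of v] z by simp
    then show "mat_apply \<Omega> e v = mat_apply \<Omega> 0 v" by (simp add: mat_apply_zero_left)
  qed
next
  assume "e = 0"
  then show "img e = {0}" using img_zero[of 0] by (auto simp: img_def mat_apply_zero_left)
qed

end


section \<open>Summands of permutation modules and idempotents\<close>

lemma (in kG_module) kG_module_submodule:
  assumes "kG_submodule G M A" shows "kG_module G (M\<lparr>carrier := A\<rparr>)"
proof -
  have A: "A \<subseteq> carrier M" "subspace A" "\<And>g v. g \<in> carrier G \<Longrightarrow> v \<in> A \<Longrightarrow> mact M g v \<in> A"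
    using assms by (auto simp: kG_submodule_def)
  interpret V: vector_space "mscale (M\<lparr>carrier := A\<rparr>)" using vector_space_axioms by simp
  show ?thesis
  proof
    show "V.subspace (carrier (M\<lparr>carrier := A\<rparr>))" using A(2) by simp
  next
    fix g h v w c
    assume g: "g \<in> carrier G" and v: "v \<in> carrier (M\<lparr>carrier := A\<rparr>)"
    show "mact (M\<lparr>carrier := A\<rparr>) g v \<in> carrier (M\<lparr>carrier := A\<rparr>)" using A g v by simp
    show "mact (M\<lparr>carrier := A\<rparr>) g (mscale (M\<lparr>carrier := A\<rparr>) c v) =
        mscale (M\<lparr>carrier := A\<rparr>) c (mact (M\<lparr>carrier := A\<rparr>) g v)"
      using act_scale[OF g] v A(1) by auto
    show "mact (M\<lparr>carrier := A\<rparr>) g (v + w) = mact (M\<lparr>carrier := A\<rparr>) g v + mact (M\<lparr>carrier := A\<rparr>) g w"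
      if "w \<in> carrier (M\<lparr>carrier := A\<rparr>)" using act_add[OF g] v that A(1) by auto
    show "mact (M\<lparr>carrier := A\<rparr>) (g \<otimes> h) v = mact (M\<lparr>carrier := A\<rparr>) g (mact (M\<lparr>carrier := A\<rparr>) h v)"
      if "h \<in> carrier G" using act_mult[OF g that] v A(1) by auto
  next
    fix v assume "v \<in> carrier (M\<lparr>carrier := A\<rparr>)"
    then show "mact (M\<lparr>carrier := A\<rparr>) \<one> v = v" using act_one A(1) by auto
  qed
qed

lemma kG_homD:
  assumes "f \<in> kG_hom G M N"
  shows "v \<in> carrier M \<Longrightarrow> f v \<in> carrier N"
    and "v \<in> carrier M \<Longrightarrow> w \<in> carrier M \<Longrightarrow> f (v + w) = f v + f w"
    and "v \<in> carrier M \<Longrightarrow> f (mscale M c v) = mscale N c (f v)"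
    and "g \<in> carrier G \<Longrightarrow> v \<in> carrier M \<Longrightarrow> f (mact M g v) = mact N g (f v)"
  using assms by (auto simp: kG_hom_def)

lemma kG_hom_inverse:
  assumes M: "kG_module G M" and f: "f \<in> kG_hom G M N" and bij: "bij_betw f (carrier M) (carrier N)"
  shows "inv_into (carrier M) f \<in> kG_hom G N M"
proof -
  interpret M: kG_module G M by fact
  let ?f = "inv_into (carrier M) f"
  have c: "?f v \<in> carrier M" "f (?f v) = v" if "v \<in> carrier N" for v
    using bij that by (auto simp: bij_betw_def inv_into_into f_inv_into_f)
  have i: "?f (f v) = v" if "v \<in> carrier M" for v
    using bij that by (auto simp: bij_betw_def)
  note h = kG_homD[OF f]
  show ?thesis unfolding kG_hom_def
  proof (safe)
    fix v assume v: "v \<in> carrier N"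
    show "?f v \<in> carrier M" by (rule c[OF v])
    fix w assume w: "w \<in> carrier N"
    have "?f (f (?f v + ?f w)) = ?f v + ?f w" using c v w M.subspace_add[OF M.carrier_subspace] by (intro i) blast
    then show "?f (v + w) = ?f v + ?f w" using h(2) c v w by simp
  next
    fix v r assume v: "v \<in> carrier N"
    have "?f (f (mscale M r (?f v))) = mscale M r (?f v)" using c v M.subspace_scale[OF M.carrier_subspace] by (intro i) blast
    then show "?f (mscale N r v) = mscale M r (?f v)" using h(3) c v by simp
  next
    fix v g assume v: "v \<in> carrier N" and g: "g \<in> carrier G"
    have "?f (f (mact M g (?f v))) = mact M g (?f v)" using c v g M.act_closed by (intro i) blast
    then show "?f (mact N g v) = mact M g (?f v)" using h(4) g c v by simp
  qed
qed

context permutation_module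
begin

lemma summand_module: "e \<in> E \<Longrightarrow> kG_module G (summand e)"
  by (rule Mod.kG_module_submodule[OF submodule_img])

text \<open>A homomorphism between two summands is extended to \<open>k\<Omega>\<close> by zero on the complement of its source.\<close>

lemma hom_matrix:
  assumes e: "alg.idempotent e" and f: "alg.idempotent f" and h: "h \<in> kG_hom G (summand e) (summand f)"
  obtains u where "u \<in> E" "mat_mult \<Omega> u e = u" "mat_mult \<Omega> f u = u"
    "\<And>v. v \<in> carrier k\<Omega> \<Longrightarrow> mat_apply \<Omega> u v = h (mat_apply \<Omega> e v)"
proof -
  have eE: "e \<in> E" "mat_mult \<Omega> e e = e" using e by (auto simp: alg.idempotent_def)
  have fE: "f \<in> E" "mat_mult \<Omega> f f = f" using f by (auto simp: alg.idempotent_def)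
  define k where "k v = h (mat_apply \<Omega> e v)" for v
  define u where "u = matrix_of \<Omega> k"
  have ev: "mat_apply \<Omega> e v \<in> carrier (summand e)" for v using mat_apply_in_img[OF e] by simp
  note hD = kG_homD[OF h]
  have k: "k v \<in> img f" for v using hD(1)[OF ev] by (simp add: k_def)
  have app: "mat_apply \<Omega> u v = k v" if "v \<in> carrier k\<Omega>" for v
    unfolding u_def
  proof (rule matrix_of_apply[OF _ _ _ that])
    show "k v \<in> carrier k\<Omega>" for v using k img_subset by blast
    show "k (v + w) = k v + k w" for v w
      unfolding k_def mat_apply_add by (rule hD(2)[OF ev ev])
    show "k (mscale k\<Omega> c v) = mscale k\<Omega> c (k v)" for c v
      using hD(3)[OF ev, of c v] by (simp add: k_def mscale_k\<Omega> mat_apply_scale)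
  qed
  have uE: "u \<in> E" unfolding u_def
  proof (rule matrix_of_invariant[OF _ subset_refl])
    show "k (mact k\<Omega> g v) = mact k\<Omega> g (k v)" if "g \<in> carrier G" for g v
      using hD(4)[OF that ev, of v] mat_apply_act[OF eE(1) that subset_refl, of v] by (simp add: k_def)
  qed
  have ve: "mat_apply \<Omega> e v \<in> carrier k\<Omega>" for v using ev[of v] img_subset by auto
  show thesis
  proof (rule that[OF uE])
    show "mat_mult \<Omega> u e = u"
    proof (rule E_eqI)
      show "mat_mult \<Omega> u e \<in> matrices \<Omega>" "u \<in> matrices \<Omega>"
        using uE eE alg.mult_closed E_matrices by blast+
      fix v assume v: "v \<in> carrier k\<Omega>"
      have "k (mat_apply \<Omega> e v) = k v" by (simp add: k_def eE(2) flip: mat_apply_mult)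
      then show "mat_apply \<Omega> (mat_mult \<Omega> u e) v = mat_apply \<Omega> u v"
        using app[OF v] app[OF ve[of v]] by (simp add: mat_apply_mult)
    qed
    show "mat_mult \<Omega> f u = u"
    proof (rule E_eqI)
      show "mat_mult \<Omega> f u \<in> matrices \<Omega>" "u \<in> matrices \<Omega>"
        using uE fE alg.mult_closed E_matrices by blast+
      fix v assume v: "v \<in> carrier k\<Omega>"
      show "mat_apply \<Omega> (mat_mult \<Omega> f u) v = mat_apply \<Omega> u v"
        using app[OF v] mat_apply_img[OF k[of v]] by (simp add: mat_apply_mult)
    qed
    show "\<And>v. v \<in> carrier k\<Omega> \<Longrightarrow> mat_apply \<Omega> u v = h (mat_apply \<Omega> e v)"
      using app by (simp add: k_def)
  qed
qed

lemma matrix_hom: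
  assumes u: "u \<in> E" "mat_mult \<Omega> f u = u"
  shows "mat_apply \<Omega> u \<in> kG_hom G (summand e) (summand f)"
  unfolding kG_hom_def
proof (safe)
  fix v
  show "mat_apply \<Omega> u v \<in> carrier (summand f)"
    using mat_apply_closed[OF E_matrices[OF u(1)], of v] by (simp add: img_def u(2) flip: mat_apply_mult)
  show "mat_apply \<Omega> u (v + w) = mat_apply \<Omega> u v + mat_apply \<Omega> u w" for w by (rule mat_apply_add)
  show "mat_apply \<Omega> u (mscale (summand e) c v) = mscale (summand f) c (mat_apply \<Omega> u v)" for c
    by (simp add: mscale_k\<Omega> mat_apply_scale)
  show "mat_apply \<Omega> u (mact (summand e) g v) = mact (summand f) g (mat_apply \<Omega> u v)" if "g \<in> carrier G" for g
    using mat_apply_act[OF u(1) that] by simp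
qed

lemma isomorphic_iff_equivalent:
  assumes e: "alg.idempotent e" and f: "alg.idempotent f"
  shows "kG_isomorphic G (summand e) (summand f) \<longleftrightarrow> alg.equivalent e f"
proof
  have eE: "e \<in> E" "mat_mult \<Omega> e e = e" using e by (auto simp: alg.idempotent_def)
  have fE: "f \<in> E" "mat_mult \<Omega> f f = f" using f by (auto simp: alg.idempotent_def)
  {
    assume "kG_isomorphic G (summand e) (summand f)"
    then obtain h where h: "h \<in> kG_hom G (summand e) (summand f)" and bij: "bij_betw h (img e) (img f)"
      by (auto simp: kG_isomorphic_def)
    define h' where "h' = inv_into (img e) h"
    have h': "h' \<in> kG_hom G (summand f) (summand e)"
      using kG_hom_inverse[OF summand_module[OF eE(1)] h] bij by (simp add: h'_def)
    have hh: "h' (h v) = v" if "v \<in> img e" for v using bij that by (simp add: h'_def bij_betw_def)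
    have hh': "h (h' v) = v" if "v \<in> img f" for v using bij that by (simp add: h'_def bij_betw_def f_inv_into_f)
    obtain u where u: "u \<in> E" "mat_mult \<Omega> u e = u" "mat_mult \<Omega> f u = u"
      "\<And>v. v \<in> carrier k\<Omega> \<Longrightarrow> mat_apply \<Omega> u v = h (mat_apply \<Omega> e v)"
      using hom_matrix[OF e f h] by blast
    obtain u' where u': "u' \<in> E" "mat_mult \<Omega> u' f = u'" "mat_mult \<Omega> e u' = u'"
      "\<And>v. v \<in> carrier k\<Omega> \<Longrightarrow> mat_apply \<Omega> u' v = h' (mat_apply \<Omega> f v)"
      using hom_matrix[OF f e h'] by blast
    note ev = mat_apply_in_img[OF e] and fv = mat_apply_in_img[OF f]
    have hf: "h v \<in> img f" if "v \<in> img e" for v using kG_homD(1)[OF h] that by simp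
    have h'e: "h' v \<in> img e" if "v \<in> img f" for v using kG_homD(1)[OF h'] that by simp
    have "mat_mult \<Omega> u' u = e"
    proof (rule E_eqI)
      show "mat_mult \<Omega> u' u \<in> matrices \<Omega>" "e \<in> matrices \<Omega>"
        using u(1) u'(1) eE(1) alg.mult_closed E_matrices by blast+
      fix v assume v: "v \<in> carrier k\<Omega>"
      have c: "h (mat_apply \<Omega> e v) \<in> carrier k\<Omega>" using hf[OF ev] img_subset by blast
      show "mat_apply \<Omega> (mat_mult \<Omega> u' u) v = mat_apply \<Omega> e v"
        using u(4)[OF v] u'(4)[OF c] mat_apply_img[OF hf[OF ev[of v]]] hh[OF ev[of v]] by (simp add: mat_apply_mult)
    qed
    moreover have "mat_mult \<Omega> u u' = f"
    proof (rule E_eqI)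
      show "mat_mult \<Omega> u u' \<in> matrices \<Omega>" "f \<in> matrices \<Omega>"
        using u(1) u'(1) fE(1) alg.mult_closed E_matrices by blast+
      fix v assume v: "v \<in> carrier k\<Omega>"
      have c: "h' (mat_apply \<Omega> f v) \<in> carrier k\<Omega>" using h'e[OF fv] img_subset by blast
      show "mat_apply \<Omega> (mat_mult \<Omega> u u') v = mat_apply \<Omega> f v"
        using u'(4)[OF v] u(4)[OF c] mat_apply_img[OF h'e[OF fv[of v]]] hh'[OF fv[of v]] by (simp add: mat_apply_mult)
    qed
    ultimately show "alg.equivalent e f" unfolding alg.equivalent_def using u(1) u'(1) by blast
  next
    assume "alg.equivalent e f"
    then obtain u v where uv: "u \<in> E" "v \<in> E" "mat_mult \<Omega> u v = e" "mat_mult \<Omega> v u = f"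
      "mat_mult \<Omega> e u = u" "mat_mult \<Omega> f v = v"
      using alg.equivalent_normalized[OF _ eE(2) fE(2)] by blast
    have hom: "mat_apply \<Omega> v \<in> kG_hom G (summand e) (summand f)"
      "mat_apply \<Omega> u \<in> kG_hom G (summand f) (summand e)"
      using matrix_hom uv by blast+
    have "bij_betw (mat_apply \<Omega> v) (img e) (img f)"
    proof (rule bij_betw_byWitness[where f' = "mat_apply \<Omega> u"])
      show "\<forall>a\<in>img e. mat_apply \<Omega> u (mat_apply \<Omega> v a) = a"
        using uv(3) mat_apply_img by (simp flip: mat_apply_mult)
      show "\<forall>a\<in>img f. mat_apply \<Omega> v (mat_apply \<Omega> u a) = a"
        using uv(4) mat_apply_img by (simp flip: mat_apply_mult)
      show "mat_apply \<Omega> v ` img e \<subseteq> img f" using kG_homD(1)[OF hom(1)] by auto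
      show "mat_apply \<Omega> u ` img f \<subseteq> img e" using kG_homD(1)[OF hom(2)] by auto
    qed
    then show "kG_isomorphic G (summand e) (summand f)"
      unfolding kG_isomorphic_def using hom(1) by auto
  }
qed

text \<open>
  The components of a vector in the decomposition depend linearly and equivariantly on the vector,
  because components are unique. So the projections are invariant matrices.
\<close>

lemma idempotents_of_decomposition:
  fixes A :: "'i \<Rightarrow> ('a \<Rightarrow> 'k) set"
  assumes e: "alg.idempotent e" and fin: "finite I"
    and sub: "\<And>i. i \<in> I \<Longrightarrow> kG_submodule G k\<Omega> (A i)" "\<And>i. i \<in> I \<Longrightarrow> A i \<subseteq> img e"
    and dec: "\<And>v. v \<in> img e \<Longrightarrow> \<exists>!f. f \<in> (\<Pi>\<^sub>E i\<in>I. A i) \<and> v = (\<Sum>i\<in>I. f i)"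
  obtains d where "\<And>i. i \<in> I \<Longrightarrow> d i \<in> alg.corner e \<and> mat_mult \<Omega> (d i) (d i) = d i \<and> img (d i) = A i"
    "\<And>i j. i \<in> I \<Longrightarrow> j \<in> I \<Longrightarrow> i \<noteq> j \<Longrightarrow> mat_mult \<Omega> (d i) (d j) = 0" "(\<Sum>i\<in>I. d i) = e"
proof -
  have eE: "e \<in> E" "mat_mult \<Omega> e e = e" using e by (auto simp: alg.idempotent_def)
  have Aadd: "v + w \<in> A i" if "i \<in> I" "v \<in> A i" "w \<in> A i" for i v w
    using sub(1)[OF that(1)] Mod.subspace_add[of "A i"] that(2,3) by (auto simp: kG_submodule_def)
  have Ascale: "mscale k\<Omega> c v \<in> A i" if "i \<in> I" "v \<in> A i" for i v c
    using sub(1)[OF that(1)] Mod.subspace_scale[of "A i"] that(2) by (auto simp: kG_submodule_def)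
  have Aact: "mact k\<Omega> g v \<in> A i" if "i \<in> I" "v \<in> A i" "g \<in> carrier G" for i v g
    using sub(1)[OF that(1)] that(2,3) by (auto simp: kG_submodule_def)
  have Azero: "0 \<in> A i" if "i \<in> I" for i
    using sub(1)[OF that] Mod.subspace_0[of "A i"] by (auto simp: kG_submodule_def)
  have Acar: "v \<in> carrier k\<Omega>" if "i \<in> I" "v \<in> A i" for i v
    using sub(1)[OF that(1)] that(2) by (auto simp: kG_submodule_def)
  define comp where "comp v = (THE f. f \<in> (\<Pi>\<^sub>E i\<in>I. A i) \<and> v = (\<Sum>i\<in>I. f i))" for v
  have comp: "comp v \<in> (\<Pi>\<^sub>E i\<in>I. A i)" "v = (\<Sum>i\<in>I. comp v i)" if "v \<in> img e" for v
    using theI'[OF dec[OF that]] unfolding comp_def by blast+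
  have comp_eq: "comp v = f" if "v \<in> img e" "f \<in> (\<Pi>\<^sub>E i\<in>I. A i)" "v = (\<Sum>i\<in>I. f i)" for v f
    using dec[OF that(1)] comp[OF that(1)] that(2,3) by blast
  have compA: "comp v i \<in> A i" if "v \<in> img e" "i \<in> I" for v i
    using comp(1)[OF that(1)] that(2) by blast
  have comp_add: "comp (v + w) = (\<lambda>i\<in>I. comp v i + comp w i)" if v: "v \<in> img e" "w \<in> img e" for v w
  proof (rule comp_eq)
    show "v + w \<in> img e" using img_closed v by blast
    show "(\<lambda>i\<in>I. comp v i + comp w i) \<in> (\<Pi>\<^sub>E i\<in>I. A i)" using Aadd compA v by auto
    show "v + w = (\<Sum>i\<in>I. (\<lambda>i\<in>I. comp v i + comp w i) i)"
    proof -
      have "v + w = (\<Sum>i\<in>I. comp v i) + (\<Sum>i\<in>I. comp w i)" using comp(2)[OF v(1)] comp(2)[OF v(2)] by simp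
      also have "\<dots> = (\<Sum>i\<in>I. comp v i + comp w i)" by (simp only: sum.distrib)
      also have "\<dots> = (\<Sum>i\<in>I. (\<lambda>i\<in>I. comp v i + comp w i) i)" by (rule sum.cong[OF refl]) (simp only: restrict_apply if_True)
      finally show ?thesis .
    qed
  qed
  have comp_scale: "comp (mscale k\<Omega> c v) = (\<lambda>i\<in>I. mscale k\<Omega> c (comp v i))" if v: "v \<in> img e" for v c
  proof (rule comp_eq)
    show "mscale k\<Omega> c v \<in> img e" using img_scale v by blast
    show "(\<lambda>i\<in>I. mscale k\<Omega> c (comp v i)) \<in> (\<Pi>\<^sub>E i\<in>I. A i)" using Ascale compA v by auto
    show "mscale k\<Omega> c v = (\<Sum>i\<in>I. (\<lambda>i\<in>I. mscale k\<Omega> c (comp v i)) i)"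
    proof -
      have "mscale k\<Omega> c v = mscale k\<Omega> c (\<Sum>i\<in>I. comp v i)" using comp(2)[OF v] by simp
      also have "\<dots> = (\<Sum>i\<in>I. mscale k\<Omega> c (comp v i))" by (rule Mod.scale_sum_right)
      also have "\<dots> = (\<Sum>i\<in>I. (\<lambda>i\<in>I. mscale k\<Omega> c (comp v i)) i)" by (rule sum.cong[OF refl]) (simp only: restrict_apply if_True)
      finally show ?thesis .
    qed
  qed
  have act_sum: "mact k\<Omega> g (\<Sum>i\<in>J. f i) = (\<Sum>i\<in>J. mact k\<Omega> g (f i))" for g J and f :: "'i \<Rightarrow> 'a \<Rightarrow> 'k"
    by (rule ext) (simp add: mact_k\<Omega> sum_fun_apply)
  have comp_act: "comp (mact k\<Omega> g v) = (\<lambda>i\<in>I. mact k\<Omega> g (comp v i))" if v: "v \<in> img e" and g: "g \<in> carrier G" for v g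
  proof (rule comp_eq)
    show "mact k\<Omega> g v \<in> img e" using img_act[OF eE(1) v g] .
    show "(\<lambda>i\<in>I. mact k\<Omega> g (comp v i)) \<in> (\<Pi>\<^sub>E i\<in>I. A i)" using Aact compA v g by auto
    show "mact k\<Omega> g v = (\<Sum>i\<in>I. (\<lambda>i\<in>I. mact k\<Omega> g (comp v i)) i)"
    proof -
      have "mact k\<Omega> g v = mact k\<Omega> g (\<Sum>i\<in>I. comp v i)" using comp(2)[OF v] by simp
      also have "\<dots> = (\<Sum>i\<in>I. mact k\<Omega> g (comp v i))" by (rule act_sum)
      also have "\<dots> = (\<Sum>i\<in>I. (\<lambda>i\<in>I. mact k\<Omega> g (comp v i)) i)" by (rule sum.cong[OF refl]) (simp only: restrict_apply if_True)
      finally show ?thesis .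
    qed
  qed
  have comp_A: "comp v = (\<lambda>j\<in>I. if j = i then v else 0)" if i: "i \<in> I" and v: "v \<in> A i" for i v
  proof (rule comp_eq)
    show "v \<in> img e" using sub(2) i v by blast
    show "(\<lambda>j\<in>I. if j = i then v else 0) \<in> (\<Pi>\<^sub>E i\<in>I. A i)" using v Azero by auto
    have "(\<Sum>j\<in>I. (\<lambda>j\<in>I. if j = i then v else 0) j) = (\<Sum>j\<in>I. if j = i then v else 0)"
      by (rule sum.cong[OF refl]) (simp only: restrict_apply if_True)
    also have "\<dots> = v" using fin i by (simp only: sum.delta if_True)
    finally show "v = (\<Sum>j\<in>I. (\<lambda>j\<in>I. if j = i then v else 0) j)" ..
  qed
  define h where "h i v = comp (mat_apply \<Omega> e v) i" for i v
  define d where "d i = matrix_of \<Omega> (h i)" for i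
  note ev = mat_apply_in_img[OF e]
  have hA: "h i v \<in> A i" if "i \<in> I" for i v using compA[OF ev that] by (simp add: h_def)
  have app: "mat_apply \<Omega> (d i) v = h i v" if i: "i \<in> I" and v: "v \<in> carrier k\<Omega>" for i v
    unfolding d_def
  proof (rule matrix_of_apply[OF _ _ _ v])
    show "h i v \<in> carrier k\<Omega>" for v using Acar i hA by blast
    show "h i (v + w) = h i v + h i w" for v w
      using comp_add[OF ev[of v] ev[of w]] i by (simp add: h_def mat_apply_add)
    show "h i (mscale k\<Omega> c v) = mscale k\<Omega> c (h i v)" for c v
    proof -
      have "mat_apply \<Omega> e (mscale k\<Omega> c v) = mscale k\<Omega> c (mat_apply \<Omega> e v)" by (simp add: mscale_k\<Omega> mat_apply_scale)
      then show ?thesis using comp_scale[OF ev[of v], of c] i by (simp add: h_def)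
    qed
  qed
  have dE: "d i \<in> E" if i: "i \<in> I" for i unfolding d_def
  proof (rule matrix_of_invariant[OF _ subset_refl])
    show "h i (mact k\<Omega> g v) = mact k\<Omega> g (h i v)" if g: "g \<in> carrier G" for g v
      using comp_act[OF ev g, of v] i mat_apply_act[OF eE(1) g subset_refl, of v] by (simp add: h_def)
  qed
  note dM = E_matrices[OF dE]
  have hcar: "h i v \<in> carrier k\<Omega>" if "i \<in> I" for i v using Acar that hA by blast
  have hh: "h i (h j v) = (if i = j then h j v else 0)" if "i \<in> I" "j \<in> I" for i j v
  proof -
    have "mat_apply \<Omega> e (h j v) = h j v" using hA[OF that(2)] sub(2)[OF that(2)] mat_apply_img by blast
    then show ?thesis using comp_A[OF that(2) hA[OF that(2)], of v] that(1) by (simp add: h_def)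
  qed
  have dd: "mat_mult \<Omega> (d i) (d j) = (if i = j then d j else 0)" if ij: "i \<in> I" "j \<in> I" for i j
  proof (rule E_eqI)
    show "mat_mult \<Omega> (d i) (d j) \<in> matrices \<Omega>" using E_matrices alg.mult_closed[OF dE[OF ij(1)] dE[OF ij(2)]] .
    show "(if i = j then d j else 0) \<in> matrices \<Omega>" using dM[OF ij(2)] by (simp add: matrices_def)
    fix v assume v: "v \<in> carrier k\<Omega>"
    show "mat_apply \<Omega> (mat_mult \<Omega> (d i) (d j)) v = mat_apply \<Omega> (if i = j then d j else 0) v"
      using app[OF ij(2) v] app[OF ij(1) hcar[OF ij(2), of v]] hh[OF ij, of v]
      by (simp add: mat_apply_mult mat_apply_zero_left)
  qed
  have corner: "d i \<in> alg.corner e" if i: "i \<in> I" for i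
  proof -
    have "mat_mult \<Omega> e (d i) = d i"
    proof (rule E_eqI[OF _ dM[OF i]])
      show "mat_mult \<Omega> e (d i) \<in> matrices \<Omega>" using E_matrices alg.mult_closed[OF eE(1) dE[OF i]] .
      fix v assume v: "v \<in> carrier k\<Omega>"
      have "mat_apply \<Omega> e (h i v) = h i v" using hA[OF i] sub(2)[OF i] mat_apply_img by blast
      then show "mat_apply \<Omega> (mat_mult \<Omega> e (d i)) v = mat_apply \<Omega> (d i) v"
        using app[OF i v] by (simp add: mat_apply_mult)
    qed
    moreover have "mat_mult \<Omega> (d i) e = d i"
    proof (rule E_eqI[OF _ dM[OF i]])
      show "mat_mult \<Omega> (d i) e \<in> matrices \<Omega>" using E_matrices alg.mult_closed[OF dE[OF i] eE(1)] .
      fix v assume v: "v \<in> carrier k\<Omega>"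
      have "mat_apply \<Omega> e v \<in> carrier k\<Omega>" using ev img_subset by blast
      moreover have "h i (mat_apply \<Omega> e v) = h i v" by (simp add: h_def eE(2) flip: mat_apply_mult)
      ultimately show "mat_apply \<Omega> (mat_mult \<Omega> (d i) e) v = mat_apply \<Omega> (d i) v"
        using app[OF i v] app[OF i] by (simp add: mat_apply_mult)
    qed
    ultimately show ?thesis using dE[OF i] by (simp add: alg.corner_def)
  qed
  have img: "img (d i) = A i" if i: "i \<in> I" for i
  proof
    show "img (d i) \<subseteq> A i"
    proof
      fix v assume v: "v \<in> img (d i)"
      then have "v = h i v" using app[OF i, of v] by (simp add: img_def)
      then show "v \<in> A i" using hA[OF i, of v] by simp
    qed
    show "A i \<subseteq> img (d i)"
    proof
      fix v assume v: "v \<in> A i"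
      have "mat_apply \<Omega> e v = v" using v sub(2)[OF i] mat_apply_img by blast
      then have "h i v = v" using comp_A[OF i v] i by (simp add: h_def)
      then show "v \<in> img (d i)" using app[OF i Acar[OF i v]] Acar[OF i v] by (simp add: img_def)
    qed
  qed
  have "(\<Sum>i\<in>I. d i) = e"
  proof (rule E_eqI)
    show "(\<Sum>i\<in>I. d i) \<in> matrices \<Omega>" using E_matrices alg.E_sum dE by blast
    show "e \<in> matrices \<Omega>" using E_matrices eE(1) .
    fix v assume v: "v \<in> carrier k\<Omega>"
    have "mat_apply \<Omega> (\<Sum>i\<in>I. d i) v = (\<Sum>i\<in>I. h i v)"
      unfolding mat_apply_sum_left by (rule sum.cong[OF refl]) (rule app[OF _ v])
    also have "\<dots> = mat_apply \<Omega> e v" unfolding h_def by (rule comp(2)[OF ev, symmetric])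
    finally show "mat_apply \<Omega> (\<Sum>i\<in>I. d i) v = mat_apply \<Omega> e v" .
  qed
  then show thesis using that[of d] corner dd img by simp
qed

lemma sum_01: "(\<Sum>i\<in>{0, 1}. f i) = f 0 + f 1" for f :: "nat \<Rightarrow> 'x \<Rightarrow> 'y::comm_monoid_add"
  by (rule ext) (simp add: sum_fun_apply)

text \<open>
  A direct sum of two submodules is treated as a family indexed by \<open>{0, 1}\<close>; indexing by the set
  \<open>{A, B}\<close> would fail for \<open>A = B = {0}\<close>.
\<close>

lemma idempotents_of_direct_sum:
  assumes e: "alg.idempotent e" and AB: "internal_direct_sum G (summand e) A B"
  obtains d where "d \<in> alg.corner e" "mat_mult \<Omega> d d = d" "img d = A" "img (e - d) = B"
proof -
  have eE: "e \<in> E" using e by (auto simp: alg.idempotent_def)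
  note ids = AB[unfolded internal_direct_sum_def]
  have sm: "kG_submodule G (summand e) A" "kG_submodule G (summand e) B"
    by (rule conjunct1[OF ids], rule conjunct1[OF conjunct2[OF ids]])
  have int: "A \<inter> B = {0}" by (rule conjunct1[OF conjunct2[OF conjunct2[OF ids]]])
  have "carrier (summand e) = {a + b | a b. a \<in> A \<and> b \<in> B}"
    by (rule conjunct2[OF conjunct2[OF conjunct2[OF ids]]])
  then have sum: "img e = {a + b | a b. a \<in> A \<and> b \<in> B}" by simp
  have sub: "A \<subseteq> img e" "B \<subseteq> img e" and subA: "Mod.subspace A" "Mod.subspace B"
    using sm unfolding kG_submodule_def by simp_all
  have submod: "kG_submodule G k\<Omega> A" "kG_submodule G k\<Omega> B"
    using sm subset_trans[OF sub(1) img_subset] subset_trans[OF sub(2) img_subset]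
    unfolding kG_submodule_def by simp_all
  define F where "F i = (if i = 0 then A else B)" for i :: nat
  obtain d where d: "\<And>i. i \<in> {0, 1::nat} \<Longrightarrow> d i \<in> alg.corner e \<and> mat_mult \<Omega> (d i) (d i) = d i \<and> img (d i) = F i"
    "(\<Sum>i\<in>{0, 1}. d i) = e"
  proof (rule idempotents_of_decomposition[OF e, of "{0, 1}" F])
    show "finite {0, 1::nat}" by simp
    show "kG_submodule G k\<Omega> (F i)" for i using submod by (simp add: F_def)
    show "F i \<subseteq> img e" for i using sub by (simp add: F_def)
    fix v assume "v \<in> img e"
    then obtain a b where ab: "a \<in> A" "b \<in> B" "v = a + b" using sum by blast
    define w where "w = (\<lambda>i\<in>{0,1::nat}. if i = 0 then a else b)"
    have w: "w 0 = a" "w 1 = b" by (simp_all add: w_def)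
    show "\<exists>!f. f \<in> (\<Pi>\<^sub>E i\<in>{0, 1}. F i) \<and> v = (\<Sum>i\<in>{0, 1}. f i)"
    proof (rule ex1I[of _ w], intro conjI)
      show "w \<in> (\<Pi>\<^sub>E i\<in>{0, 1}. F i)" using ab by (auto simp: F_def w_def)
      show "v = (\<Sum>i\<in>{0, 1}. w i)" unfolding sum_01 w by (rule ab(3))
      fix f assume f: "f \<in> (\<Pi>\<^sub>E i\<in>{0, 1}. F i) \<and> v = (\<Sum>i\<in>{0, 1}. f i)"
      have f': "f 0 \<in> A" "f 1 \<in> B" using f by (auto simp: F_def PiE_iff split: if_splits)
      have fv: "v = f 0 + f 1" using f unfolding sum_01 by blast
      have eq: "a - f 0 = f 1 - b" using ab(3) fv by (simp add: algebra_simps)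
      have "a - f 0 \<in> A" using Mod.subspace_diff[OF subA(1)] ab f' by blast
      moreover have "a - f 0 \<in> B" unfolding eq using Mod.subspace_diff[OF subA(2)] ab f' by blast
      ultimately have z: "a - f 0 = 0" using int by blast
      then have "a = f 0" "f 1 = b" using eq by simp_all
      then show "f = w"
        using f by (intro ext) (auto simp: PiE_def extensional_def w_def)
    qed
  qed blast
  have "d 0 + d 1 = e" using d(2) unfolding sum_01 .
  then have "e - d 0 = d 1" by (simp add: algebra_simps)
  then show thesis using that[of "d 0"] d(1)[of 0] d(1)[of 1] by (simp add: F_def)
qed

lemma direct_sum_of_idempotent:
  assumes e: "alg.idempotent e" and d: "d \<in> alg.corner e" "mat_mult \<Omega> d d = d"
  shows "internal_direct_sum G (summand e) (img d) (img (e - d))"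
proof -
  have eE: "e \<in> E" "mat_mult \<Omega> e e = e" using e by (auto simp: alg.idempotent_def)
  have dE: "d \<in> E" "mat_mult \<Omega> e d = d" "mat_mult \<Omega> d e = d" using d by (auto simp: alg.corner_def)
  have cE: "e - d \<in> E" using alg.E_diff eE dE by blast
  have ec: "mat_mult \<Omega> e (e - d) = e - d" by (simp only: alg.diff_right eE dE)
  have dc: "mat_mult \<Omega> d (e - d) = 0" by (simp only: alg.diff_right d dE diff_self)
  have sub: "img f \<subseteq> img e" if "mat_mult \<Omega> e f = f" for f
  proof
    fix v assume v: "v \<in> img f"
    have "mat_apply \<Omega> e v = mat_apply \<Omega> e (mat_apply \<Omega> f v)" using mat_apply_img[OF v] by simp
    also have "\<dots> = mat_apply \<Omega> (mat_mult \<Omega> e f) v" by (rule mat_apply_mult[symmetric])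
    also have "\<dots> = v" using that mat_apply_img[OF v] by simp
    finally show "v \<in> img e" using v by (simp add: img_def)
  qed
  have submod: "kG_submodule G (summand e) (img f)" if "f \<in> E" "mat_mult \<Omega> e f = f" for f
    using submodule_img[OF that(1)] sub[OF that(2)] by (simp add: kG_submodule_def)
  have "img d \<inter> img (e - d) = {0}"
  proof
    show "{0} \<subseteq> img d \<inter> img (e - d)" using img_zero by blast
    show "img d \<inter> img (e - d) \<subseteq> {0}"
    proof
      fix v assume v: "v \<in> img d \<inter> img (e - d)"
      have "v = mat_apply \<Omega> d (mat_apply \<Omega> (e - d) v)" using v mat_apply_img by auto
      also have "\<dots> = 0" by (simp add: dc mat_apply_zero_left flip: mat_apply_mult)
      finally show "v \<in> {0}" by simp
    qed
  qed
  moreover have "img e = {a + b | a b. a \<in> img d \<and> b \<in> img (e - d)}"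
  proof
    show "img e \<subseteq> {a + b | a b. a \<in> img d \<and> b \<in> img (e - d)}"
    proof
      fix v assume v: "v \<in> img e"
      have "mat_mult \<Omega> (e - d) (e - d) = e - d"
        by (simp only: alg.diff_right alg.diff_left eE dE d diff_self diff_zero)
      then have ic: "alg.idempotent (e - d)" using cE by (simp add: alg.idempotent_def)
      have id: "alg.idempotent d" using dE d by (simp add: alg.idempotent_def)
      have "v = mat_apply \<Omega> d v + mat_apply \<Omega> (e - d) v"
        using mat_apply_img[OF v] by (simp add: mat_apply_diff_left)
      then show "v \<in> {a + b | a b. a \<in> img d \<and> b \<in> img (e - d)}"
        using mat_apply_in_img[OF ic, of v] mat_apply_in_img[OF id, of v] by blast
    qed
    show "{a + b | a b. a \<in> img d \<and> b \<in> img (e - d)} \<subseteq> img e"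
      using img_closed sub[OF dE(2)] sub[OF ec] by blast
  qed
  ultimately show ?thesis
    using submod[OF dE(1,2)] submod[OF cE ec] by (simp add: internal_direct_sum_def)
qed

lemma direct_summand_iff: "direct_summand G k\<Omega> A \<longleftrightarrow> (\<exists>e. alg.idempotent e \<and> A = img e)"
proof
  assume "direct_summand G k\<Omega> A"
  then obtain B where "internal_direct_sum G (summand (mat_one \<Omega>)) A B"
    unfolding summand_one by (auto simp: direct_summand_def)
  then obtain d where "d \<in> alg.corner (mat_one \<Omega>)" "mat_mult \<Omega> d d = d" "img d = A"
    by (rule idempotents_of_direct_sum[OF idempotent_one])
  then show "\<exists>e. alg.idempotent e \<and> A = img e"
    by (auto simp: alg.idempotent_def alg.corner_def)
next
  assume "\<exists>e. alg.idempotent e \<and> A = img e"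
  then obtain e where e: "alg.idempotent e" "A = img e" by blast
  then have "e \<in> alg.corner (mat_one \<Omega>)" "mat_mult \<Omega> e e = e"
    by (auto simp: alg.idempotent_def alg.corner_def alg.one_left alg.one_right)
  then have "internal_direct_sum G k\<Omega> (img e) (img (mat_one \<Omega> - e))"
    using direct_sum_of_idempotent[OF idempotent_one, of e] unfolding summand_one by blast
  then show "direct_summand G k\<Omega> A" using e(2) unfolding direct_summand_def by blast
qed

lemma indecomposable_iff_primitive:
  assumes e: "alg.idempotent e"
  shows "indecomposable G (summand e) \<longleftrightarrow> alg.primitive e"
proof
  have eE: "e \<in> E" "mat_mult \<Omega> e e = e" using e by (auto simp: alg.idempotent_def)
  have cidem: "alg.idempotent d" "alg.idempotent (e - d)" if "d \<in> alg.corner e" "mat_mult \<Omega> d d = d" for d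
  proof -
    have dE: "d \<in> E" "mat_mult \<Omega> e d = d" "mat_mult \<Omega> d e = d" using that by (auto simp: alg.corner_def)
    show "alg.idempotent d" using dE that by (simp add: alg.idempotent_def)
    have "mat_mult \<Omega> (e - d) (e - d) = e - d"
      by (simp only: alg.diff_right alg.diff_left eE dE that(2) diff_self diff_zero)
    then show "alg.idempotent (e - d)" using alg.E_diff eE dE by (simp add: alg.idempotent_def)
  qed
  {
    assume ind: "indecomposable G (summand e)"
    have "d = 0 \<or> d = e" if d: "d \<in> alg.corner e" "mat_mult \<Omega> d d = d" for d
    proof -
      have "img d = {0} \<or> img (e - d) = {0}"
        using ind direct_sum_of_idempotent[OF e d] by (auto simp: indecomposable_def)
      then have "d = 0 \<or> e - d = 0" using img_zero_iff cidem[OF d] by blast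
      then show ?thesis by auto
    qed
    moreover have "e \<noteq> 0" using ind img_zero_iff[OF e] by (auto simp: indecomposable_def)
    ultimately show "alg.primitive e" using e unfolding alg.primitive_def by blast
  next
    assume p: "alg.primitive e"
    have "A = {0} \<or> B = {0}" if AB: "internal_direct_sum G (summand e) A B" for A B
    proof -
      obtain d where d: "d \<in> alg.corner e" "mat_mult \<Omega> d d = d" "img d = A" "img (e - d) = B"
        by (rule idempotents_of_direct_sum[OF e AB])
      then have "d = 0 \<or> e - d = 0" using p by (auto simp: alg.primitive_def)
      then show ?thesis using d img_zero_iff cidem[OF d(1,2)] by blast
    qed
    moreover have "img e \<noteq> {0}" using p img_zero_iff[OF e] by (simp add: alg.primitive_def)
    ultimately show "indecomposable G (summand e)" by (simp add: indecomposable_def)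
  }
qed

lemma decomposition_of_idempotents:
  assumes S: "alg.primitive_decomposition S"
  shows "indecomposable_decomposition G k\<Omega> (img ` S)" "inj_on img S"
proof -
  have fin: "finite S" and prim: "\<And>f. f \<in> S \<Longrightarrow> alg.primitive f"
    and orth: "\<And>f g. f \<in> S \<Longrightarrow> g \<in> S \<Longrightarrow> f \<noteq> g \<Longrightarrow> mat_mult \<Omega> f g = 0" and sum: "(\<Sum>f\<in>S. f) = mat_one \<Omega>"
    using S by (auto simp: alg.primitive_decomposition_def id_def)
  have idem: "alg.idempotent f" if "f \<in> S" for f using alg.primitive_idempotent prim that by blast
  have orth': "mat_apply \<Omega> f v = 0" if "f \<in> S" "g \<in> S" "f \<noteq> g" "v \<in> img g" for f g v
  proof -
    have "mat_apply \<Omega> f v = mat_apply \<Omega> (mat_mult \<Omega> f g) v"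
      using mat_apply_img[OF that(4)] by (simp add: mat_apply_mult)
    then show ?thesis using orth[OF that(1-3)] by (simp add: mat_apply_zero_left)
  qed
  show inj: "inj_on img S"
  proof (rule inj_onI, rule ccontr)
    fix f g assume fg: "f \<in> S" "g \<in> S" "img f = img g" "f \<noteq> g"
    have "v = 0" if "v \<in> img f" for v
      using orth'[OF fg(1,2,4)] mat_apply_img[OF that] that fg(3) by simp
    then have "img f = {0}" using img_zero by blast
    then show False using img_zero_iff idem prim fg(1) by (auto simp: alg.primitive_def)
  qed
  show "indecomposable_decomposition G k\<Omega> (img ` S)"
    unfolding indecomposable_decomposition_def
  proof (intro conjI ballI)
    show "finite (img ` S)" using fin by simp
  next
    fix A assume "A \<in> img ` S"
    then obtain f where f: "f \<in> S" "A = img f" by blast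
    show "kG_submodule G k\<Omega> A" using f submodule_img idem by (auto simp: alg.idempotent_def)
    show "indecomposable G (k\<Omega>\<lparr>carrier := A\<rparr>)" using f indecomposable_iff_primitive idem prim by blast
  next
    fix v assume v: "v \<in> carrier k\<Omega>"
    define pr where "pr A = inv_into S img A" for A
    have pr: "pr (img f) = f" if "f \<in> S" for f using inj that by (simp add: pr_def)
    have re: "(\<Sum>A\<in>img ` S. F A) = (\<Sum>f\<in>S. F (img f))" for F :: "('a \<Rightarrow> 'k) set \<Rightarrow> 'a \<Rightarrow> 'k"
      using sum.reindex[OF inj, of F] by (simp only: o_def)
    show "\<exists>!F. F \<in> (\<Pi>\<^sub>E A\<in>img ` S. A) \<and> v = (\<Sum>A\<in>img ` S. F A)"
    proof (rule ex1I[of _ "\<lambda>A\<in>img ` S. mat_apply \<Omega> (pr A) v"], intro conjI)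
      show "(\<lambda>A\<in>img ` S. mat_apply \<Omega> (pr A) v) \<in> (\<Pi>\<^sub>E A\<in>img ` S. A)"
        using pr mat_apply_in_img idem by auto
      have "(\<Sum>A\<in>img ` S. (\<lambda>A\<in>img ` S. mat_apply \<Omega> (pr A) v) A) = (\<Sum>f\<in>S. mat_apply \<Omega> f v)"
        unfolding re by (rule sum.cong[OF refl]) (simp add: pr)
      also have "\<dots> = mat_apply \<Omega> (\<Sum>f\<in>S. f) v" by (rule mat_apply_sum_left[symmetric])
      also have "\<dots> = v" using sum mat_one_apply[OF v] by simp
      finally show "v = (\<Sum>A\<in>img ` S. (\<lambda>A\<in>img ` S. mat_apply \<Omega> (pr A) v) A)" ..
      fix F assume F: "F \<in> (\<Pi>\<^sub>E A\<in>img ` S. A) \<and> v = (\<Sum>A\<in>img ` S. F A)"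
      have "F (img f) = mat_apply \<Omega> f v" if f: "f \<in> S" for f
      proof -
        have "mat_apply \<Omega> f v = (\<Sum>g\<in>S. mat_apply \<Omega> f (F (img g)))"
          using F unfolding re by (metis mat_apply_sum)
        also have "\<dots> = (\<Sum>g\<in>S. if g = f then F (img f) else 0)"
        proof (rule sum.cong[OF refl])
          fix g assume g: "g \<in> S"
          have "F (img g) \<in> img g" using F g by auto
          then show "mat_apply \<Omega> f (F (img g)) = (if g = f then F (img f) else 0)"
            using orth'[OF f g] mat_apply_img by auto
        qed
        also have "\<dots> = F (img f)" using fin f by (simp only: sum.delta if_True)
        finally show ?thesis ..
      qed
      then show "F = (\<lambda>A\<in>img ` S. mat_apply \<Omega> (pr A) v)"
        using F by (intro ext) (auto simp: pr PiE_def extensional_def)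
    qed
  qed
qed

lemma idempotents_of_indecomposable_decomposition:
  assumes D: "indecomposable_decomposition G k\<Omega> D"
  obtains S where "alg.primitive_decomposition S" "img ` S = D" "inj_on img S"
proof -
  have fin: "finite D" and sub: "\<And>A. A \<in> D \<Longrightarrow> kG_submodule G k\<Omega> A"
    and ind: "\<And>A. A \<in> D \<Longrightarrow> indecomposable G (k\<Omega>\<lparr>carrier := A\<rparr>)"
    and dec: "\<And>v. v \<in> carrier k\<Omega> \<Longrightarrow> \<exists>!f. f \<in> (\<Pi>\<^sub>E A\<in>D. A) \<and> v = (\<Sum>A\<in>D. f A)"
    using D by (auto simp: indecomposable_decomposition_def)
  obtain d where d: "\<And>A. A \<in> D \<Longrightarrow> d A \<in> alg.corner (mat_one \<Omega>) \<and> mat_mult \<Omega> (d A) (d A) = d A \<and> img (d A) = A"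
    "\<And>A B. A \<in> D \<Longrightarrow> B \<in> D \<Longrightarrow> A \<noteq> B \<Longrightarrow> mat_mult \<Omega> (d A) (d B) = 0" "(\<Sum>A\<in>D. d A) = mat_one \<Omega>"
  proof (rule idempotents_of_decomposition[OF idempotent_one fin, of "\<lambda>A. A"])
    show "A \<subseteq> img (mat_one \<Omega>)" if "A \<in> D" for A using sub[OF that] by (simp add: img_one kG_submodule_def)
  qed (use sub dec img_one in auto)
  have idem: "alg.idempotent (d A)" if "A \<in> D" for A
    using d(1)[OF that] by (simp add: alg.idempotent_def alg.corner_def)
  have inj: "inj_on d D" using d(1) by (metis inj_onI)
  have "alg.primitive_decomposition (d ` D)"
    unfolding alg.primitive_decomposition_def
  proof (intro conjI ballI impI)
    show "finite (d ` D)" using fin by simp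
    show "alg.primitive e" if "e \<in> d ` D" for e
      using that ind d(1) indecomposable_iff_primitive[OF idem] by auto
    show "mat_mult \<Omega> e f = 0" if "e \<in> d ` D" "f \<in> d ` D" "e \<noteq> f" for e f using that d(2) by auto
    show "sum id (d ` D) = mat_one \<Omega>" using sum.reindex[OF inj, of id] d(3) by (simp only: o_def id_def)
  qed
  moreover have "img ` d ` D = D" using d(1) by (auto simp: image_iff)
  moreover have "inj_on img (d ` D)" using d(1) by (auto simp: inj_on_def)
  ultimately show thesis using that by blast
qed

text \<open>
  By the Krull--Schmidt theorem for idempotents, the number in the definition of the multiplicity
  exists and is unique.
\<close>

theorem copies_iff_multiplicity:
  assumes e: "alg.primitive e"
  shows "alg.copies e n \<longleftrightarrow> n \<le> summand_multiplicity G k\<Omega> (summand e)"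
proof -
  note ide = alg.primitive_idempotent[OF e]
  have card: "card {A \<in> img ` S. kG_isomorphic G (k\<Omega>\<lparr>carrier := A\<rparr>) (summand e)} = card {f \<in> S. alg.equivalent f e}"
    if S: "alg.primitive_decomposition S" and inj: "inj_on img S" for S
  proof -
    have idem: "alg.idempotent f" if "f \<in> S" for f
      using alg.primitive_idempotent S that by (auto simp: alg.primitive_decomposition_def)
    have "{A \<in> img ` S. kG_isomorphic G (k\<Omega>\<lparr>carrier := A\<rparr>) (summand e)} = img ` {f \<in> S. alg.equivalent f e}"
      using isomorphic_iff_equivalent[OF idem ide] by blast
    then show ?thesis using card_image[of img "{f \<in> S. alg.equivalent f e}"] inj by (simp add: inj_on_def)
  qed
  obtain S where S: "alg.primitive_decomposition S" using alg.primitive_decomposition_exists by blast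
  have "summand_multiplicity G k\<Omega> (summand e) = card {f \<in> S. alg.equivalent f e}"
    unfolding summand_multiplicity_def
  proof (rule the_equality)
    show "\<exists>D. indecomposable_decomposition G k\<Omega> D \<and>
        card {A \<in> D. kG_isomorphic G (k\<Omega>\<lparr>carrier := A\<rparr>) (summand e)} = card {f \<in> S. alg.equivalent f e}"
      using decomposition_of_idempotents[OF S] card[OF S] by blast
    fix m assume "\<exists>D. indecomposable_decomposition G k\<Omega> D \<and>
        card {A \<in> D. kG_isomorphic G (k\<Omega>\<lparr>carrier := A\<rparr>) (summand e)} = m"
    then obtain D where D: "indecomposable_decomposition G k\<Omega> D"
        "card {A \<in> D. kG_isomorphic G (k\<Omega>\<lparr>carrier := A\<rparr>) (summand e)} = m" by blast
    obtain S' where S': "alg.primitive_decomposition S'" "img ` S' = D" "inj_on img S'"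
      by (rule idempotents_of_indecomposable_decomposition[OF D(1)])
    have m: "m = card {f \<in> S'. alg.equivalent f e}" using card[OF S'(1,3)] D(2) S'(2) by simp
    have "n \<le> m \<longleftrightarrow> n \<le> card {f \<in> S. alg.equivalent f e}" for n
      using alg.copies_iff_le_card[OF S e] alg.copies_iff_le_card[OF S'(1) e] m by simp
    then show "m = card {f \<in> S. alg.equivalent f e}" by (meson order_antisym order_refl)
  qed
  then show ?thesis using alg.copies_iff_le_card[OF S e] by simp
qed

end


section \<open>Sums over cosets and relative traces\<close>

context group
begin

definition cosets :: "'a set \<Rightarrow> 'a set \<Rightarrow> 'a set set" where
  "cosets K H = (\<lambda>g. H #> g) ` K"

definition rep :: "'a set \<Rightarrow> 'a" where
  "rep C = (SOME g. g \<in> C)"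

lemma rep_coset:
  assumes H: "subgroup H G" and g: "g \<in> carrier G"
  obtains h where "h \<in> H" "rep (H #> g) = h \<otimes> g"
proof -
  have "rep (H #> g) \<in> H #> g" unfolding rep_def by (rule someI[of "\<lambda>x. x \<in> H #> g", OF rcos_self[OF g H]])
  then show thesis using that by (auto simp: r_coset_def)
qed

lemma rep_invariant:
  assumes H: "subgroup H G" and g: "g \<in> carrier G"
    and F: "\<And>h g. h \<in> H \<Longrightarrow> g \<in> carrier G \<Longrightarrow> F (h \<otimes> g) = F g"
  shows "F (rep (H #> g)) = F g"
  using rep_coset[OF H g] F g by metis

lemma coset_eq_iff:
  assumes "subgroup H G" "g \<in> carrier G" "g' \<in> carrier G"
  shows "H #> g = H #> g' \<longleftrightarrow> g \<otimes> inv g' \<in> H"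
  using repr_independence[of g H g'] repr_independenceD[of H g g'] subgroup.rcos_module[of H G g' g] assms
    is_group rcos_self[of g H] by metis

lemma rep_in:
  assumes H: "subgroup H G" and K: "subgroup K G" "H \<subseteq> K" and C: "C \<in> cosets K H"
  shows "rep C \<in> K" "H #> rep C = C"
proof -
  obtain g where g: "g \<in> K" "C = H #> g" using C by (auto simp: cosets_def)
  have gG: "g \<in> carrier G" using g subgroup.subset[OF K(1)] by blast
  obtain h where h: "h \<in> H" "rep C = h \<otimes> g" using rep_coset[OF H gG] g by blast
  show "rep C \<in> K" using h g K subgroup.m_closed[OF K(1)] by auto
  have "h \<otimes> g \<in> H #> g" using h(1) by (auto simp: r_coset_def)
  then show "H #> rep C = C" using repr_independence[OF _ gG H] h g by simp
qed

lemma coset_shift_bij: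
  assumes H: "subgroup H G" and K: "subgroup K G" "H \<subseteq> K" and k: "k \<in> K"
  shows "bij_betw (\<lambda>C. C #> k) (cosets K H) (cosets K H)"
proof -
  have HG: "H \<subseteq> carrier G" and KG: "K \<subseteq> carrier G" using H K subgroup.subset by blast+
  have sh: "(H #> g) #> x = H #> (g \<otimes> x)" if "g \<in> K" "x \<in> K" for g x
    using coset_mult_assoc[OF HG] that KG by blast
  have ik: "inv k \<in> K" using subgroup.m_inv_closed[OF K(1) k] .
  have closed: "C #> x \<in> cosets K H" if "C \<in> cosets K H" "x \<in> K" for C x
    using that sh subgroup.m_closed[OF K(1)] by (auto simp: cosets_def)
  have undo: "C #> x #> inv x = C" "C #> inv x #> x = C" if CK: "C \<in> cosets K H" and x: "x \<in> K" for C x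
  proof -
    obtain g where g: "g \<in> K" "C = H #> g" using CK by (auto simp: cosets_def)
    have G: "g \<in> carrier G" "x \<in> carrier G" using g x KG by blast+
    have C: "C \<subseteq> carrier G" using g HG G r_coset_subset_G by blast
    show "C #> x #> inv x = C" "C #> inv x #> x = C"
      using coset_mult_assoc[OF C] G C by simp_all
  qed
  show ?thesis
    by (rule bij_betw_byWitness[where f' = "\<lambda>C. C #> inv k"]) (use closed undo k ik in auto)
qed

text \<open>
  A function that is constant on the right cosets of \<open>H\<close> is summed over \<open>H \<setminus> K\<close>. Right
  multiplication by an element of \<open>K\<close> permutes these cosets.
\<close>

lemma sum_cosets_shift:
  fixes F :: "'a \<Rightarrow> 'c::comm_monoid_add"
  assumes H: "subgroup H G" and K: "subgroup K G" "H \<subseteq> K" and k: "k \<in> K"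
    and F: "\<And>h g. h \<in> H \<Longrightarrow> g \<in> carrier G \<Longrightarrow> F (h \<otimes> g) = F g"
  shows "(\<Sum>C\<in>cosets K H. F (rep C \<otimes> k)) = (\<Sum>C\<in>cosets K H. F (rep C))"
proof -
  have KG: "K \<subseteq> carrier G" and HG: "H \<subseteq> carrier G" using H K subgroup.subset by blast+
  have "F (rep (C #> k)) = F (rep C \<otimes> k)" if "C \<in> cosets K H" for C
  proof -
    have "C #> k = H #> (rep C \<otimes> k)"
      using coset_mult_assoc[OF HG, of "rep C" k] rep_in[OF H K that] k KG by auto
    then show ?thesis using rep_invariant[OF H _ F, of "rep C \<otimes> k"] rep_in[OF H K that] k KG by auto
  qed
  then have "(\<Sum>C\<in>cosets K H. F (rep C \<otimes> k)) = (\<Sum>C\<in>cosets K H. F (rep (C #> k)))" by simp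
  also have "\<dots> = (\<Sum>C\<in>cosets K H. F (rep C))"
    by (rule sum.reindex_bij_betw[OF coset_shift_bij[OF H K k]])
  finally show ?thesis .
qed

text \<open>
  If \<open>d\<close> runs over representatives of the cosets of \<open>K\<close> in \<open>L\<close>, and \<open>c\<close> over representatives of
  the cosets of \<open>H\<close> in \<open>K\<close>, then \<open>c d\<close> runs over representatives of the cosets of \<open>H\<close> in \<open>L\<close>.
\<close>

lemma sum_cosets_trans:
  fixes F :: "'a \<Rightarrow> 'c::comm_monoid_add"
  assumes H: "subgroup H G" and K: "subgroup K G" "H \<subseteq> K" and L: "subgroup L G" "K \<subseteq> L"
    and F: "\<And>h g. h \<in> H \<Longrightarrow> g \<in> carrier G \<Longrightarrow> F (h \<otimes> g) = F g"
  shows "(\<Sum>C\<in>cosets L H. F (rep C)) = (\<Sum>D\<in>cosets L K. \<Sum>C\<in>cosets K H. F (rep C \<otimes> rep D))"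
proof -
  have HG: "H \<subseteq> carrier G" and KG: "K \<subseteq> carrier G" and LG: "L \<subseteq> carrier G"
    using H K L subgroup.subset by blast+
  note rD = rep_in[OF K(1) L] and rC = rep_in[OF H K]
  let ?f = "\<lambda>(D, C). H #> (rep C \<otimes> rep D)"
  have KD: "K #> (k \<otimes> d) = K #> d" if "k \<in> K" "d \<in> L" for k d
    using repr_independence[of "k \<otimes> d" K d] that LG K(1) by (auto simp: r_coset_def)
  have bij: "bij_betw ?f (cosets L K \<times> cosets K H) (cosets L H)"
    unfolding bij_betw_def
  proof
    show "inj_on ?f (cosets L K \<times> cosets K H)"
    proof (rule inj_onI, clarify)
      fix D C D' C'
      assume D: "D \<in> cosets L K" "D' \<in> cosets L K" and C: "C \<in> cosets K H" "C' \<in> cosets K H"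
        and eq: "H #> (rep C \<otimes> rep D) = H #> (rep C' \<otimes> rep D')"
      note r = rC[OF C(1)] rC[OF C(2)] rD[OF D(1)] rD[OF D(2)]
      have G: "rep C \<in> carrier G" "rep C' \<in> carrier G" "rep D \<in> carrier G" "rep D' \<in> carrier G"
        using r KG LG by blast+
      have "rep C \<otimes> rep D \<in> H #> (rep C' \<otimes> rep D')"
        using rcos_self[OF _ H, of "rep C \<otimes> rep D"] G eq by simp
      then obtain h where h: "h \<in> H" "rep C \<otimes> rep D = h \<otimes> (rep C' \<otimes> rep D')"
        by (auto simp: r_coset_def)
      have hK: "h \<otimes> rep C' \<in> K" using h(1) K r subgroup.m_closed[OF K(1)] by blast
      have hG: "h \<in> carrier G" using h HG by blast
      have "D = K #> (rep C \<otimes> rep D)" using KD r by simp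
      also have "\<dots> = K #> ((h \<otimes> rep C') \<otimes> rep D')" using h(2) hG G by (simp add: m_assoc)
      also have "\<dots> = D'" using KD[OF hK] r by simp
      finally have DD: "D = D'" .
      then have "rep C \<otimes> rep D = (h \<otimes> rep C') \<otimes> rep D" using h(2) hG G by (simp add: m_assoc)
      then have "rep C = h \<otimes> rep C'" using right_cancel[of "rep D" "rep C" "h \<otimes> rep C'"] G hG by simp
      then have "rep C \<in> H #> rep C'" using h(1) by (auto simp: r_coset_def)
      then have "H #> rep C' = H #> rep C" using repr_independence[OF _ G(2) H] by blast
      then show "D = D' \<and> C = C'" using DD r by simp
    qed
    show "?f ` (cosets L K \<times> cosets K H) = cosets L H"
    proof
      show "?f ` (cosets L K \<times> cosets K H) \<subseteq> cosets L H"
      proof clarify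
        fix D C assume "D \<in> cosets L K" "C \<in> cosets K H"
        then have "rep C \<otimes> rep D \<in> L" using rC(1) rD(1) L subgroup.m_closed[OF L(1)] by blast
        then show "H #> (rep C \<otimes> rep D) \<in> cosets L H" by (simp add: cosets_def)
      qed
      show "cosets L H \<subseteq> ?f ` (cosets L K \<times> cosets K H)"
      proof
        fix B assume "B \<in> cosets L H"
        then obtain g where g: "g \<in> L" "B = H #> g" by (auto simp: cosets_def)
        have gG: "g \<in> carrier G" using g LG by blast
        let ?D = "K #> g"
        have D: "?D \<in> cosets L K" using g by (simp add: cosets_def)
        obtain k where k: "k \<in> K" "rep ?D = k \<otimes> g" using rep_coset[OF K(1) gG] by blast
        have kG: "k \<in> carrier G" using k KG by blast
        have ik: "inv k \<in> K" using subgroup.m_inv_closed[OF K(1) k(1)] .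
        let ?C = "H #> inv k"
        have C: "?C \<in> cosets K H" using ik by (simp add: cosets_def)
        obtain h where h: "h \<in> H" "rep ?C = h \<otimes> inv k" using rep_coset[OF H, of "inv k"] kG by blast
        have hG: "h \<in> carrier G" using h HG by blast
        have "rep ?C \<otimes> rep ?D = h \<otimes> g"
          unfolding h(2) k(2) using hG kG gG by (simp add: m_assoc flip: m_assoc[of "inv k" k g])
        then have "H #> (rep ?C \<otimes> rep ?D) = B"
          using repr_independence[OF _ gG H, of "h \<otimes> g"] h(1) g(2) by (auto simp: r_coset_def)
        then show "B \<in> ?f ` (cosets L K \<times> cosets K H)" using C D by force
      qed
    qed
  qed
  have "(\<Sum>C\<in>cosets L H. F (rep C)) = (\<Sum>z\<in>cosets L K \<times> cosets K H. F (rep (?f z)))"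
    by (rule sum.reindex_bij_betw[OF bij, symmetric])
  also have "\<dots> = (\<Sum>z\<in>cosets L K \<times> cosets K H. F (rep (snd z) \<otimes> rep (fst z)))"
  proof (rule sum.cong[OF refl])
    fix z assume z: "z \<in> cosets L K \<times> cosets K H"
    then have "rep (snd z) \<otimes> rep (fst z) \<in> carrier G" using rC(1) rD(1) KG LG by (auto intro!: m_closed)
    then show "F (rep (?f z)) = F (rep (snd z) \<otimes> rep (fst z))"
      using rep_invariant[OF H _ F] by (simp add: case_prod_beta)
  qed
  also have "\<dots> = (\<Sum>D\<in>cosets L K. \<Sum>C\<in>cosets K H. F (rep C \<otimes> rep D))"
    by (simp add: sum.cartesian_product case_prod_beta)
  finally show ?thesis .
qed

lemma card_cosets:
  assumes H: "subgroup H G" and K: "subgroup K G" "H \<subseteq> K"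
  shows "card (cosets K H) * card H = card K"
proof -
  interpret K: group "G\<lparr>carrier := K\<rparr>" using subgroup.subgroup_is_group[OF K(1)] is_group .
  have "subgroup H (G\<lparr>carrier := K\<rparr>)" using subgroup_incl[OF H K] .
  then have "card (rcosets\<^bsub>G\<lparr>carrier := K\<rparr>\<^esub> H) * card H = order (G\<lparr>carrier := K\<rparr>)" by (rule K.lagrange)
  moreover have "rcosets\<^bsub>G\<lparr>carrier := K\<rparr>\<^esub> H = cosets K H" by (auto simp: RCOSETS_def cosets_def r_coset_def)
  ultimately show ?thesis by (simp add: order_def)
qed

lemma finite_cosets: "finite K \<Longrightarrow> finite (cosets K H)"
  by (simp add: cosets_def)

lemma unique_coset:
  assumes H: "subgroup H G" and x: "x \<in> carrier G" and C: "C \<in> cosets (carrier G) H"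
  shows "rep C \<otimes> x \<in> H \<longleftrightarrow> C = H #> inv x"
proof -
  note r = rep_in[OF H subgroup_self subgroup.subset[OF H] C]
  have "C = H #> inv x \<longleftrightarrow> H #> rep C = H #> inv x" using r by simp
  also have "\<dots> \<longleftrightarrow> rep C \<otimes> x \<in> H" using coset_eq_iff[OF H r(1), of "inv x"] x by simp
  finally show ?thesis by blast
qed

lemma cosets_one: "K \<subseteq> carrier G \<Longrightarrow> cosets K {\<one>} = (\<lambda>g. {g}) ` K"
  unfolding cosets_def by (rule image_cong[OF refl]) (auto simp: r_coset_def)

lemma sum_cosets_one:
  assumes "K \<subseteq> carrier G" shows "(\<Sum>C\<in>cosets K {\<one>}. F (rep C)) = (\<Sum>g\<in>K. F g)"
proof -
  have "inj_on (\<lambda>g. {g}) K" by (simp add: inj_on_def)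
  then show ?thesis unfolding cosets_one[OF assms] by (simp add: sum.reindex rep_def)
qed

end

lemma (in kG_module) act_zero: "g \<in> carrier G \<Longrightarrow> mact M g 0 = 0"
  using act_add[of g 0 0] subspace_0[OF carrier_subspace] by simp

lemma (in kG_module) act_sum_vectors:
  assumes g: "g \<in> carrier G" and f: "\<And>i. i \<in> S \<Longrightarrow> f i \<in> carrier M"
  shows "mact M g (sum f S) = (\<Sum>i\<in>S. mact M g (f i))"
  using f
proof (induction S rule: infinite_finite_induct)
  case (insert i S)
  have "mact M g (f i + sum f S) = mact M g (f i) + mact M g (sum f S)"
    using insert.prems by (intro act_add[OF g] subspace_sum[OF carrier_subspace]) blast+
  also have "mact M g (sum f S) = (\<Sum>i\<in>S. mact M g (f i))" using insert by blast
  finally show ?case by (simp only: sum.insert[OF insert.hyps])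
qed (simp_all only: sum.infinite sum.empty simp_thms not_False_eq_True act_zero[OF g])

lemma kG_hom_sum:
  assumes M: "kG_module G M" and h: "h \<in> kG_hom G M N" and f: "\<And>i. i \<in> S \<Longrightarrow> f i \<in> carrier M"
  shows "h (sum f S) = (\<Sum>i\<in>S. h (f i))"
proof -
  interpret kG_module G M by fact
  have z: "0 \<in> carrier M" using subspace_0[OF carrier_subspace] .
  have h0: "h 0 = 0" using kG_homD(2)[OF h z z] by simp
  show ?thesis using f
  proof (induction S rule: infinite_finite_induct)
    case (insert i S)
    have "h (f i + sum f S) = h (f i) + h (sum f S)"
      using insert.prems by (intro kG_homD(2)[OF h] subspace_sum[OF carrier_subspace]) blast+
    also have "h (sum f S) = (\<Sum>i\<in>S. h (f i))" using insert by blast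
    finally show ?case by (simp only: sum.insert[OF insert.hyps])
  qed (simp_all only: sum.infinite sum.empty simp_thms not_False_eq_True h0)
qed

text \<open>A retract is a summand: the complement of the image of \<open>\<alpha>\<close> is the kernel of \<open>\<beta>\<close>.\<close>

lemma isomorphic_to_summandI:
  assumes M: "kG_module G M" and N: "kG_module G N"
    and a: "\<alpha> \<in> kG_hom G M N" and b: "\<beta> \<in> kG_hom G N M"
    and ba: "\<And>v. v \<in> carrier M \<Longrightarrow> \<beta> (\<alpha> v) = v"
  shows "isomorphic_to_summand G M N"
proof -
  interpret M: kG_module G M by fact
  interpret N: kG_module G N by fact
  note a' = kG_homD[OF a] and b' = kG_homD[OF b]
  note cs = M.carrier_subspace and cs' = N.carrier_subspace
  have z: "0 \<in> carrier M" "0 \<in> carrier N" using M.subspace_0[OF cs] N.subspace_0[OF cs'] .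
  have a0: "\<alpha> 0 = 0" using a'(2)[OF z(1) z(1)] by simp
  have b0: "\<beta> 0 = 0" using b'(2)[OF z(2) z(2)] by simp
  let ?A = "\<alpha> ` carrier M" and ?B = "{n \<in> carrier N. \<beta> n = 0}"
  have A: "kG_submodule G N ?A" unfolding kG_submodule_def
  proof (intro conjI ballI)
    show "?A \<subseteq> carrier N" using a'(1) by blast
    show "N.subspace ?A"
    proof (rule N.subspaceI)
      show "0 \<in> ?A" using a0 z(1) by (metis image_eqI)
      show "x + y \<in> ?A" if "x \<in> ?A" "y \<in> ?A" for x y
        using that a'(2) M.subspace_add[OF cs] by (metis (no_types, lifting) image_iff)
      show "mscale N c x \<in> ?A" if "x \<in> ?A" for c x
        using that a'(3) M.subspace_scale[OF cs] by (metis (no_types, lifting) image_iff)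
    qed
    show "mact N g v \<in> ?A" if "g \<in> carrier G" "v \<in> ?A" for g v
      using that a'(4) M.act_closed by (metis (no_types, lifting) image_iff)
  qed
  have B: "kG_submodule G N ?B" unfolding kG_submodule_def
  proof (intro conjI ballI)
    show "?B \<subseteq> carrier N" by blast
    show "N.subspace ?B"
      by (rule N.subspaceI) (use z b0 b' N.subspace_add[OF cs'] N.subspace_scale[OF cs'] in auto)
    show "mact N g v \<in> ?B" if "g \<in> carrier G" "v \<in> ?B" for g v
      using that b'(4) N.act_closed M.act_zero by auto
  qed
  have int: "?A \<inter> ?B = {0}"
  proof
    show "?A \<inter> ?B \<subseteq> {0}" using ba a0 by auto
    show "{0} \<subseteq> ?A \<inter> ?B" using a0 b0 z by (metis (mono_tags, lifting) IntI empty_subsetI image_eqI insert_subset mem_Collect_eq)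
  qed
  have sum: "carrier N = {x + y | x y. x \<in> ?A \<and> y \<in> ?B}"
  proof
    show "carrier N \<subseteq> {x + y | x y. x \<in> ?A \<and> y \<in> ?B}"
    proof
      fix n assume n: "n \<in> carrier N"
      let ?a = "\<alpha> (\<beta> n)"
      have a: "?a \<in> carrier N" using a' b' n by blast
      have na: "n - ?a \<in> carrier N" using N.subspace_diff[OF cs' n a] .
      have "\<beta> ?a + \<beta> (n - ?a) = \<beta> (?a + (n - ?a))" using b'(2)[OF a na] by simp
      then have "\<beta> (n - ?a) = 0" using ba[OF b'(1)[OF n]] by simp
      then have "n - ?a \<in> ?B" using na by blast
      moreover have "n = ?a + (n - ?a)" by simp
      moreover have "?a \<in> ?A" using b'(1)[OF n] by blast
      ultimately show "n \<in> {x + y | x y. x \<in> ?A \<and> y \<in> ?B}" by blast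
    qed
    show "{x + y | x y. x \<in> ?A \<and> y \<in> ?B} \<subseteq> carrier N"
      using a'(1) N.subspace_add[OF cs'] by blast
  qed
  have "internal_direct_sum G N ?A ?B" unfolding internal_direct_sum_def using A B int sum by blast
  then have "direct_summand G N ?A" unfolding direct_summand_def by blast
  moreover have "\<alpha> \<in> kG_hom G M (N\<lparr>carrier := ?A\<rparr>)" using a by (auto simp: kG_hom_def)
  moreover have "bij_betw \<alpha> (carrier M) ?A" using ba by (auto simp: bij_betw_def intro: inj_on_inverseI)
  ultimately show ?thesis unfolding isomorphic_to_summand_def kG_isomorphic_def by auto
qed

lemma isomorphic_to_summandE:
  assumes M: "kG_module G M" and N: "kG_module G N" and s: "isomorphic_to_summand G M N"
  obtains \<alpha> \<beta> where "\<alpha> \<in> kG_hom G M N" "\<beta> \<in> kG_hom G N M" "\<And>v. v \<in> carrier M \<Longrightarrow> \<beta> (\<alpha> v) = v"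
proof -
  interpret M: kG_module G M by fact
  interpret N: kG_module G N by fact
  obtain A B f where AB: "internal_direct_sum G N A B"
    and f: "f \<in> kG_hom G M (N\<lparr>carrier := A\<rparr>)" and bij: "bij_betw f (carrier M) A"
    using s by (auto simp: isomorphic_to_summand_def direct_summand_def kG_isomorphic_def)
  note ids = AB[unfolded internal_direct_sum_def]
  have smA: "kG_submodule G N A" and smB: "kG_submodule G N B"
    by (rule conjunct1[OF ids], rule conjunct1[OF conjunct2[OF ids]])
  have int: "A \<inter> B = {0}" by (rule conjunct1[OF conjunct2[OF conjunct2[OF ids]]])
  have sum: "carrier N = {a + b | a b. a \<in> A \<and> b \<in> B}"
    by (rule conjunct2[OF conjunct2[OF conjunct2[OF ids]]])
  have A: "A \<subseteq> carrier N" "N.subspace A" "\<And>g v. g \<in> carrier G \<Longrightarrow> v \<in> A \<Longrightarrow> mact N g v \<in> A"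
    using smA by (auto simp: kG_submodule_def)
  have B: "B \<subseteq> carrier N" "N.subspace B" "\<And>g v. g \<in> carrier G \<Longrightarrow> v \<in> B \<Longrightarrow> mact N g v \<in> B"
    using smB by (auto simp: kG_submodule_def)
  have ex: "\<exists>a. a \<in> A \<and> n - a \<in> B" if n: "n \<in> carrier N" for n
  proof -
    obtain a b where "a \<in> A" "b \<in> B" "n = a + b" using sum n by blast
    then show ?thesis by (intro exI[of _ a]) simp
  qed
  define pr where "pr n = (SOME a. a \<in> A \<and> n - a \<in> B)" for n
  have pr: "pr n \<in> A" "n - pr n \<in> B" if "n \<in> carrier N" for n
    using someI_ex[OF ex[OF that]] unfolding pr_def by blast+
  have pr_eq: "pr n = a" if "n \<in> carrier N" "a \<in> A" "n - a \<in> B" for n a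
  proof -
    have "pr n - a \<in> A" using N.subspace_diff[OF A(2)] pr[OF that(1)] that by blast
    moreover have "(n - a) - (n - pr n) \<in> B" using N.subspace_diff[OF B(2)] pr[OF that(1)] that by blast
    then have "pr n - a \<in> B" by simp
    ultimately have "pr n - a = 0" using int by blast
    then show ?thesis by simp
  qed
  have pr_hom: "pr \<in> kG_hom G N (N\<lparr>carrier := A\<rparr>)" unfolding kG_hom_def
  proof (safe)
    fix v assume v: "v \<in> carrier N"
    show "pr v \<in> carrier (N\<lparr>carrier := A\<rparr>)" using pr[OF v] by simp
    fix w assume w: "w \<in> carrier N"
    show "pr (v + w) = pr v + pr w"
    proof (rule pr_eq)
      show "v + w \<in> carrier N" using N.subspace_add[OF N.carrier_subspace v w] .
      show "pr v + pr w \<in> A" using N.subspace_add[OF A(2)] pr v w by blast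
      have "(v - pr v) + (w - pr w) \<in> B" using N.subspace_add[OF B(2)] pr v w by blast
      then show "v + w - (pr v + pr w) \<in> B" by (simp add: algebra_simps)
    qed
  next
    fix v c assume v: "v \<in> carrier N"
    have "pr (mscale N c v) = mscale N c (pr v)"
    proof (rule pr_eq)
      show "mscale N c v \<in> carrier N" using N.subspace_scale[OF N.carrier_subspace v] .
      show "mscale N c (pr v) \<in> A" using N.subspace_scale[OF A(2)] pr v by blast
      have "mscale N c (v - pr v) \<in> B" using N.subspace_scale[OF B(2)] pr v by blast
      then show "mscale N c v - mscale N c (pr v) \<in> B" by (simp add: N.scale_right_diff_distrib)
    qed
    then show "pr (mscale N c v) = mscale (N\<lparr>carrier := A\<rparr>) c (pr v)" by simp
  next
    fix g v assume v: "v \<in> carrier N" and g: "g \<in> carrier G"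
    have "pr (mact N g v) = mact N g (pr v)"
    proof (rule pr_eq)
      show "mact N g v \<in> carrier N" using N.act_closed[OF g v] .
      show "mact N g (pr v) \<in> A" using A(3)[OF g] pr v by blast
      have "mact N g (v - pr v) \<in> B" using B(3)[OF g] pr v by blast
      moreover have "mact N g (pr v) + mact N g (v - pr v) = mact N g v"
        using N.act_add[OF g subsetD[OF A(1) pr(1)[OF v]] subsetD[OF B(1) pr(2)[OF v]]] by simp
      then have "mact N g (v - pr v) = mact N g v - mact N g (pr v)" by (simp add: algebra_simps)
      ultimately show "mact N g v - mact N g (pr v) \<in> B" by simp
    qed
    then show "pr (mact N g v) = mact (N\<lparr>carrier := A\<rparr>) g (pr v)" by simp
  qed
  have inv: "inv_into (carrier M) f \<in> kG_hom G (N\<lparr>carrier := A\<rparr>) M"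
    using kG_hom_inverse[OF M f] bij by simp
  show thesis
  proof (rule that)
    show "f \<in> kG_hom G M N" using f A(1) by (auto simp: kG_hom_def)
    show "inv_into (carrier M) f \<circ> pr \<in> kG_hom G N M"
      using kG_homD[OF pr_hom] kG_homD[OF inv] by (auto simp: kG_hom_def)
    show "(inv_into (carrier M) f \<circ> pr) (f v) = v" if v: "v \<in> carrier M" for v
    proof -
      have fv: "f v \<in> A" using bij v by (auto simp: bij_betw_def)
      have "pr (f v) = f v" using fv A(1) N.subspace_0[OF B(2)] by (intro pr_eq) auto
      then show ?thesis using bij v by (simp add: bij_betw_def)
    qed
  qed
qed

context permutation_module
begin

abbreviation Inv :: "'g set \<Rightarrow> ('a \<Rightarrow> 'a \<Rightarrow> 'k) set" where
  "Inv H \<equiv> invariant_matrices \<phi> H \<Omega>"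

text \<open>
  The relative trace, the sum of the conjugates \<open>g\<^sup>-\<^sup>1 a g\<close> over right cosets \<open>H g\<close>. Its values do
  not depend on the representatives if \<open>a\<close> is \<open>H\<close>-invariant.
\<close>

definition rel_trace :: "'g set \<Rightarrow> 'g set \<Rightarrow> ('a \<Rightarrow> 'a \<Rightarrow> 'k) \<Rightarrow> ('a \<Rightarrow> 'a \<Rightarrow> 'k)" where
  "rel_trace K H a = (\<lambda>x y.
     if x \<in> \<Omega> \<and> y \<in> \<Omega> then \<Sum>C\<in>Gr.cosets K H. a (\<phi> (Gr.rep C) x) (\<phi> (Gr.rep C) y) else 0)"

lemma InvD: "a \<in> Inv H \<Longrightarrow> h \<in> H \<Longrightarrow> x \<in> \<Omega> \<Longrightarrow> y \<in> \<Omega> \<Longrightarrow> a (\<phi> h x) (\<phi> h y) = a x y"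
  by (simp add: invariant_matrices_def)

lemma Inv_mono: "H \<subseteq> K \<Longrightarrow> a \<in> Inv K \<Longrightarrow> a \<in> Inv H"
  by (auto simp: invariant_matrices_def)

lemma Inv_coset:
  assumes a: "a \<in> Inv H" and H: "subgroup H G" and h: "h \<in> H" "g \<in> carrier G" and x: "x \<in> \<Omega>" "y \<in> \<Omega>"
  shows "a (\<phi> (h \<otimes> g) x) (\<phi> (h \<otimes> g) y) = a (\<phi> g x) (\<phi> g y)"
proof -
  have hG: "h \<in> carrier G" using subgroup.subset[OF H] h by blast
  then show ?thesis using InvD[OF a h(1)] act_mult[OF hG h(2)] act_closed[OF h(2)] x by simp
qed

lemma rel_trace_matrices: "rel_trace K H a \<in> matrices \<Omega>"
  by (simp add: rel_trace_def matrices_def)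

lemma rel_trace_invariant:
  assumes a: "a \<in> Inv H" and H: "subgroup H G" and K: "subgroup K G" "H \<subseteq> K"
  shows "rel_trace K H a \<in> Inv K"
proof -
  have KG: "K \<subseteq> carrier G" using subgroup.subset[OF K(1)] .
  have "rel_trace K H a (\<phi> k x) (\<phi> k y) = rel_trace K H a x y" if k: "k \<in> K" and x: "x \<in> \<Omega>" "y \<in> \<Omega>" for k x y
  proof -
    let ?F = "\<lambda>g. a (\<phi> g x) (\<phi> g y)"
    have kG: "k \<in> carrier G" using k KG by blast
    have "(\<Sum>C\<in>Gr.cosets K H. a (\<phi> (Gr.rep C) (\<phi> k x)) (\<phi> (Gr.rep C) (\<phi> k y))) =
        (\<Sum>C\<in>Gr.cosets K H. ?F (Gr.rep C \<otimes> k))"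
    proof (rule sum.cong[OF refl])
      fix C assume "C \<in> Gr.cosets K H"
      then have "Gr.rep C \<in> carrier G" using Gr.rep_in[OF H K] KG by blast
      then show "a (\<phi> (Gr.rep C) (\<phi> k x)) (\<phi> (Gr.rep C) (\<phi> k y)) = ?F (Gr.rep C \<otimes> k)"
        using act_mult kG x by simp
    qed
    also have "\<dots> = (\<Sum>C\<in>Gr.cosets K H. ?F (Gr.rep C))"
      by (rule Gr.sum_cosets_shift[OF H K k]) (rule Inv_coset[OF a H _ _ x])
    finally show ?thesis using x act_closed[OF kG] by (simp add: rel_trace_def)
  qed
  then show ?thesis using rel_trace_matrices by (simp add: invariant_matrices_def)
qed

lemma rel_trace_E:
  assumes "a \<in> Inv H" "subgroup H G" shows "rel_trace (carrier G) H a \<in> E"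
  using rel_trace_invariant[OF assms Gr.subgroup_self subgroup.subset[OF assms(2)]] .

lemma rel_trace_trans:
  assumes a: "a \<in> Inv H" and H: "subgroup H G" and K: "subgroup K G" "H \<subseteq> K"
    and L: "subgroup L G" "K \<subseteq> L"
  shows "rel_trace L H a = rel_trace L K (rel_trace K H a)"
proof (intro ext)
  fix x y
  have LG: "L \<subseteq> carrier G" and KG: "K \<subseteq> carrier G" using subgroup.subset L K by blast+
  show "rel_trace L H a x y = rel_trace L K (rel_trace K H a) x y"
  proof (cases "x \<in> \<Omega> \<and> y \<in> \<Omega>")
    case True
    then have x: "x \<in> \<Omega>" "y \<in> \<Omega>" by auto
    let ?F = "\<lambda>g. a (\<phi> g x) (\<phi> g y)"
    have "(\<Sum>C\<in>Gr.cosets L H. ?F (Gr.rep C)) =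
        (\<Sum>D\<in>Gr.cosets L K. \<Sum>C\<in>Gr.cosets K H. ?F (Gr.rep C \<otimes> Gr.rep D))"
      by (rule Gr.sum_cosets_trans[OF H K L]) (rule Inv_coset[OF a H _ _ x])
    also have "\<dots> = (\<Sum>D\<in>Gr.cosets L K. rel_trace K H a (\<phi> (Gr.rep D) x) (\<phi> (Gr.rep D) y))"
    proof (rule sum.cong[OF refl])
      fix D assume "D \<in> Gr.cosets L K"
      then have D: "Gr.rep D \<in> carrier G" using Gr.rep_in[OF K(1) L] LG by blast
      have "?F (Gr.rep C \<otimes> Gr.rep D) = a (\<phi> (Gr.rep C) (\<phi> (Gr.rep D) x)) (\<phi> (Gr.rep C) (\<phi> (Gr.rep D) y))"
        if "C \<in> Gr.cosets K H" for C
        using Gr.rep_in[OF H K that] KG act_mult[OF _ D] x by (metis subsetD)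
      then show "(\<Sum>C\<in>Gr.cosets K H. ?F (Gr.rep C \<otimes> Gr.rep D)) = rel_trace K H a (\<phi> (Gr.rep D) x) (\<phi> (Gr.rep D) y)"
        using act_closed[OF D] x by (simp add: rel_trace_def)
    qed
    finally show ?thesis using True by (simp add: rel_trace_def)
  next
    case False
    then show ?thesis by (auto simp: rel_trace_def)
  qed
qed

text \<open>Each of the conjugates that are summed equals \<open>a\<close>.\<close>

lemma rel_trace_index:
  assumes a: "a \<in> Inv K" and H: "subgroup H G" and K: "subgroup K G" "H \<subseteq> K"
  shows "rel_trace K H a = mat_scale (of_nat (card (Gr.cosets K H))) a"
proof (intro ext)
  fix x y
  have "a (\<phi> (Gr.rep C) x) (\<phi> (Gr.rep C) y) = a x y" if "C \<in> Gr.cosets K H" "x \<in> \<Omega>" "y \<in> \<Omega>" for C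
    using InvD[OF a Gr.rep_in(1)[OF H K that(1)] that(2,3)] .
  moreover have "a \<in> matrices \<Omega>" using a by (simp add: invariant_matrices_def)
  ultimately show "rel_trace K H a x y = mat_scale (of_nat (card (Gr.cosets K H))) a x y"
    by (auto simp: rel_trace_def mat_scale_def matrices_def)
qed

lemma rel_trace_scale: "rel_trace K H (mat_scale c a) = mat_scale c (rel_trace K H a)"
  by (auto simp: rel_trace_def mat_scale_def fun_eq_iff sum_distrib_left)

lemma rel_trace_sum: "rel_trace K H (\<Sum>i\<in>S. f i) = (\<Sum>i\<in>S. rel_trace K H (f i))"
proof (intro ext)
  fix x y
  show "rel_trace K H (\<Sum>i\<in>S. f i) x y = (\<Sum>i\<in>S. rel_trace K H (f i)) x y"
  proof (cases "x \<in> \<Omega> \<and> y \<in> \<Omega>")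
    case True
    then have "rel_trace K H (\<Sum>i\<in>S. f i) x y =
        (\<Sum>C\<in>Gr.cosets K H. \<Sum>i\<in>S. f i (\<phi> (Gr.rep C) x) (\<phi> (Gr.rep C) y))"
      by (simp add: rel_trace_def sum_fun_apply)
    also have "\<dots> = (\<Sum>i\<in>S. \<Sum>C\<in>Gr.cosets K H. f i (\<phi> (Gr.rep C) x) (\<phi> (Gr.rep C) y))"
      by (rule sum.swap)
    finally show ?thesis using True by (simp add: rel_trace_def sum_fun_apply)
  qed (auto simp: rel_trace_def sum_fun_apply)
qed

text \<open>
  Multiplication by a \<open>G\<close>-invariant matrix commutes with conjugation. So the relative traces from
  \<open>H\<close> form an ideal of the algebra of invariant matrices.
\<close>

lemma rel_trace_mult:
  assumes b: "b \<in> E" and H: "subgroup H G"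
  shows "mat_mult \<Omega> b (rel_trace (carrier G) H a) = rel_trace (carrier G) H (mat_mult \<Omega> b a)"
    and "mat_mult \<Omega> (rel_trace (carrier G) H a) b = rel_trace (carrier G) H (mat_mult \<Omega> a b)"
proof -
  have rG: "Gr.rep C \<in> carrier G" if "C \<in> Gr.cosets (carrier G) H" for C
    using Gr.rep_in[OF H Gr.subgroup_self subgroup.subset[OF H] that] by blast
  have bM: "b \<in> matrices \<Omega>" using E_matrices[OF b] .
  show "mat_mult \<Omega> b (rel_trace (carrier G) H a) = rel_trace (carrier G) H (mat_mult \<Omega> b a)"
  proof (intro ext)
    fix x y
    show "mat_mult \<Omega> b (rel_trace (carrier G) H a) x y = rel_trace (carrier G) H (mat_mult \<Omega> b a) x y"
    proof (cases "x \<in> \<Omega> \<and> y \<in> \<Omega>")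
      case True
      have "mat_mult \<Omega> b (rel_trace (carrier G) H a) x y =
          (\<Sum>w\<in>\<Omega>. \<Sum>C\<in>Gr.cosets (carrier G) H. b x w * a (\<phi> (Gr.rep C) w) (\<phi> (Gr.rep C) y))"
        unfolding mat_mult_def rel_trace_def using True by (simp add: sum_distrib_left)
      also have "\<dots> = (\<Sum>C\<in>Gr.cosets (carrier G) H. \<Sum>w\<in>\<Omega>. b x w * a (\<phi> (Gr.rep C) w) (\<phi> (Gr.rep C) y))"
        by (rule sum.swap)
      also have "\<dots> = (\<Sum>C\<in>Gr.cosets (carrier G) H. mat_mult \<Omega> b a (\<phi> (Gr.rep C) x) (\<phi> (Gr.rep C) y))"
      proof (rule sum.cong[OF refl])
        fix C assume C: "C \<in> Gr.cosets (carrier G) H"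
        have "(\<Sum>w\<in>\<Omega>. b x w * a (\<phi> (Gr.rep C) w) (\<phi> (Gr.rep C) y)) =
            (\<Sum>w\<in>\<Omega>. b (\<phi> (Gr.rep C) x) (\<phi> (Gr.rep C) w) * a (\<phi> (Gr.rep C) w) (\<phi> (Gr.rep C) y))"
          using InvD[OF b rG[OF C]] True by (intro sum.cong refl) simp
        also have "\<dots> = mat_mult \<Omega> b a (\<phi> (Gr.rep C) x) (\<phi> (Gr.rep C) y)"
          unfolding mat_mult_def
          by (rule act_sum[OF rG[OF C], of "\<lambda>w. b (\<phi> (Gr.rep C) x) w * a w (\<phi> (Gr.rep C) y)"])
        finally show "(\<Sum>w\<in>\<Omega>. b x w * a (\<phi> (Gr.rep C) w) (\<phi> (Gr.rep C) y)) =
            mat_mult \<Omega> b a (\<phi> (Gr.rep C) x) (\<phi> (Gr.rep C) y)" .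
      qed
      finally show ?thesis using True by (simp add: rel_trace_def)
    next
      case False
      then show ?thesis using bM by (auto simp: mat_mult_def rel_trace_def matrices_def)
    qed
  qed
  show "mat_mult \<Omega> (rel_trace (carrier G) H a) b = rel_trace (carrier G) H (mat_mult \<Omega> a b)"
  proof (intro ext)
    fix x y
    show "mat_mult \<Omega> (rel_trace (carrier G) H a) b x y = rel_trace (carrier G) H (mat_mult \<Omega> a b) x y"
    proof (cases "x \<in> \<Omega> \<and> y \<in> \<Omega>")
      case True
      have "mat_mult \<Omega> (rel_trace (carrier G) H a) b x y =
          (\<Sum>w\<in>\<Omega>. \<Sum>C\<in>Gr.cosets (carrier G) H. a (\<phi> (Gr.rep C) x) (\<phi> (Gr.rep C) w) * b w y)"
        unfolding mat_mult_def rel_trace_def using True by (simp add: sum_distrib_right)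
      also have "\<dots> = (\<Sum>C\<in>Gr.cosets (carrier G) H. \<Sum>w\<in>\<Omega>. a (\<phi> (Gr.rep C) x) (\<phi> (Gr.rep C) w) * b w y)"
        by (rule sum.swap)
      also have "\<dots> = (\<Sum>C\<in>Gr.cosets (carrier G) H. mat_mult \<Omega> a b (\<phi> (Gr.rep C) x) (\<phi> (Gr.rep C) y))"
      proof (rule sum.cong[OF refl])
        fix C assume C: "C \<in> Gr.cosets (carrier G) H"
        have "(\<Sum>w\<in>\<Omega>. a (\<phi> (Gr.rep C) x) (\<phi> (Gr.rep C) w) * b w y) =
            (\<Sum>w\<in>\<Omega>. a (\<phi> (Gr.rep C) x) (\<phi> (Gr.rep C) w) * b (\<phi> (Gr.rep C) w) (\<phi> (Gr.rep C) y))"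
          using InvD[OF b rG[OF C]] True by (intro sum.cong refl) simp
        also have "\<dots> = mat_mult \<Omega> a b (\<phi> (Gr.rep C) x) (\<phi> (Gr.rep C) y)"
          unfolding mat_mult_def
          by (rule act_sum[OF rG[OF C], of "\<lambda>w. a (\<phi> (Gr.rep C) x) w * b w (\<phi> (Gr.rep C) y)"])
        finally show "(\<Sum>w\<in>\<Omega>. a (\<phi> (Gr.rep C) x) (\<phi> (Gr.rep C) w) * b w y) =
            mat_mult \<Omega> a b (\<phi> (Gr.rep C) x) (\<phi> (Gr.rep C) y)" .
      qed
      finally show ?thesis using True by (simp add: rel_trace_def)
    next
      case False
      then show ?thesis using bM by (auto simp: mat_mult_def rel_trace_def matrices_def)
    qed
  qed
qed

lemma rel_trace_apply:
  assumes a: "a \<in> Inv H" and H: "subgroup H G" and v: "v \<in> carrier k\<Omega>"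
  shows "mat_apply \<Omega> (rel_trace (carrier G) H a) v =
    (\<Sum>C\<in>Gr.cosets (carrier G) H. mact k\<Omega> (inv (Gr.rep C)) (mat_apply \<Omega> a (mact k\<Omega> (Gr.rep C) v)))"
proof
  fix x
  have rG: "Gr.rep C \<in> carrier G" if "C \<in> Gr.cosets (carrier G) H" for C
    using Gr.rep_in[OF H Gr.subgroup_self subgroup.subset[OF H] that] by blast
  show "mat_apply \<Omega> (rel_trace (carrier G) H a) v x =
    (\<Sum>C\<in>Gr.cosets (carrier G) H. mact k\<Omega> (inv (Gr.rep C)) (mat_apply \<Omega> a (mact k\<Omega> (Gr.rep C) v))) x"
  proof (cases "x \<in> \<Omega>")
    case True
    have "mat_apply \<Omega> (rel_trace (carrier G) H a) v x =
        (\<Sum>y\<in>\<Omega>. \<Sum>C\<in>Gr.cosets (carrier G) H. a (\<phi> (Gr.rep C) x) (\<phi> (Gr.rep C) y) * v y)"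
      unfolding mat_apply_def rel_trace_def using True by (simp add: sum_distrib_right)
    also have "\<dots> = (\<Sum>C\<in>Gr.cosets (carrier G) H. \<Sum>y\<in>\<Omega>. a (\<phi> (Gr.rep C) x) (\<phi> (Gr.rep C) y) * v y)"
      by (rule sum.swap)
    also have "\<dots> = (\<Sum>C\<in>Gr.cosets (carrier G) H. mact k\<Omega> (inv (Gr.rep C)) (mat_apply \<Omega> a (mact k\<Omega> (Gr.rep C) v)) x)"
    proof (rule sum.cong[OF refl])
      fix C assume C: "C \<in> Gr.cosets (carrier G) H"
      let ?g = "Gr.rep C"
      have "(\<Sum>y\<in>\<Omega>. a (\<phi> ?g x) (\<phi> ?g y) * v y) = (\<Sum>y\<in>\<Omega>. a (\<phi> ?g x) (\<phi> ?g y) * mact k\<Omega> ?g v (\<phi> ?g y))"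
        using act_inv(1)[OF rG[OF C]] act_closed[OF rG[OF C]] by (intro sum.cong refl) (simp add: mact_k\<Omega>)
      also have "\<dots> = mat_apply \<Omega> a (mact k\<Omega> ?g v) (\<phi> ?g x)"
        unfolding mat_apply_def by (rule act_sum[OF rG[OF C], of "\<lambda>y. a (\<phi> ?g x) y * mact k\<Omega> ?g v y"])
      also have "\<dots> = mact k\<Omega> (inv ?g) (mat_apply \<Omega> a (mact k\<Omega> ?g v)) x"
        using True rG[OF C] mact_k\<Omega>[of "inv ?g"] by simp
      finally show "(\<Sum>y\<in>\<Omega>. a (\<phi> ?g x) (\<phi> ?g y) * v y) = mact k\<Omega> (inv ?g) (mat_apply \<Omega> a (mact k\<Omega> ?g v)) x" .
    qed
    finally show ?thesis by (simp add: sum_fun_apply)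
  next
    case False
    then show ?thesis by (simp add: sum_fun_apply mact_k\<Omega> mat_apply_def rel_trace_def)
  qed
qed

end


section \<open>Relative projectivity and relative traces\<close>

context permutation_module
begin

text \<open>
  One half of Higman's criterion: if the identity of \<open>N\<close> is the relative trace of an \<open>H\<close>-linear
  map \<open>\<theta>\<close>, then the identity of a retract of \<open>N\<close> is the relative trace of \<open>\<beta> \<theta> \<alpha>\<close>.
\<close>

lemma rel_trace_of_retract:
  fixes N :: "('w::ab_group_add, 'k, 'g) gmodule"
  assumes e: "alg.idempotent e" and H: "subgroup H G" and N: "kG_module G N"
    and a: "\<alpha> \<in> kG_hom G (summand e) N" and b: "\<beta> \<in> kG_hom G N (summand e)"
    and ba: "\<And>v. v \<in> img e \<Longrightarrow> \<beta> (\<alpha> v) = v"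
    and closed: "\<And>F. F \<in> carrier N \<Longrightarrow> \<theta> F \<in> carrier N"
    and add: "\<And>F F'. F \<in> carrier N \<Longrightarrow> F' \<in> carrier N \<Longrightarrow> \<theta> (F + F') = \<theta> F + \<theta> F'"
    and scale: "\<And>c F. F \<in> carrier N \<Longrightarrow> \<theta> (mscale N c F) = mscale N c (\<theta> F)"
    and act: "\<And>h F. h \<in> H \<Longrightarrow> F \<in> carrier N \<Longrightarrow> \<theta> (mact N h F) = mact N h (\<theta> F)"
    and trace: "\<And>F. F \<in> carrier N \<Longrightarrow>
      (\<Sum>C\<in>Gr.cosets (carrier G) H. mact N (inv (Gr.rep C)) (\<theta> (mact N (Gr.rep C) F))) = F"
  shows "\<exists>a\<in>Inv H. rel_trace (carrier G) H a = e"
proof -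
  interpret N: kG_module G N by fact
  have eE: "e \<in> E" using e by (simp add: alg.idempotent_def)
  have HG: "H \<subseteq> carrier G" using subgroup.subset[OF H] .
  note a' = kG_homD[OF a] and b' = kG_homD[OF b]
  have ev: "mat_apply \<Omega> e v \<in> carrier (summand e)" for v using mat_apply_in_img[OF e] by simp
  have eact: "mat_apply \<Omega> e (mact k\<Omega> g v) = mact k\<Omega> g (mat_apply \<Omega> e v)" if "g \<in> carrier G" for g v
    by (rule mat_apply_act[OF eE that subset_refl])
  define h where "h v = \<beta> (\<theta> (\<alpha> (mat_apply \<Omega> e v)))" for v
  define m where "m = matrix_of \<Omega> h"
  note N1 = a'(1)[OF ev] and N2 = closed[OF a'(1)[OF ev]]
  have app: "mat_apply \<Omega> m v = h v" if "v \<in> carrier k\<Omega>" for v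
    unfolding m_def
  proof (rule matrix_of_apply[OF _ _ _ that])
    show "h v \<in> carrier k\<Omega>" for v using b'(1)[OF N2, of v] img_subset by (auto simp: h_def)
    show "h (v + w) = h v + h w" for v w
      unfolding h_def mat_apply_add a'(2)[OF ev ev] add[OF N1 N1] by (rule b'(2)[OF N2 N2])
    show "h (mscale k\<Omega> c v) = mscale k\<Omega> c (h v)" for c v
    proof -
      have "mat_apply \<Omega> e (mscale k\<Omega> c v) = mscale (summand e) c (mat_apply \<Omega> e v)"
        by (simp add: mscale_k\<Omega> mat_apply_scale)
      then show ?thesis unfolding h_def by (simp only: a'(3)[OF ev] scale[OF N1] b'(3)[OF N2]) simp
    qed
  qed
  have m: "m \<in> Inv H" unfolding m_def
  proof (rule matrix_of_invariant[OF _ HG])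
    fix g v assume g: "g \<in> H"
    then have gG: "g \<in> carrier G" using HG by blast
    have "mat_apply \<Omega> e (mact k\<Omega> g v) = mact (summand e) g (mat_apply \<Omega> e v)" using eact[OF gG] by simp
    then show "h (mact k\<Omega> g v) = mact k\<Omega> g (h v)"
      unfolding h_def by (simp only: a'(4)[OF gG ev] act[OF g N1] b'(4)[OF gG N2]) simp
  qed
  have "rel_trace (carrier G) H m = e"
  proof (rule E_eqI[OF rel_trace_matrices E_matrices[OF eE]])
    fix v assume v: "v \<in> carrier k\<Omega>"
    let ?I = "Gr.cosets (carrier G) H"
    let ?F = "\<alpha> (mat_apply \<Omega> e v)"
    have rG: "Gr.rep C \<in> carrier G" if "C \<in> ?I" for C
      using Gr.rep_in[OF H Gr.subgroup_self HG that] by blast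
    have FN: "?F \<in> carrier N" by (rule N1)
    have step: "mact k\<Omega> (inv (Gr.rep C)) (mat_apply \<Omega> m (mact k\<Omega> (Gr.rep C) v)) =
        \<beta> (mact N (inv (Gr.rep C)) (\<theta> (mact N (Gr.rep C) ?F)))" if C: "C \<in> ?I" for C
    proof -
      let ?g = "Gr.rep C"
      have "mat_apply \<Omega> e (mact k\<Omega> ?g v) = mact (summand e) ?g (mat_apply \<Omega> e v)" using eact[OF rG[OF C]] by simp
      then have "h (mact k\<Omega> ?g v) = \<beta> (\<theta> (mact N ?g ?F))"
        unfolding h_def by (simp only: a'(4)[OF rG[OF C] ev])
      then have "mat_apply \<Omega> m (mact k\<Omega> ?g v) = \<beta> (\<theta> (mact N ?g ?F))"
        using app[OF Mod.act_closed[OF rG[OF C] v]] by simp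
      moreover have "\<theta> (mact N ?g ?F) \<in> carrier N" by (rule closed[OF N.act_closed[OF rG[OF C] FN]])
      ultimately show ?thesis using b'(4)[of "inv ?g"] rG[OF C] by simp
    qed
    have "mat_apply \<Omega> (rel_trace (carrier G) H m) v =
        (\<Sum>C\<in>?I. \<beta> (mact N (inv (Gr.rep C)) (\<theta> (mact N (Gr.rep C) ?F))))"
      unfolding rel_trace_apply[OF m H v] by (rule sum.cong[OF refl step])
    also have "\<dots> = \<beta> (\<Sum>C\<in>?I. mact N (inv (Gr.rep C)) (\<theta> (mact N (Gr.rep C) ?F)))"
    proof (rule kG_hom_sum[OF N b, symmetric])
      fix C assume C: "C \<in> ?I"
      show "mact N (inv (Gr.rep C)) (\<theta> (mact N (Gr.rep C) ?F)) \<in> carrier N"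
        by (intro N.act_closed closed FN rG[OF C] Gr.inv_closed)
    qed
    also have "\<dots> = \<beta> ?F" by (simp only: trace[OF FN])
    also have "\<dots> = mat_apply \<Omega> e v" by (rule ba[OF mat_apply_in_img[OF e]])
    finally show "mat_apply \<Omega> (rel_trace (carrier G) H m) v = mat_apply \<Omega> e v" .
  qed
  then show ?thesis using m by blast
qed

text \<open>
  In an induced module, \<open>\<theta>\<close> is the projection onto the summand \<open>1 \<otimes> V\<close>. Its conjugates are the
  projections onto the summands \<open>t \<otimes> V\<close>, and these add up to the identity.
\<close>

lemma rel_trace_of_relatively_projective:
  assumes e: "alg.idempotent e" and H: "subgroup H G" and rp: "relatively_projective G H (summand e)"
  shows "\<exists>a\<in>Inv H. rel_trace (carrier G) H a = e"
proof -
  have eE: "e \<in> E" using e by (simp add: alg.idempotent_def)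
  have HG: "H \<subseteq> carrier G" using subgroup.subset[OF H] .
  obtain V :: "('a \<Rightarrow> 'k, 'k, 'g) gmodule" where V: "kG_module (G\<lparr>carrier := H\<rparr>) V"
    and s: "isomorphic_to_summand G (summand e) (induced_module G H V)"
    using rp by (auto simp: relatively_projective_def)
  interpret V: kG_module "G\<lparr>carrier := H\<rparr>" V by fact
  let ?N = "induced_module G H V"
  have N: "kG_module G ?N" using induced_kG_module[OF Gr.group_axioms H V] .
  interpret N: kG_module G ?N by (rule N)
  obtain \<alpha> \<beta> where ab: "\<alpha> \<in> kG_hom G (summand e) ?N" "\<beta> \<in> kG_hom G ?N (summand e)"
    "\<And>v. v \<in> carrier (summand e) \<Longrightarrow> \<beta> (\<alpha> v) = v"
    using isomorphic_to_summandE[OF summand_module[OF eE] N s] by blast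
  define \<theta> where "\<theta> F = (\<lambda>x. if x \<in> H then F x else 0)" for F :: "'g \<Rightarrow> 'a \<Rightarrow> 'k"
  have V0: "0 \<in> carrier V" using V.subspace_0[OF V.carrier_subspace] .
  have Vact0: "mact V (inv h) 0 = 0" if "h \<in> H" for h
    using V.act_zero[of "inv h"] subgroup.m_inv_closed[OF H that] by simp
  have Hmult: "x \<otimes> h \<in> H \<longleftrightarrow> x \<in> H" if "x \<in> carrier G" "h \<in> H" for x h
    using subgroup.m_closed[OF H] subgroup.m_inv_closed[OF H] that HG
    by (metis Gr.inv_solve_right subsetD Gr.m_closed)
  have Hmult': "inv h \<otimes> x \<in> H \<longleftrightarrow> x \<in> H" if "x \<in> carrier G" "h \<in> H" for x h
    using subgroup.m_closed[OF H] subgroup.m_inv_closed[OF H] that HG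
    by (metis Gr.inv_solve_left subsetD Gr.m_closed)
  show ?thesis
  proof (rule rel_trace_of_retract[OF e H N ab(1,2), of \<theta>])
    show "\<beta> (\<alpha> v) = v" if "v \<in> img e" for v using ab(3) that by simp
    show "\<theta> F \<in> carrier ?N" if F: "F \<in> carrier ?N" for F
      using F V0 HG Hmult Vact0 by (auto simp: induced_module_def \<theta>_def)
    show "\<theta> (F + F') = \<theta> F + \<theta> F'" for F F' by (simp add: \<theta>_def fun_eq_iff)
    show "\<theta> (mscale ?N c F) = mscale ?N c (\<theta> F)" for c F
      by (simp add: \<theta>_def fun_eq_iff induced_module_def)
    show "\<theta> (mact ?N h F) = mact ?N h (\<theta> F)" if h: "h \<in> H" for h F
    proof
      fix x
      show "\<theta> (mact ?N h F) x = mact ?N h (\<theta> F) x"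
        using Hmult'[OF _ h, of x] HG by (auto simp: \<theta>_def induced_module_def)
    qed
    fix F assume F: "F \<in> carrier ?N"
    show "(\<Sum>C\<in>Gr.cosets (carrier G) H. mact ?N (inv (Gr.rep C)) (\<theta> (mact ?N (Gr.rep C) F))) = F"
    proof
      fix x
      let ?I = "Gr.cosets (carrier G) H"
      show "(\<Sum>C\<in>?I. mact ?N (inv (Gr.rep C)) (\<theta> (mact ?N (Gr.rep C) F))) x = F x"
      proof (cases "x \<in> carrier G")
        case True
        have rG: "Gr.rep C \<in> carrier G" if "C \<in> ?I" for C
          using Gr.rep_in[OF H Gr.subgroup_self HG that] by blast
        have gen: "mact ?N (inv g) (\<theta> (mact ?N g F)) x = (if g \<otimes> x \<in> H then F x else 0)"
          if g: "g \<in> carrier G" for g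
        proof -
          have "inv g \<otimes> (g \<otimes> x) = x" using g True by (simp flip: Gr.m_assoc)
          then show ?thesis using g True by (simp add: induced_module_def \<theta>_def)
        qed
        have "mact ?N (inv (Gr.rep C)) (\<theta> (mact ?N (Gr.rep C) F)) x =
            (if C = H #> inv x then F x else 0)" if C: "C \<in> ?I" for C
          by (simp only: gen[OF rG[OF C]] Gr.unique_coset[OF H True C])
        then have "(\<Sum>C\<in>?I. mact ?N (inv (Gr.rep C)) (\<theta> (mact ?N (Gr.rep C) F)) x) =
            (\<Sum>C\<in>?I. if C = H #> inv x then F x else 0)" by (rule sum.cong[OF refl])
        also have "\<dots> = F x"
        proof -
          have "H #> inv x \<in> ?I" using True by (simp add: Gr.cosets_def)
          then show ?thesis using Gr.finite_cosets[OF finite_group] by (simp only: sum.delta if_True)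
        qed
        finally show ?thesis unfolding sum_fun_apply .
      next
        case False
        then have "F x = 0" using F by (simp add: induced_module_def)
        then show ?thesis unfolding sum_fun_apply using False by (simp add: induced_module_def zero_fun_def)
      qed
    qed
  qed
qed

text \<open>
  The other half of Higman's criterion: if \<open>e\<close> is the trace of \<open>a\<close>, the summand embeds into the
  module induced from its own restriction to \<open>H\<close> by \<open>v \<mapsto> \<Sum> t \<otimes> e a t\<^sup>-\<^sup>1 v\<close>, and the multiplication
  map \<open>t \<otimes> v \<mapsto> t v\<close> takes this vector to \<open>e (\<Sum> t a t\<^sup>-\<^sup>1) v = e e v = v\<close>.
\<close>

lemma relatively_projective_of_rel_trace:
  assumes e: "alg.idempotent e" and H: "subgroup H G" and a: "a \<in> Inv H" "rel_trace (carrier G) H a = e"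
  shows "relatively_projective G H (summand e)"
proof -
  have eE: "e \<in> E" using e by (simp add: alg.idempotent_def)
  have HG: "H \<subseteq> carrier G" using subgroup.subset[OF H] .
  let ?V = "summand e"
  have VH: "kG_module (G\<lparr>carrier := H\<rparr>) ?V"
  proof -
    interpret V: kG_module G ?V by (rule summand_module[OF eE])
    interpret HH: group "G\<lparr>carrier := H\<rparr>" using subgroup.subgroup_is_group[OF H Gr.group_axioms] .
    show ?thesis
      by unfold_locales
        (use subsetD[OF HG] V.carrier_subspace V.act_closed V.act_add V.act_scale V.act_one V.act_mult in auto)
  qed
  let ?N = "induced_module G H ?V"
  have N: "kG_module G ?N" using induced_kG_module[OF Gr.group_axioms H VH] .
  interpret N: kG_module G ?N by (rule N)
  let ?I = "Gr.cosets (carrier G) H"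
  have rG: "Gr.rep C \<in> carrier G" if "C \<in> ?I" for C
    using Gr.rep_in[OF H Gr.subgroup_self HG that] by blast
  define b where "b v = mat_apply \<Omega> e (mat_apply \<Omega> a v)" for v
  have bV: "b v \<in> img e" for v using mat_apply_in_img[OF e] by (simp add: b_def)
  have bact: "b (mact k\<Omega> h v) = mact k\<Omega> h (b v)" if "h \<in> H" for h v
    using mat_apply_act[OF a(1) that HG, of v] mat_apply_act[OF eE _ subset_refl, of h] that HG
    by (auto simp: b_def)
  define \<alpha> where "\<alpha> v = (\<lambda>x. if x \<in> carrier G then b (mact k\<Omega> (inv x) v) else 0)" for v
  define \<beta> where "\<beta> F = (\<Sum>C\<in>?I. mact k\<Omega> (inv (Gr.rep C)) (F (inv (Gr.rep C))))" for F :: "'g \<Rightarrow> 'a \<Rightarrow> 'k"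
  have mact_mult: "mact k\<Omega> (g \<otimes> h) v = mact k\<Omega> g (mact k\<Omega> h v)"
    if "g \<in> carrier G" "h \<in> carrier G" "v \<in> carrier k\<Omega>" for g h v by (rule Mod.act_mult[OF that])
  have Fcar: "F x \<in> img e" if "F \<in> carrier ?N" "x \<in> carrier G" for F x
    using that by (simp add: induced_module_def)
  have Fh: "F (x \<otimes> h) = mact k\<Omega> (inv h) (F x)" if "F \<in> carrier ?N" "x \<in> carrier G" "h \<in> H" for F x h
    using that by (simp add: induced_module_def)
  have ic: "v \<in> carrier k\<Omega>" if "v \<in> img e" for v using that img_subset by blast
  have "\<alpha> \<in> kG_hom G ?V ?N" unfolding kG_hom_def
  proof (safe)
    fix v assume v: "v \<in> carrier ?V"
    then have vc: "v \<in> carrier k\<Omega>" using ic by simp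
    show "\<alpha> v \<in> carrier ?N"
    proof -
      have "b (mact k\<Omega> (inv (x \<otimes> h)) v) = mact k\<Omega> (inv h) (b (mact k\<Omega> (inv x) v))"
        if x: "x \<in> carrier G" and h: "h \<in> H" for x h
      proof -
        have hG: "h \<in> carrier G" using h HG by blast
        have "mact k\<Omega> (inv (x \<otimes> h)) v = mact k\<Omega> (inv h) (mact k\<Omega> (inv x) v)"
          using mact_mult[of "inv h" "inv x" v] x hG vc by (simp add: Gr.inv_mult_group)
        then show ?thesis using bact[OF subgroup.m_inv_closed[OF H h]] by simp
      qed
      then show ?thesis using bV HG by (auto simp: induced_module_def \<alpha>_def)
    qed
    show "\<alpha> (v + w) = \<alpha> v + \<alpha> w" if w: "w \<in> carrier ?V" for w
    proof
      fix x
      have "w \<in> carrier k\<Omega>" using w ic by simp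
      then show "\<alpha> (v + w) x = (\<alpha> v + \<alpha> w) x"
        using Mod.act_add[OF _ vc, of "inv x" w] by (simp add: \<alpha>_def b_def mat_apply_add)
    qed
    show "\<alpha> (mscale ?V c v) = mscale ?N c (\<alpha> v)" for c
    proof
      fix x
      have "b (mscale k\<Omega> c u) = mscale k\<Omega> c (b u)" for u by (simp add: b_def mscale_k\<Omega> mat_apply_scale)
      moreover have "mscale k\<Omega> c 0 = 0" by (rule Mod.scale_zero_right)
      ultimately show "\<alpha> (mscale ?V c v) x = mscale ?N c (\<alpha> v) x"
        using Mod.act_scale[OF _ vc, of "inv x" c] by (simp add: \<alpha>_def induced_module_def)
    qed
    show "\<alpha> (mact ?V g v) = mact ?N g (\<alpha> v)" if g: "g \<in> carrier G" for g
    proof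
      fix x
      show "\<alpha> (mact ?V g v) x = mact ?N g (\<alpha> v) x"
      proof (cases "x \<in> carrier G")
        case True
        have "mact k\<Omega> (inv x) (mact k\<Omega> g v) = mact k\<Omega> (inv (inv g \<otimes> x)) v"
          using mact_mult[of "inv x" g v] True g vc by (simp add: Gr.inv_mult_group)
        then show ?thesis using True g by (simp add: \<alpha>_def induced_module_def)
      qed (simp add: \<alpha>_def induced_module_def)
    qed
  qed
  moreover have "\<beta> \<in> kG_hom G ?N ?V" unfolding kG_hom_def
  proof (safe)
    fix F assume F: "F \<in> carrier ?N"
    have Fr: "F (inv (Gr.rep C)) \<in> img e" if "C \<in> ?I" for C using Fcar[OF F] rG[OF that] by simp
    have term_in: "mact k\<Omega> (inv (Gr.rep C)) (F (inv (Gr.rep C))) \<in> img e" if "C \<in> ?I" for C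
      using img_act[OF eE Fr[OF that]] rG[OF that] by simp
    have sub: "Mod.subspace (img e)" using submodule_img[OF eE] by (simp add: kG_submodule_def)
    show "\<beta> F \<in> carrier ?V" unfolding \<beta>_def using Mod.subspace_sum[OF sub term_in] by simp
    show "\<beta> (F + F') = \<beta> F + \<beta> F'" if F': "F' \<in> carrier ?N" for F'
    proof -
      have "mact k\<Omega> (inv (Gr.rep C)) ((F + F') (inv (Gr.rep C))) =
          mact k\<Omega> (inv (Gr.rep C)) (F (inv (Gr.rep C))) + mact k\<Omega> (inv (Gr.rep C)) (F' (inv (Gr.rep C)))"
        if C: "C \<in> ?I" for C
        using Mod.act_add[of "inv (Gr.rep C)" "F (inv (Gr.rep C))" "F' (inv (Gr.rep C))"]
          ic[OF Fr[OF C]] ic[OF Fcar[OF F', of "inv (Gr.rep C)"]] rG[OF C] by (simp add: plus_fun_def)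
      then have "\<beta> (F + F') = (\<Sum>C\<in>?I. mact k\<Omega> (inv (Gr.rep C)) (F (inv (Gr.rep C))) +
          mact k\<Omega> (inv (Gr.rep C)) (F' (inv (Gr.rep C))))"
        unfolding \<beta>_def by (rule sum.cong[OF refl])
      then show ?thesis unfolding \<beta>_def by (simp only: sum.distrib)
    qed
    show "\<beta> (mscale ?N c F) = mscale ?V c (\<beta> F)" for c
    proof -
      have "mact k\<Omega> (inv (Gr.rep C)) (mscale ?N c F (inv (Gr.rep C))) =
          mscale k\<Omega> c (mact k\<Omega> (inv (Gr.rep C)) (F (inv (Gr.rep C))))" if C: "C \<in> ?I" for C
        using Mod.act_scale[of "inv (Gr.rep C)" "F (inv (Gr.rep C))" c]
          ic[OF Fr[OF C]] rG[OF C] by (simp add: induced_module_def)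
      then have "\<beta> (mscale ?N c F) = (\<Sum>C\<in>?I. mscale k\<Omega> c (mact k\<Omega> (inv (Gr.rep C)) (F (inv (Gr.rep C)))))"
        unfolding \<beta>_def by (rule sum.cong[OF refl])
      also have "\<dots> = mscale k\<Omega> c (\<beta> F)" unfolding \<beta>_def by (rule Mod.scale_sum_right[symmetric])
      finally show ?thesis by simp
    qed
    show "\<beta> (mact ?N g F) = mact ?V g (\<beta> F)" if g: "g \<in> carrier G" for g
    proof -
      let ?P = "\<lambda>x. mact k\<Omega> (inv x) (F (inv x))"
      have "mact k\<Omega> (inv (Gr.rep C)) (mact ?N g F (inv (Gr.rep C))) = mact k\<Omega> g (?P (Gr.rep C \<otimes> g))"
        if C: "C \<in> ?I" for C
      proof -
        let ?c = "Gr.rep C"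
        have "mact ?N g F (inv ?c) = F (inv (?c \<otimes> g))"
          using rG[OF C] g by (simp add: induced_module_def Gr.inv_mult_group)
        moreover have "F (inv (?c \<otimes> g)) \<in> carrier k\<Omega>" using ic[OF Fcar[OF F]] rG[OF C] g by simp
        then have "mact k\<Omega> g (mact k\<Omega> (inv (?c \<otimes> g)) (F (inv (?c \<otimes> g)))) =
            mact k\<Omega> (g \<otimes> inv (?c \<otimes> g)) (F (inv (?c \<otimes> g)))"
          using mact_mult rG[OF C] g by simp
        moreover have "g \<otimes> inv (?c \<otimes> g) = inv ?c"
          using rG[OF C] g by (simp add: Gr.inv_mult_group flip: Gr.m_assoc)
        ultimately show ?thesis by simp
      qed
      then have "\<beta> (mact ?N g F) = (\<Sum>C\<in>?I. mact k\<Omega> g (?P (Gr.rep C \<otimes> g)))"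
        unfolding \<beta>_def by (rule sum.cong[OF refl])
      also have "\<dots> = mact k\<Omega> g (\<Sum>C\<in>?I. ?P (Gr.rep C \<otimes> g))"
      proof (rule Mod.act_sum_vectors[OF g, symmetric])
        fix C assume C: "C \<in> ?I"
        then show "?P (Gr.rep C \<otimes> g) \<in> carrier k\<Omega>"
          using Mod.act_closed ic[OF Fcar[OF F]] rG[OF C] g by simp
      qed
      also have "(\<Sum>C\<in>?I. ?P (Gr.rep C \<otimes> g)) = (\<Sum>C\<in>?I. ?P (Gr.rep C))"
      proof (rule Gr.sum_cosets_shift[OF H Gr.subgroup_self HG g])
        fix h x assume h: "h \<in> H" and x: "x \<in> carrier G"
        have hG: "h \<in> carrier G" using h HG by blast
        have "F (inv x \<otimes> inv h) = mact k\<Omega> h (F (inv x))"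
          using Fh[OF F _ subgroup.m_inv_closed[OF H h], of "inv x"] x hG by simp
        moreover have "F (inv x) \<in> carrier k\<Omega>" using ic[OF Fcar[OF F]] x by simp
        then have "mact k\<Omega> (inv x \<otimes> inv h) (mact k\<Omega> h (F (inv x))) =
            mact k\<Omega> (inv x \<otimes> inv h \<otimes> h) (F (inv x))"
          using mact_mult x hG by simp
        moreover have "inv x \<otimes> inv h \<otimes> h = inv x" using x hG by (simp add: Gr.m_assoc)
        ultimately show "?P (h \<otimes> x) = ?P x" using x hG by (simp add: Gr.inv_mult_group)
      qed
      finally show ?thesis by (simp add: \<beta>_def)
    qed
  qed
  moreover have "\<beta> (\<alpha> v) = v" if v: "v \<in> carrier ?V" for v
  proof -
    have vc: "v \<in> carrier k\<Omega>" and ev: "mat_apply \<Omega> e v = v" using v ic mat_apply_img by auto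
    have "mact k\<Omega> (inv (Gr.rep C)) (\<alpha> v (inv (Gr.rep C))) =
        mat_apply \<Omega> e (mact k\<Omega> (inv (Gr.rep C)) (mat_apply \<Omega> a (mact k\<Omega> (Gr.rep C) v)))" if C: "C \<in> ?I" for C
      using mat_apply_act[OF eE _ subset_refl, of "inv (Gr.rep C)"] rG[OF C] by (simp add: \<alpha>_def b_def)
    then have "\<beta> (\<alpha> v) = (\<Sum>C\<in>?I. mat_apply \<Omega> e (mact k\<Omega> (inv (Gr.rep C)) (mat_apply \<Omega> a (mact k\<Omega> (Gr.rep C) v))))"
      unfolding \<beta>_def by (rule sum.cong[OF refl])
    also have "\<dots> = mat_apply \<Omega> e (mat_apply \<Omega> (rel_trace (carrier G) H a) v)"
      unfolding rel_trace_apply[OF a(1) H vc] by (rule mat_apply_sum[symmetric])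
    finally show ?thesis using a(2) ev by simp
  qed
  ultimately have "isomorphic_to_summand G ?V ?N"
    by (rule isomorphic_to_summandI[OF summand_module[OF eE] N])
  then show ?thesis unfolding relatively_projective_def using VH by blast
qed

theorem relatively_projective_iff_rel_trace:
  assumes "alg.idempotent e" and "subgroup H G"
  shows "relatively_projective G H (summand e) \<longleftrightarrow> (\<exists>a\<in>Inv H. rel_trace (carrier G) H a = e)"
  using rel_trace_of_relatively_projective[OF assms] relatively_projective_of_rel_trace[OF assms] by blast

lemma triv_subgroup: "subgroup {\<one>} G"
  by (rule Gr.triv_subgroup)

text \<open>In the free module, \<open>\<theta>\<close> is the projection onto the span of the basis elements \<open>(i, \<one>)\<close>.\<close>

lemma rel_trace_of_projective:
  assumes e: "alg.idempotent e" and p: "projective G (summand e)"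
  shows "\<exists>a\<in>Inv {\<one>}. rel_trace (carrier G) {\<one>} a = e"
proof -
  have eE: "e \<in> E" using e by (simp add: alg.idempotent_def)
  obtain n where s: "isomorphic_to_summand G (summand e) (free_module G n :: (nat \<times> 'g \<Rightarrow> 'k, 'k, 'g) gmodule)"
    using p by (auto simp: projective_def)
  let ?N = "free_module G n :: (nat \<times> 'g \<Rightarrow> 'k, 'k, 'g) gmodule"
  have N: "kG_module G ?N" by (rule kG_module_free_module[OF Gr.group_axioms])
  interpret N: kG_module G ?N by (rule N)
  obtain \<alpha> \<beta> where ab: "\<alpha> \<in> kG_hom G (summand e) ?N" "\<beta> \<in> kG_hom G ?N (summand e)"
    "\<And>v. v \<in> carrier (summand e) \<Longrightarrow> \<beta> (\<alpha> v) = v"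
    using isomorphic_to_summandE[OF summand_module[OF eE] N s] by blast
  have car: "F \<in> carrier ?N \<longleftrightarrow> (\<forall>i x. \<not> (i < n \<and> x \<in> carrier G) \<longrightarrow> F (i, x) = 0)" for F
    by (auto simp: free_module_def perm_module_def)
  have sc: "mscale ?N c F = (\<lambda>z. c * F z)" for c F
    by (simp add: free_module_def perm_module_def)
  have ac: "mact ?N g F (i, x) = (if i < n \<and> x \<in> carrier G then F (i, inv g \<otimes> x) else 0)" for g F i x
    by (simp add: free_module_def perm_module_def)
  define \<theta> where "\<theta> F = (\<lambda>(i, x). if x = \<one> then F (i, x) else 0)" for F :: "nat \<times> 'g \<Rightarrow> 'k"
  show ?thesis
  proof (rule rel_trace_of_retract[OF e triv_subgroup N ab(1,2), of \<theta>])
    show "\<beta> (\<alpha> v) = v" if "v \<in> img e" for v using ab(3) that by simp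
    show "\<theta> F \<in> carrier ?N" if F: "F \<in> carrier ?N" for F
      using F by (auto simp: car \<theta>_def)
    show "\<theta> (F + F') = \<theta> F + \<theta> F'" for F F' by (simp add: \<theta>_def fun_eq_iff)
    show "\<theta> (mscale ?N c F) = mscale ?N c (\<theta> F)" for c F
      by (simp add: \<theta>_def fun_eq_iff sc)
    show "\<theta> (mact ?N h F) = mact ?N h (\<theta> F)" if h: "h \<in> {\<one>}" for h F
    proof
      fix z :: "nat \<times> 'g"
      obtain i x where z: "z = (i, x)" by (cases z)
      show "\<theta> (mact ?N h F) z = mact ?N h (\<theta> F) z"
        using h by (simp add: z \<theta>_def ac)
    qed
    fix F assume F: "F \<in> carrier ?N"
    show "(\<Sum>C\<in>Gr.cosets (carrier G) {\<one>}. mact ?N (inv (Gr.rep C)) (\<theta> (mact ?N (Gr.rep C) F))) = F"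
    proof
      fix z :: "nat \<times> 'g"
      obtain i x where z: "z = (i, x)" by (cases z)
      have "(\<Sum>C\<in>Gr.cosets (carrier G) {\<one>}. mact ?N (inv (Gr.rep C)) (\<theta> (mact ?N (Gr.rep C) F))) z =
          (\<Sum>g\<in>carrier G. mact ?N (inv g) (\<theta> (mact ?N g F)) z)"
        unfolding sum_fun_apply by (rule Gr.sum_cosets_one[OF subset_refl])
      also have "\<dots> = F z"
      proof (cases "i < n \<and> x \<in> carrier G")
        case True
        have "mact ?N (inv g) (\<theta> (mact ?N g F)) z = (if g = inv x then F z else 0)" if g: "g \<in> carrier G" for g
        proof -
          have "g \<otimes> x = \<one> \<longleftrightarrow> g = inv x" using g True Gr.inv_equality[of g x] by auto
          moreover have "inv g \<otimes> (g \<otimes> x) = x" using g True by (simp flip: Gr.m_assoc)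
          ultimately show ?thesis using g True by (auto simp: z ac \<theta>_def)
        qed
        then have "(\<Sum>g\<in>carrier G. mact ?N (inv g) (\<theta> (mact ?N g F)) z) =
            (\<Sum>g\<in>carrier G. if g = inv x then F z else 0)" by (rule sum.cong[OF refl])
        then show ?thesis using finite_group True by simp
      next
        case False
        then have "F z = 0" using F by (auto simp: car z)
        moreover have "mact ?N g F' z = 0" for g F' using False by (auto simp: z ac)
        ultimately show ?thesis by simp
      qed
      finally show "(\<Sum>C\<in>Gr.cosets (carrier G) {\<one>}. mact ?N (inv (Gr.rep C)) (\<theta> (mact ?N (Gr.rep C) F))) z = F z" .
    qed
  qed
qed

text \<open>
  The embedding \<open>v \<mapsto> \<Sum> t \<otimes> a t\<^sup>-\<^sup>1 v\<close> of the relatively projective case, with the coefficient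
  space \<open>k\<Omega>\<close> replaced by coordinates: \<open>\<Omega>\<close> is numbered by \<open>pt\<close>, and \<open>slice F g\<close> is the vector of
  coefficients of \<open>F\<close> at the group element \<open>g\<close>.
\<close>

lemma projective_of_rel_trace:
  assumes e: "alg.idempotent e" and a: "a \<in> Inv {\<one>}" "rel_trace (carrier G) {\<one>} a = e"
  shows "projective G (summand e)"
proof -
  have eE: "e \<in> E" using e by (simp add: alg.idempotent_def)
  have ic: "v \<in> carrier k\<Omega>" if "v \<in> img e" for v using that img_subset by blast
  define n where "n = card \<Omega>"
  obtain pt where pt: "bij_betw pt {..<n} \<Omega>"
    using ex_bij_betw_nat_finite[OF finite_set] by (auto simp: atLeast0LessThan n_def)
  define idx where "idx = inv_into {..<n} pt"
  have idx: "idx \<omega> < n" "pt (idx \<omega>) = \<omega>" if "\<omega> \<in> \<Omega>" for \<omega>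
    using pt that inv_into_into[of \<omega> pt "{..<n}"] f_inv_into_f[of \<omega> pt "{..<n}"]
    by (auto simp: bij_betw_def idx_def)
  let ?V = "summand e"
  let ?N = "free_module G n :: (nat \<times> 'g \<Rightarrow> 'k, 'k, 'g) gmodule"
  have N: "kG_module G ?N" by (rule kG_module_free_module[OF Gr.group_axioms])
  have car: "F \<in> carrier ?N \<longleftrightarrow> (\<forall>i x. \<not> (i < n \<and> x \<in> carrier G) \<longrightarrow> F (i, x) = 0)" for F
    by (auto simp: free_module_def perm_module_def)
  have sc: "mscale ?N c F = (\<lambda>z. c * F z)" for c F
    by (simp add: free_module_def perm_module_def)
  have ac: "mact ?N g F (i, x) = (if i < n \<and> x \<in> carrier G then F (i, inv g \<otimes> x) else 0)" for g F i x
    by (simp add: free_module_def perm_module_def)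
  define \<alpha> where "\<alpha> v = (\<lambda>(i, x).
      if i < n \<and> x \<in> carrier G then mat_apply \<Omega> a (mact k\<Omega> (inv x) v) (pt i) else 0)" for v
  define slice where "slice F g = (\<lambda>\<omega>. if \<omega> \<in> \<Omega> then F (idx \<omega>, g) else 0)" for F :: "nat \<times> 'g \<Rightarrow> 'k" and g
  have slice: "slice F g \<in> carrier k\<Omega>" for F g by (simp add: slice_def carrier_k\<Omega>)
  define \<beta>' where "\<beta>' F = (\<Sum>g\<in>carrier G. mact k\<Omega> g (slice F g))" for F
  define \<beta> where "\<beta> F = mat_apply \<Omega> e (\<beta>' F)" for F
  have "\<alpha> \<in> kG_hom G ?V ?N" unfolding kG_hom_def
  proof (safe)
    fix v assume v: "v \<in> carrier ?V"
    then have vc: "v \<in> carrier k\<Omega>" using ic by simp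
    show "\<alpha> v \<in> carrier ?N" by (auto simp: car \<alpha>_def)
    show "\<alpha> (v + w) = \<alpha> v + \<alpha> w" if w: "w \<in> carrier ?V" for w
    proof
      fix z :: "nat \<times> 'g"
      obtain i x where z: "z = (i, x)" by (cases z)
      have "w \<in> carrier k\<Omega>" using w ic by simp
      then show "\<alpha> (v + w) z = (\<alpha> v + \<alpha> w) z"
        using Mod.act_add[OF _ vc, of "inv x" w] by (auto simp: z \<alpha>_def mat_apply_add)
    qed
    show "\<alpha> (mscale ?V c v) = mscale ?N c (\<alpha> v)" for c
    proof
      fix z :: "nat \<times> 'g"
      obtain i x where z: "z = (i, x)" by (cases z)
      show "\<alpha> (mscale ?V c v) z = mscale ?N c (\<alpha> v) z"
        using Mod.act_scale[OF _ vc, of "inv x" c]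
        by (auto simp: z \<alpha>_def sc mscale_k\<Omega> mat_apply_scale)
    qed
    show "\<alpha> (mact ?V g v) = mact ?N g (\<alpha> v)" if g: "g \<in> carrier G" for g
    proof
      fix z :: "nat \<times> 'g"
      obtain i x where z: "z = (i, x)" by (cases z)
      show "\<alpha> (mact ?V g v) z = mact ?N g (\<alpha> v) z"
      proof (cases "i < n \<and> x \<in> carrier G")
        case True
        have "mact k\<Omega> (inv x) (mact k\<Omega> g v) = mact k\<Omega> (inv (inv g \<otimes> x)) v"
          using Mod.act_mult[of "inv x" g v] True g vc by (simp add: Gr.inv_mult_group)
        then show ?thesis using True g by (simp add: z \<alpha>_def ac)
      qed (auto simp: z \<alpha>_def ac)
    qed
  qed
  moreover have "\<beta> \<in> kG_hom G ?N ?V" unfolding kG_hom_def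
  proof (safe)
    fix F
    show "\<beta> F \<in> carrier ?V" using mat_apply_in_img[OF e] by (simp add: \<beta>_def)
    show "\<beta> (F + F') = \<beta> F + \<beta> F'" for F'
    proof -
      have "mact k\<Omega> g (slice (F + F') g) = mact k\<Omega> g (slice F g) + mact k\<Omega> g (slice F' g)"
        if g: "g \<in> carrier G" for g
      proof -
        have "slice (F + F') g = slice F g + slice F' g" by (simp add: slice_def fun_eq_iff)
        then show ?thesis using Mod.act_add[OF g slice slice] by simp
      qed
      then have "\<beta>' (F + F') = (\<Sum>g\<in>carrier G. mact k\<Omega> g (slice F g) + mact k\<Omega> g (slice F' g))"
        unfolding \<beta>'_def by (rule sum.cong[OF refl])
      then have "\<beta>' (F + F') = \<beta>' F + \<beta>' F'" unfolding \<beta>'_def by (simp only: sum.distrib)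
      then show ?thesis by (simp only: \<beta>_def mat_apply_add)
    qed
    show "\<beta> (mscale ?N c F) = mscale ?V c (\<beta> F)" for c
    proof -
      have "mact k\<Omega> g (slice (mscale ?N c F) g) = mscale k\<Omega> c (mact k\<Omega> g (slice F g))" if g: "g \<in> carrier G" for g
      proof -
        have "slice (mscale ?N c F) g = mscale k\<Omega> c (slice F g)"
          by (simp add: slice_def fun_eq_iff sc mscale_k\<Omega>)
        then show ?thesis using Mod.act_scale[OF g slice] by simp
      qed
      then have "\<beta>' (mscale ?N c F) = (\<Sum>g\<in>carrier G. mscale k\<Omega> c (mact k\<Omega> g (slice F g)))"
        unfolding \<beta>'_def by (rule sum.cong[OF refl])
      also have "\<dots> = mscale k\<Omega> c (\<beta>' F)" unfolding \<beta>'_def by (rule Mod.scale_sum_right[symmetric])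
      finally show ?thesis by (simp add: \<beta>_def mscale_k\<Omega> mat_apply_scale)
    qed
    show "\<beta> (mact ?N g F) = mact ?V g (\<beta> F)" if g: "g \<in> carrier G" for g
    proof -
      have "slice (mact ?N g F) x = slice F (inv g \<otimes> x)" if "x \<in> carrier G" for x
        using that idx(1) by (simp add: slice_def fun_eq_iff ac)
      then have "\<beta>' (mact ?N g F) = (\<Sum>x\<in>carrier G. mact k\<Omega> x (slice F (inv g \<otimes> x)))"
        unfolding \<beta>'_def by (intro sum.cong refl) simp
      also have "\<dots> = (\<Sum>y\<in>carrier G. mact k\<Omega> g (mact k\<Omega> y (slice F y)))"
      proof (rule sum.reindex_bij_witness[of _ "\<lambda>y. g \<otimes> y" "\<lambda>x. inv g \<otimes> x"])
        fix x assume x: "x \<in> carrier G"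
        show "g \<otimes> (inv g \<otimes> x) = x" "inv g \<otimes> (g \<otimes> x) = x"
          using x g by (simp_all flip: Gr.m_assoc)
        show "inv g \<otimes> x \<in> carrier G" "g \<otimes> x \<in> carrier G" using x g by simp_all
        have "g \<otimes> (inv g \<otimes> x) = x" using x g by (simp flip: Gr.m_assoc)
        then show "mact k\<Omega> g (mact k\<Omega> (inv g \<otimes> x) (slice F (inv g \<otimes> x))) =
            mact k\<Omega> x (slice F (inv g \<otimes> x))"
          using Mod.act_mult[OF g _ slice, of "inv g \<otimes> x" F "inv g \<otimes> x"] g x by simp
      qed
      also have "\<dots> = mact k\<Omega> g (\<beta>' F)"
        unfolding \<beta>'_def by (rule Mod.act_sum_vectors[OF g, symmetric]) (rule Mod.act_closed[OF _ slice])
      finally have "\<beta>' (mact ?N g F) = mact k\<Omega> g (\<beta>' F)" .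
      then show ?thesis using mat_apply_act[OF eE g subset_refl] by (simp add: \<beta>_def)
    qed
  qed
  moreover have "\<beta> (\<alpha> v) = v" if v: "v \<in> carrier ?V" for v
  proof -
    have vc: "v \<in> carrier k\<Omega>" and ev: "mat_apply \<Omega> e v = v" using v ic mat_apply_img by auto
    have aM: "a \<in> matrices \<Omega>" using a(1) by (simp add: invariant_matrices_def)
    have sl: "slice (\<alpha> v) g = mat_apply \<Omega> a (mact k\<Omega> (inv g) v)" if "g \<in> carrier G" for g
      using that idx mat_apply_closed[OF aM] by (auto simp: slice_def \<alpha>_def fun_eq_iff carrier_k\<Omega>)
    have "\<beta>' (\<alpha> v) = (\<Sum>g\<in>carrier G. mact k\<Omega> g (mat_apply \<Omega> a (mact k\<Omega> (inv g) v)))"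
      unfolding \<beta>'_def by (intro sum.cong refl) (simp only: sl)
    also have "\<dots> = (\<Sum>g\<in>carrier G. mact k\<Omega> (inv g) (mat_apply \<Omega> a (mact k\<Omega> g v)))"
      by (rule sum.reindex_bij_witness[of _ "m_inv G" "m_inv G"]) auto
    also have "\<dots> = mat_apply \<Omega> (rel_trace (carrier G) {\<one>} a) v"
      unfolding rel_trace_apply[OF a(1) triv_subgroup vc] by (rule Gr.sum_cosets_one[OF subset_refl, symmetric])
    finally show ?thesis using a(2) ev by (simp add: \<beta>_def)
  qed
  ultimately have "isomorphic_to_summand G ?V ?N"
    by (rule isomorphic_to_summandI[OF summand_module[OF eE] N])
  then show ?thesis unfolding projective_def by blast
qed

theorem projective_iff_rel_trace:
  assumes "alg.idempotent e"
  shows "projective G (summand e) \<longleftrightarrow> (\<exists>a\<in>Inv {\<one>}. rel_trace (carrier G) {\<one>} a = e)"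
  using rel_trace_of_projective[OF assms] projective_of_rel_trace[OF assms] by blast

end


section \<open>Counting modulo p\<close>

lemma group_action_restrict:
  fixes Q :: "('q, 'n) monoid_scheme"
  assumes Q: "group Q"
    and closed: "\<And>q z. q \<in> carrier Q \<Longrightarrow> z \<in> Z \<Longrightarrow> act q z \<in> Z"
    and one: "\<And>z. z \<in> Z \<Longrightarrow> act \<one>\<^bsub>Q\<^esub> z = z"
    and mult: "\<And>q r z. q \<in> carrier Q \<Longrightarrow> r \<in> carrier Q \<Longrightarrow> z \<in> Z \<Longrightarrow> act (q \<otimes>\<^bsub>Q\<^esub> r) z = act q (act r z)"
  shows "group_action Q Z (\<lambda>q. \<lambda>z\<in>Z. act q z)"
proof -
  interpret group Q by fact
  have bij: "(\<lambda>z\<in>Z. act q z) \<in> Bij Z" if q: "q \<in> carrier Q" for q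
  proof -
    have "bij_betw (act q) Z Z"
    proof (rule bij_betw_byWitness[where f' = "act (inv\<^bsub>Q\<^esub> q)"])
      show "\<forall>z\<in>Z. act (inv\<^bsub>Q\<^esub> q) (act q z) = z" "\<forall>z\<in>Z. act q (act (inv\<^bsub>Q\<^esub> q) z) = z"
        using q one by (simp_all flip: mult)
    qed (use closed q in auto)
    then show ?thesis by (simp add: Bij_def bij_betw_def inj_on_restrict_eq)
  qed
  have "(\<lambda>q. \<lambda>z\<in>Z. act q z) \<in> hom Q (BijGroup Z)"
  proof (rule homI)
    show "(\<lambda>z\<in>Z. act q z) \<in> carrier (BijGroup Z)" if "q \<in> carrier Q" for q
      using bij[OF that] by (simp add: BijGroup_def)
    show "(\<lambda>z\<in>Z. act (q \<otimes>\<^bsub>Q\<^esub> r) z) = (\<lambda>z\<in>Z. act q z) \<otimes>\<^bsub>BijGroup Z\<^esub> (\<lambda>z\<in>Z. act r z)"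
      if "q \<in> carrier Q" "r \<in> carrier Q" for q r
      using bij that mult closed by (auto simp: BijGroup_def compose_def fun_eq_iff)
  qed
  then show ?thesis
    using Q group_BijGroup by (simp add: group_action_def group_hom_def group_hom_axioms_def)
qed

text \<open>
  The orbits of a \<open>p\<close>-group have a power of \<open>p\<close> as their size; on an orbit with more than one
  element a constant function sums to zero in characteristic \<open>p\<close>.
\<close>

lemma sum_fixed_points_mod_p:
  fixes F :: "'z \<Rightarrow> 'k::field" and Q :: "('q, 'n) monoid_scheme"
  assumes Q: "group Q" and fin: "finite Z"
    and card: "card (carrier Q) = p ^ n" and p: "prime p" and char: "CHAR('k) = p"
    and closed: "\<And>q z. q \<in> carrier Q \<Longrightarrow> z \<in> Z \<Longrightarrow> act q z \<in> Z"
    and one: "\<And>z. z \<in> Z \<Longrightarrow> act \<one>\<^bsub>Q\<^esub> z = z"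
    and mult: "\<And>q r z. q \<in> carrier Q \<Longrightarrow> r \<in> carrier Q \<Longrightarrow> z \<in> Z \<Longrightarrow> act (q \<otimes>\<^bsub>Q\<^esub> r) z = act q (act r z)"
    and F: "\<And>q z. q \<in> carrier Q \<Longrightarrow> z \<in> Z \<Longrightarrow> F (act q z) = F z"
  shows "(\<Sum>z\<in>Z. F z) = (\<Sum>z | z \<in> Z \<and> (\<forall>q\<in>carrier Q. act q z = z). F z)"
proof -
  define \<psi> where "\<psi> = (\<lambda>q. \<lambda>z\<in>Z. act q z)"
  have ga: "group_action Q Z \<psi>" unfolding \<psi>_def by (rule group_action_restrict[OF Q closed one mult])
  interpret A: group_action Q Z \<psi> by (rule ga)
  have orb: "orbit Q \<psi> z = {act q z | q. q \<in> carrier Q}" if "z \<in> Z" for z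
    using that by (auto simp: orbit_def \<psi>_def)
  have orbZ: "orbit Q \<psi> z \<subseteq> Z" if "z \<in> Z" for z using orb[OF that] closed that by auto
  let ?fix = "{z \<in> Z. \<forall>q\<in>carrier Q. act q z = z}" and ?nf = "{z \<in> Z. \<exists>q\<in>carrier Q. act q z \<noteq> z}"
  have orb_eq: "orbit Q \<psi> w = orbit Q \<psi> z" if z: "z \<in> Z" and w: "w \<in> orbit Q \<psi> z" for z w
  proof -
    have wZ: "w \<in> Z" using orbZ[OF z] w by blast
    have zw: "z \<in> orbit Q \<psi> w" by (rule A.orbit_sym[OF z wZ w])
    show ?thesis
    proof
      show "orbit Q \<psi> w \<subseteq> orbit Q \<psi> z"
      proof
        fix u assume u: "u \<in> orbit Q \<psi> w"
        then have "u \<in> Z" using orbZ[OF wZ] by blast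
        then show "u \<in> orbit Q \<psi> z" using A.orbit_trans[OF z wZ _ w u] by blast
      qed
      show "orbit Q \<psi> z \<subseteq> orbit Q \<psi> w"
      proof
        fix u assume u: "u \<in> orbit Q \<psi> z"
        then have "u \<in> Z" using orbZ[OF z] by blast
        then show "u \<in> orbit Q \<psi> w" using A.orbit_trans[OF wZ z _ zw u] by blast
      qed
    qed
  qed
  have fixed_orb: "orbit Q \<psi> z = {z}" if "z \<in> ?fix" for z
    using that orb[of z] group.is_monoid[OF Q] monoid.one_closed by force
  have inner: "(\<Sum>x | x \<in> ?nf \<and> orbit Q \<psi> x = orbit Q \<psi> z. F x) = 0" if z: "z \<in> ?nf" for z
  proof -
    have zZ: "z \<in> Z" using z by simp
    have "{x. x \<in> ?nf \<and> orbit Q \<psi> x = orbit Q \<psi> z} = orbit Q \<psi> z"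
    proof
      show "{x. x \<in> ?nf \<and> orbit Q \<psi> x = orbit Q \<psi> z} \<subseteq> orbit Q \<psi> z"
        using A.orbit_refl by blast
      show "orbit Q \<psi> z \<subseteq> {x. x \<in> ?nf \<and> orbit Q \<psi> x = orbit Q \<psi> z}"
      proof
        fix w assume w: "w \<in> orbit Q \<psi> z"
        have wZ: "w \<in> Z" using orbZ[OF zZ] w by blast
        have "w \<notin> ?fix"
        proof
          assume "w \<in> ?fix"
          then have "orbit Q \<psi> z = {w}" using fixed_orb orb_eq[OF zZ w] by simp
          then have "z = w" using A.orbit_refl[OF zZ] by simp
          then show False using z \<open>w \<in> ?fix\<close> by blast
        qed
        then show "w \<in> {x. x \<in> ?nf \<and> orbit Q \<psi> x = orbit Q \<psi> z}" using wZ orb_eq[OF zZ w] by blast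
      qed
    qed
    moreover have "F x = F z" if "x \<in> orbit Q \<psi> z" for x using that orb[OF zZ] F zZ by auto
    ultimately have "(\<Sum>x | x \<in> ?nf \<and> orbit Q \<psi> x = orbit Q \<psi> z. F x) = (\<Sum>x\<in>orbit Q \<psi> z. F z)"
      by (intro sum.cong) auto
    also have "\<dots> = of_nat (card (orbit Q \<psi> z)) * F z" by simp
    also have "p dvd card (orbit Q \<psi> z)"
    proof -
      have "card (orbit Q \<psi> z) * card (stabilizer Q \<psi> z) = p ^ n"
        using A.orbit_stabilizer_theorem[OF zZ] card by (simp add: order_def)
      then have "card (orbit Q \<psi> z) dvd p ^ n" by (metis dvd_triv_left)
      then obtain i where i: "card (orbit Q \<psi> z) = p ^ i" using divides_primepow_nat[OF p] by blast
      have "i \<noteq> 0"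
      proof
        assume "i = 0"
        then obtain w where w: "orbit Q \<psi> z = {w}" using i by (auto simp: card_1_singleton_iff)
        then have "act q z = w" if "q \<in> carrier Q" for q using orb[OF zZ] that by blast
        moreover have "z = w" using A.orbit_refl[OF zZ] w by simp
        ultimately show False using z by blast
      qed
      then show ?thesis using i by (simp add: dvd_power)
    qed
    then have "(of_nat (card (orbit Q \<psi> z)) :: 'k) = 0" using char by (simp add: of_nat_eq_0_iff_char_dvd)
    finally show ?thesis by simp
  qed
  have "(\<Sum>z\<in>?nf. F z) = (\<Sum>o'\<in>orbit Q \<psi> ` ?nf. \<Sum>x | x \<in> ?nf \<and> orbit Q \<psi> x = o'. F x)"
    by (rule sum.group[symmetric]) (use fin in auto)
  also have "\<dots> = 0" by (rule sum.neutral) (use inner in blast)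
  finally have nf: "(\<Sum>z\<in>?nf. F z) = 0" .
  have "(\<Sum>z\<in>Z. F z) = (\<Sum>z\<in>?fix \<union> ?nf. F z)" by (rule sum.cong) auto
  also have "\<dots> = (\<Sum>z\<in>?fix. F z) + (\<Sum>z\<in>?nf. F z)"
    by (rule sum.union_disjoint) (use fin in auto)
  finally show ?thesis using nf by simp
qed

lemma sylow_index_not_dvd:
  fixes p :: nat
  assumes p: "prime p" and n: "n > 0" and m: "r * p ^ multiplicity p n = n"
  shows "\<not> p dvd r"
proof
  assume "p dvd r"
  then obtain s where "r = p * s" by blast
  then have "n = p ^ Suc (multiplicity p n) * s" using m by (simp add: mult_ac)
  then have "p ^ Suc (multiplicity p n) dvd n" by (metis dvd_triv_left)
  moreover have "\<not> is_unit p" using p not_prime_unit by blast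
  ultimately show False using power_dvd_iff_le_multiplicity[where x = n and p = p and n = "Suc (multiplicity p n)"] n
    by (simp add: Suc_le_eq)
qed

context permutation_module
begin

text \<open>
  By transitivity, the trace from \<open>H\<close> of a \<open>K\<close>-invariant matrix is the index times its trace from
  \<open>K\<close>.
\<close>

lemma rel_trace_invertible_index:
  assumes a: "a \<in> Inv K" and H: "subgroup H G" and K: "subgroup K G" "H \<subseteq> K"
    and idx: "(of_nat (card (Gr.cosets K H)) :: 'k) \<noteq> 0"
  shows "\<exists>b\<in>Inv H. rel_trace (carrier G) H b = rel_trace (carrier G) K a"
proof -
  let ?c = "inverse (of_nat (card (Gr.cosets K H))) :: 'k"
  let ?b = "mat_scale ?c a"
  have b: "?b \<in> Inv K" using a by (auto simp: invariant_matrices_def matrices_def mat_scale_def)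
  have bH: "?b \<in> Inv H" by (rule Inv_mono[OF K(2) b])
  have "rel_trace (carrier G) H ?b = rel_trace (carrier G) K (rel_trace K H ?b)"
    by (rule rel_trace_trans[OF bH H K Gr.subgroup_self subgroup.subset[OF K(1)]])
  also have "rel_trace K H ?b = mat_scale (of_nat (card (Gr.cosets K H))) ?b"
    by (rule rel_trace_index[OF b H K])
  also have "\<dots> = a" using idx by (simp add: mat_scale_def fun_eq_iff)
  finally show ?thesis using bH by blast
qed

lemma rel_trace_mono:
  assumes a: "a \<in> Inv H" and H: "subgroup H G" and K: "subgroup K G" "H \<subseteq> K"
  shows "\<exists>b\<in>Inv K. rel_trace (carrier G) K b = rel_trace (carrier G) H a"
  using rel_trace_trans[OF a H K Gr.subgroup_self subgroup.subset[OF K(1)]] rel_trace_invariant[OF a H K] by metis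

definition pair_stabilizer :: "'g set \<Rightarrow> 'a \<times> 'a \<Rightarrow> 'g set" where
  "pair_stabilizer K z = {g \<in> K. \<phi> g (fst z) = fst z \<and> \<phi> g (snd z) = snd z}"

lemma pair_stabilizer_subgroup:
  assumes K: "subgroup K G" and z: "z \<in> \<Omega> \<times> \<Omega>"
  shows "subgroup (pair_stabilizer K z) G"
proof
  have KG: "K \<subseteq> carrier G" by (rule subgroup.subset[OF K])
  have zO: "fst z \<in> \<Omega>" "snd z \<in> \<Omega>" using z by auto
  show "pair_stabilizer K z \<subseteq> carrier G" using KG by (auto simp: pair_stabilizer_def)
  show "\<one> \<in> pair_stabilizer K z" using subgroup.one_closed[OF K] act_one zO by (simp add: pair_stabilizer_def)
  show "g \<otimes> h \<in> pair_stabilizer K z" if "g \<in> pair_stabilizer K z" "h \<in> pair_stabilizer K z" for g h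
    using that subsetD[OF KG] act_mult[of g h] zO subgroup.m_closed[OF K] by (auto simp: pair_stabilizer_def)
  show "inv g \<in> pair_stabilizer K z" if g: "g \<in> pair_stabilizer K z" for g
  proof -
    have gK: "g \<in> K" "g \<in> carrier G" using g KG by (auto simp: pair_stabilizer_def)
    have "\<phi> (inv g) (fst z) = fst z" "\<phi> (inv g) (snd z) = snd z"
      using act_inv(1)[OF gK(2) zO(1)] act_inv(1)[OF gK(2) zO(2)] g by (simp_all add: pair_stabilizer_def)
    then show ?thesis using subgroup.m_inv_closed[OF K gK(1)] by (simp add: pair_stabilizer_def)
  qed
qed

lemma mat_unit_invariant:
  assumes K: "subgroup K G" and z: "z \<in> \<Omega> \<times> \<Omega>"
  shows "mat_scale c (mat_unit z) \<in> Inv (pair_stabilizer K z)"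
proof -
  have KG: "K \<subseteq> carrier G" by (rule subgroup.subset[OF K])
  have "mat_unit z (\<phi> g x) (\<phi> g y) = (mat_unit z x y :: 'k)"
    if g: "g \<in> pair_stabilizer K z" and x: "x \<in> \<Omega>" "y \<in> \<Omega>" for g x y
  proof -
    have gG: "g \<in> carrier G" using g KG by (auto simp: pair_stabilizer_def)
    have inj: "\<phi> g u = \<phi> g w \<longleftrightarrow> u = w" if "u \<in> \<Omega>" "w \<in> \<Omega>" for u w using act_inv(1)[OF gG] that by metis
    have "(\<phi> g x, \<phi> g y) = z \<longleftrightarrow> (x, y) = z"
      using inj[of x "fst z"] inj[of y "snd z"] g z x by (auto simp: pair_stabilizer_def prod_eq_iff)
    then show ?thesis by (simp add: mat_unit_def)
  qed
  then show ?thesis using z by (auto simp: invariant_matrices_def matrices_def mat_scale_def mat_unit_def)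
qed

text \<open>
  The group elements that move a given point of the orbit of \<open>z\<close> to \<open>z\<close> form exactly one coset of
  the stabilizer, so the trace of the matrix unit is the indicator function of the orbit.
\<close>

lemma rel_trace_mat_unit:
  assumes K: "subgroup K G" and z: "z \<in> \<Omega> \<times> \<Omega>" and x: "x \<in> \<Omega>" "y \<in> \<Omega>"
  shows "rel_trace K (pair_stabilizer K z) (mat_unit z) x y =
    (if \<exists>g\<in>K. (\<phi> g x, \<phi> g y) = z then 1 else 0)"
proof -
  let ?H = "pair_stabilizer K z"
  have KG: "K \<subseteq> carrier G" by (rule subgroup.subset[OF K])
  have H: "subgroup ?H G" "?H \<subseteq> K" using pair_stabilizer_subgroup[OF K z] by (auto simp: pair_stabilizer_def)
  note r = Gr.rep_in[OF H(1) K H(2)]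
  show ?thesis
  proof (cases "\<exists>g\<in>K. (\<phi> g x, \<phi> g y) = z")
    case True
    then obtain g where g: "g \<in> K" "\<phi> g x = fst z" "\<phi> g y = snd z" by (auto simp: prod_eq_iff)
    have gG: "g \<in> carrier G" using g KG by blast
    have iff: "(\<phi> (Gr.rep C) x, \<phi> (Gr.rep C) y) = z \<longleftrightarrow> C = ?H #> g" if C: "C \<in> Gr.cosets K ?H" for C
    proof -
      let ?c = "Gr.rep C"
      have cK: "?c \<in> K" and cG: "?c \<in> carrier G" using r[OF C] KG by auto
      have "C = ?H #> g \<longleftrightarrow> ?H #> ?c = ?H #> g" using r[OF C] by simp
      also have "\<dots> \<longleftrightarrow> ?c \<otimes> inv g \<in> ?H" by (rule Gr.coset_eq_iff[OF H(1) cG gG])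
      also have "\<dots> \<longleftrightarrow> \<phi> ?c x = fst z \<and> \<phi> ?c y = snd z"
      proof -
        have "\<phi> (?c \<otimes> inv g) (fst z) = \<phi> ?c x"
          using act_mult[OF cG _ act_closed[OF gG x(1)], of "inv g"] act_inv(1)[OF gG x(1)] gG g by simp
        moreover have "\<phi> (?c \<otimes> inv g) (snd z) = \<phi> ?c y"
          using act_mult[OF cG _ act_closed[OF gG x(2)], of "inv g"] act_inv(1)[OF gG x(2)] gG g by simp
        moreover have "?c \<otimes> inv g \<in> K"
          using subgroup.m_closed[OF K cK subgroup.m_inv_closed[OF K g(1)]] .
        ultimately show ?thesis by (simp add: pair_stabilizer_def)
      qed
      finally show ?thesis by (auto simp: prod_eq_iff)
    qed
    have "rel_trace K ?H (mat_unit z) x y = (\<Sum>C\<in>Gr.cosets K ?H. if C = ?H #> g then 1 else 0 :: 'k)"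
      unfolding rel_trace_def mat_unit_def using x by (simp add: iff cong: sum.cong)
    also have "\<dots> = 1"
    proof -
      have "finite (Gr.cosets K ?H)" using finite_subset[OF KG finite_group] by (rule Gr.finite_cosets)
      moreover have "?H #> g \<in> Gr.cosets K ?H" using g by (simp add: Gr.cosets_def)
      ultimately show ?thesis by simp
    qed
    finally show ?thesis using True by simp
  next
    case False
    then have "(\<phi> (Gr.rep C) x, \<phi> (Gr.rep C) y) \<noteq> z" if "C \<in> Gr.cosets K ?H" for C using r[OF that] by blast
    then have "rel_trace K ?H (mat_unit z) x y = 0"
      unfolding rel_trace_def mat_unit_def using x by (simp cong: sum.cong)
    then show ?thesis using False by simp
  qed
qed

text \<open>
  \<open>Z\<close> contains one representative of each orbit on which \<open>c\<close> does not vanish. If \<open>c\<close> vanishes on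
  the pairs fixed by \<open>K\<close>, all stabilizers that occur are proper subgroups of \<open>K\<close>.
\<close>

lemma invariant_orbit_expansion:
  assumes K: "subgroup K G" and c: "c \<in> Inv K"
  obtains Z where "Z \<subseteq> \<Omega> \<times> \<Omega>" "\<forall>z\<in>Z. c (fst z) (snd z) \<noteq> 0"
    "c = (\<Sum>z\<in>Z. rel_trace K (pair_stabilizer K z) (mat_scale (c (fst z) (snd z)) (mat_unit z)))"
proof -
  have KG: "K \<subseteq> carrier G" by (rule subgroup.subset[OF K])
  define orb where "orb z = (\<lambda>g. (\<phi> g (fst z), \<phi> g (snd z))) ` K" for z
  define pick where "pick z = (SOME w. w \<in> orb z)" for z
  have orb_self: "z \<in> orb z" if "z \<in> \<Omega> \<times> \<Omega>" for z
    using that subgroup.one_closed[OF K] act_one unfolding orb_def by (auto intro!: image_eqI[of _ _ "\<one>"])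
  have orb_sub: "orb w \<subseteq> orb z" if z: "z \<in> \<Omega> \<times> \<Omega>" and w: "w \<in> orb z" for z w
  proof -
    obtain g where g: "g \<in> K" "w = (\<phi> g (fst z), \<phi> g (snd z))" using w by (auto simp: orb_def)
    show ?thesis
    proof
      fix u assume "u \<in> orb w"
      then obtain h where h: "h \<in> K" "u = (\<phi> h (fst w), \<phi> h (snd w))" by (auto simp: orb_def)
      have "u = (\<phi> (h \<otimes> g) (fst z), \<phi> (h \<otimes> g) (snd z))"
        using g h act_mult subsetD[OF KG] z by auto
      then show "u \<in> orb z" using subgroup.m_closed[OF K h(1) g(1)] unfolding orb_def by blast
    qed
  qed
  have orbO: "orb z \<subseteq> \<Omega> \<times> \<Omega>" if "z \<in> \<Omega> \<times> \<Omega>" for z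
    using that act_closed subsetD[OF KG] by (auto simp: orb_def)
  have orb_sym: "z \<in> orb w" if z: "z \<in> \<Omega> \<times> \<Omega>" and w: "w \<in> orb z" for z w
  proof -
    obtain g where g: "g \<in> K" "w = (\<phi> g (fst z), \<phi> g (snd z))" using w by (auto simp: orb_def)
    have "z = (\<phi> (inv g) (fst w), \<phi> (inv g) (snd w))"
      using g act_inv(1)[of g] subsetD[OF KG] z by (auto simp: prod_eq_iff)
    then show ?thesis using subgroup.m_inv_closed[OF K g(1)] unfolding orb_def by blast
  qed
  have orb_eq: "orb w = orb z" if "z \<in> \<Omega> \<times> \<Omega>" "w \<in> orb z" for z w
    using orb_sub[OF that] orb_sub[OF _ orb_sym[OF that]] orbO[OF that(1)] that by blast
  have pick: "pick z \<in> orb z" if "z \<in> \<Omega> \<times> \<Omega>" for z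
    unfolding pick_def using orb_self[OF that] by (rule someI[of "\<lambda>w. w \<in> orb z"])
  have pick_eq: "pick w = pick z" if "z \<in> \<Omega> \<times> \<Omega>" "w \<in> orb z" for z w
    unfolding pick_def using orb_eq[OF that] by simp
  define Z where "Z = {z \<in> pick ` (\<Omega> \<times> \<Omega>). c (fst z) (snd z) \<noteq> 0}"
  have pickO: "pick z \<in> \<Omega> \<times> \<Omega>" if "z \<in> \<Omega> \<times> \<Omega>" for z using subsetD[OF orbO[OF that] pick[OF that]] .
  have ZO: "Z \<subseteq> \<Omega> \<times> \<Omega>"
  proof
    fix z assume "z \<in> Z"
    then obtain w where "w \<in> \<Omega> \<times> \<Omega>" "z = pick w" unfolding Z_def by blast
    then show "z \<in> \<Omega> \<times> \<Omega>" using pickO by simp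
  qed
  have finZ: "finite Z" using finite_subset[OF ZO] finite_set by simp
  have Zpick: "pick z = z" if z: "z \<in> Z" for z
  proof -
    obtain w where w: "w \<in> \<Omega> \<times> \<Omega>" "z = pick w" using z unfolding Z_def by blast
    then show ?thesis using pick_eq[OF w(1) pick[OF w(1)]] by simp
  qed
  have expansion: "c = (\<Sum>z\<in>Z. rel_trace K (pair_stabilizer K z) (mat_scale (c (fst z) (snd z)) (mat_unit z)))"
  proof (intro ext)
    fix x y
    show "c x y = (\<Sum>z\<in>Z. rel_trace K (pair_stabilizer K z) (mat_scale (c (fst z) (snd z)) (mat_unit z))) x y"
    proof (cases "x \<in> \<Omega> \<and> y \<in> \<Omega>")
      case True
      let ?w = "pick (x, y)"
      have xy: "(x, y) \<in> \<Omega> \<times> \<Omega>" using True by simp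
      obtain g where g: "g \<in> K" "?w = (\<phi> g x, \<phi> g y)" using pick[OF xy] by (auto simp: orb_def)
      have cw: "c (fst ?w) (snd ?w) = c x y" using InvD[OF c g(1)] g(2) True by simp
      have t: "rel_trace K (pair_stabilizer K z) (mat_scale (c (fst z) (snd z)) (mat_unit z)) x y =
          (if z = ?w then c x y else 0)" if z: "z \<in> Z" for z
      proof -
        have zO: "z \<in> \<Omega> \<times> \<Omega>" using z ZO by blast
        have "(\<exists>g\<in>K. (\<phi> g x, \<phi> g y) = z) \<longleftrightarrow> z \<in> orb (x, y)" by (auto simp: orb_def)
        also have "\<dots> \<longleftrightarrow> z = ?w" using pick_eq[OF xy, of z] Zpick[OF z] pick[OF xy] by auto
        finally have "rel_trace K (pair_stabilizer K z) (mat_unit z) x y = (if z = ?w then 1 else 0 :: 'k)"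
          using rel_trace_mat_unit[OF K zO, of x y] True by simp
        then have "rel_trace K (pair_stabilizer K z) (mat_scale (c (fst z) (snd z)) (mat_unit z)) x y =
            (if z = ?w then c (fst z) (snd z) else 0)" unfolding rel_trace_scale by (simp add: mat_scale_def)
        then show ?thesis by (simp only: cw cong: if_cong)
      qed
      have "(\<Sum>z\<in>Z. rel_trace K (pair_stabilizer K z) (mat_scale (c (fst z) (snd z)) (mat_unit z))) x y =
          (\<Sum>z\<in>Z. if z = ?w then c x y else 0)"
        unfolding sum_fun_apply by (rule sum.cong[OF refl t])
      also have "\<dots> = (if ?w \<in> Z then c x y else 0)" using finZ by simp
      also have "\<dots> = c x y" using cw xy by (auto simp: Z_def)
      finally show ?thesis ..
    next
      case False
      then have "c x y = 0" using c by (auto simp: invariant_matrices_def matrices_def)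
      then show ?thesis using False by (auto simp: sum_fun_apply rel_trace_def)
    qed
  qed
  show thesis by (rule that[OF ZO _ expansion]) (simp add: Z_def)
qed

end


section \<open>Restriction of invariant matrices to a closed set\<close>

locale closed_set = permutation_module G \<Omega> \<phi> k\<Omega>
  for G :: "('g, 'm) monoid_scheme" (structure) and \<Omega> :: "'a set" and \<phi> :: "'g \<Rightarrow> 'a \<Rightarrow> 'a"
    and k\<Omega> :: "('a \<Rightarrow> 'k::field, 'k, 'g) gmodule" +
  fixes p :: nat and X :: "'a set" and Q :: "'g set"
  assumes prime_p: "prime p" and char_k: "CHAR('k) = p"
    and Sylow_Q: "sylow_subgroup_of p G (pointwise_stabilizer G \<phi> X) Q"
    and fixed_Q: "fixed_points \<Omega> \<phi> Q = X"
begin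

abbreviation S :: "'g set" where "S \<equiv> pointwise_stabilizer G \<phi> X"
abbreviation N :: "'g set" where "N \<equiv> setwise_stabilizer G \<phi> X"
abbreviation M :: "'g set monoid" where "M \<equiv> setwise_mod_pointwise G \<phi> X"
abbreviation \<psi> :: "'g set \<Rightarrow> 'a \<Rightarrow> 'a" where "\<psi> \<equiv> quotient_action \<phi> X"
abbreviation kX :: "('a \<Rightarrow> 'k, 'k, 'g set) gmodule" where "kX \<equiv> perm_module M X \<psi>"

lemma X_sub: "X \<subseteq> \<Omega>"
  using fixed_Q by (auto simp: fixed_points_def)

lemma finite_X: "finite X"
  using finite_subset[OF X_sub finite_set] .

lemma S_carrier: "S \<subseteq> carrier G" and N_carrier: "N \<subseteq> carrier G"
  by (auto simp: pointwise_stabilizer_def setwise_stabilizer_def)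

lemma S_fix: "s \<in> S \<Longrightarrow> x \<in> X \<Longrightarrow> \<phi> s x = x"
  by (simp add: pointwise_stabilizer_def)

lemma S_subgroup: "subgroup S G"
proof
  show "S \<subseteq> carrier G" by (rule S_carrier)
  show "\<one> \<in> S" using act_one X_sub by (auto simp: pointwise_stabilizer_def)
  show "g \<otimes> h \<in> S" if "g \<in> S" "h \<in> S" for g h
    using that act_mult[of g h] subsetD[OF X_sub] by (simp add: pointwise_stabilizer_def)
  show "inv g \<in> S" if g: "g \<in> S" for g
  proof -
    have "\<phi> (inv g) x = x" if "x \<in> X" for x
      using act_inv(1)[of g x] S_fix[OF g that] g that X_sub S_carrier by auto
    then show ?thesis using g by (simp add: pointwise_stabilizer_def)
  qed
qed

text \<open>An injective self-map of a finite set is surjective.\<close>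

lemma setwise_stabilizerI:
  assumes g: "g \<in> carrier G" and sub: "\<And>x. x \<in> X \<Longrightarrow> \<phi> g x \<in> X"
  shows "g \<in> N"
proof -
  have "inj_on (\<phi> g) X" using inj_prop[OF g] X_sub by (rule inj_on_subset)
  moreover have "\<phi> g ` X \<subseteq> X" using sub by blast
  ultimately have "\<phi> g ` X = X" using finite_X by (simp add: endo_inj_surj)
  then show ?thesis using g by (simp add: setwise_stabilizer_def)
qed

lemma N_act: "g \<in> N \<Longrightarrow> x \<in> X \<Longrightarrow> \<phi> g x \<in> X"
  by (auto simp: setwise_stabilizer_def)

lemma N_subgroup: "subgroup N G"
proof
  show "N \<subseteq> carrier G" by (rule N_carrier)
  show "\<one> \<in> N" using act_one X_sub by (intro setwise_stabilizerI) auto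
  show "g \<otimes> h \<in> N" if gh: "g \<in> N" "h \<in> N" for g h
  proof (rule setwise_stabilizerI)
    have G: "g \<in> carrier G" "h \<in> carrier G" using gh N_carrier by auto
    then show "g \<otimes> h \<in> carrier G" by simp
    show "\<phi> (g \<otimes> h) x \<in> X" if "x \<in> X" for x
      using act_mult[OF G] N_act[OF gh(1) N_act[OF gh(2) that]] that X_sub by auto
  qed
  show "inv g \<in> N" if g: "g \<in> N" for g
  proof (rule setwise_stabilizerI)
    have gG: "g \<in> carrier G" using g N_carrier by auto
    then show "inv g \<in> carrier G" by simp
    fix x assume "x \<in> X"
    then obtain y where "y \<in> X" "x = \<phi> g y" using g unfolding setwise_stabilizer_def by blast
    then show "\<phi> (inv g) x \<in> X" using act_inv(1)[OF gG] X_sub by auto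
  qed
qed

lemma S_sub_N: "S \<subseteq> N"
  by (auto simp: pointwise_stabilizer_def setwise_stabilizer_def)

lemma Q_subgroup: "subgroup Q G" and Q_sub_S: "Q \<subseteq> S" and card_Q: "card Q = p ^ multiplicity p (card S)"
  using Sylow_Q by (auto simp: sylow_subgroup_of_def)

lemma Q_carrier: "Q \<subseteq> carrier G"
  using subgroup.subset[OF Q_subgroup] .

lemma carrier_M: "carrier M = Gr.cosets N S"
  by (simp add: setwise_mod_pointwise_def carrier_FactGroup Gr.cosets_def)

lemma \<psi>_coset:
  assumes g: "g \<in> N" and x: "x \<in> X" shows "\<psi> (S #> g) x = \<phi> g x"
proof -
  have gG: "g \<in> carrier G" using g N_carrier by auto
  have "\<phi> (s \<otimes> g) x = \<phi> g x" if "s \<in> S" for s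
    using act_mult[of s g x] S_fix[OF that N_act[OF g x]] that gG S_carrier x X_sub by auto
  then have "(\<lambda>g. \<phi> g x) ` (S #> g) \<subseteq> {\<phi> g x}" by (auto simp: r_coset_def)
  moreover have "g \<in> S #> g" by (rule Gr.rcos_self[OF gG S_subgroup])
  ultimately have "(\<lambda>g. \<phi> g x) ` (S #> g) = {\<phi> g x}" by blast
  then show ?thesis using x by (simp add: quotient_action_def)
qed

lemma \<psi>_rep: "C \<in> carrier M \<Longrightarrow> x \<in> X \<Longrightarrow> \<psi> C x = \<phi> (Gr.rep C) x"
  using Gr.rep_in[OF S_subgroup N_subgroup S_sub_N] \<psi>_coset carrier_M by metis

sublocale B: permutation_module M X \<psi> kX
proof -
  have "faithful_action M X \<psi>" by (rule quotient_faithful[OF group_action_axioms X_sub])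
  then have ga: "group_action M X \<psi>" by (rule faithful_action.axioms(1))
  have "finite (carrier M)"
    unfolding carrier_M using finite_subset[OF N_carrier finite_group] by (rule Gr.finite_cosets)
  then show "permutation_module M X \<psi> kX"
    using ga finite_X by (simp add: permutation_module_def permutation_module_axioms_def)
qed

text \<open>The Brauer homomorphism with respect to the basis \<open>\<Omega>\<close>.\<close>

definition restr :: "('a \<Rightarrow> 'a \<Rightarrow> 'k) \<Rightarrow> 'a \<Rightarrow> 'a \<Rightarrow> 'k" where
  "restr a = (\<lambda>x y. if x \<in> X \<and> y \<in> X then a x y else 0)"

text \<open>
  For \<open>x, y \<in> X\<close> the summand \<open>a x w * b w y\<close> is constant on the \<open>R\<close>-orbits of \<open>w\<close>, so only the fixed
  points \<open>w \<in> X\<close> contribute.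
\<close>

lemma restr_mult:
  assumes R: "subgroup R G" "card R = p ^ n" "fixed_points \<Omega> \<phi> R = X"
    and a: "a \<in> Inv R" and b: "b \<in> Inv R"
  shows "restr (mat_mult \<Omega> a b) = mat_mult X (restr a) (restr b)"
proof (intro ext)
  fix x y
  have RG: "R \<subseteq> carrier G" using subgroup.subset[OF R(1)] .
  have fixR: "\<phi> q x = x" if "q \<in> R" "x \<in> X" for q x using that R(3) by (auto simp: fixed_points_def)
  show "restr (mat_mult \<Omega> a b) x y = mat_mult X (restr a) (restr b) x y"
  proof (cases "x \<in> X \<and> y \<in> X")
    case True
    then have xy: "x \<in> X" "y \<in> X" "x \<in> \<Omega>" "y \<in> \<Omega>" using X_sub by auto
    have "(\<Sum>w\<in>\<Omega>. a x w * b w y) =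
        (\<Sum>w | w \<in> \<Omega> \<and> (\<forall>q\<in>carrier (G\<lparr>carrier := R\<rparr>). \<phi> q w = w). a x w * b w y)"
    proof (rule sum_fixed_points_mod_p[OF subgroup.subgroup_is_group[OF R(1) Gr.group_axioms] finite_set _ prime_p char_k])
      show "card (carrier (G\<lparr>carrier := R\<rparr>)) = p ^ n" using R(2) by simp
      show "\<phi> q z \<in> \<Omega>" if "q \<in> carrier (G\<lparr>carrier := R\<rparr>)" "z \<in> \<Omega>" for q z
        using act_closed that RG by auto
      show "\<phi> \<one>\<^bsub>G\<lparr>carrier := R\<rparr>\<^esub> z = z" if "z \<in> \<Omega>" for z using act_one[OF that] by simp
      show "\<phi> (q \<otimes>\<^bsub>G\<lparr>carrier := R\<rparr>\<^esub> r) z = \<phi> q (\<phi> r z)"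
        if "q \<in> carrier (G\<lparr>carrier := R\<rparr>)" "r \<in> carrier (G\<lparr>carrier := R\<rparr>)" "z \<in> \<Omega>" for q r z
        using act_mult that RG by auto
      show "a x (\<phi> q z) * b (\<phi> q z) y = a x z * b z y" if "q \<in> carrier (G\<lparr>carrier := R\<rparr>)" "z \<in> \<Omega>" for q z
      proof -
        have q: "q \<in> R" using that by simp
        show ?thesis using InvD[OF a q xy(3) that(2)] InvD[OF b q that(2) xy(4)] fixR[OF q] xy by simp
      qed
    qed
    also have "{w. w \<in> \<Omega> \<and> (\<forall>q\<in>carrier (G\<lparr>carrier := R\<rparr>). \<phi> q w = w)} = X"
      using R(3) by (simp add: fixed_points_def)
    finally show ?thesis using xy by (simp add: restr_def mat_mult_def)
  next
    case False
    then show ?thesis by (auto simp: restr_def mat_mult_def)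
  qed
qed

lemma fixed_coset_iff:
  assumes H: "subgroup H G" and C: "C \<in> Gr.cosets (carrier G) H"
  shows "(\<forall>q\<in>Q. C #> inv q = C) \<longleftrightarrow> (\<forall>q\<in>Q. Gr.rep C \<otimes> q \<otimes> inv (Gr.rep C) \<in> H)"
proof -
  note r = Gr.rep_in[OF H Gr.subgroup_self subgroup.subset[OF H] C]
  have 1: "C #> q = C \<longleftrightarrow> Gr.rep C \<otimes> q \<otimes> inv (Gr.rep C) \<in> H" if q: "q \<in> Q" for q
  proof -
    have qG: "q \<in> carrier G" using q Q_carrier by auto
    have "C #> q = H #> (Gr.rep C \<otimes> q)"
      using Gr.coset_mult_assoc[OF subgroup.subset[OF H] r(1) qG] r(2) by simp
    then show ?thesis using Gr.coset_eq_iff[OF H _ r(1), of "Gr.rep C \<otimes> q"] r qG by simp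
  qed
  have inv: "inv q \<in> Q" "inv (inv q) = q" if "q \<in> Q" for q
    using that subgroup.m_inv_closed[OF Q_subgroup] Q_carrier by auto
  show ?thesis using 1 inv by metis
qed

text \<open>
  \<open>Q\<close> permutes the right cosets of \<open>H\<close> by right multiplication. For \<open>x, y \<in> X\<close> the summands are
  constant on the \<open>Q\<close>-orbits, so only the cosets \<open>H g\<close> with \<open>g Q g\<^sup>-\<^sup>1 \<subseteq> H\<close> contribute.
\<close>

lemma restr_rel_trace:
  assumes H: "subgroup H G" and a: "a \<in> Inv H" and x: "x \<in> X" "y \<in> X"
  shows "rel_trace (carrier G) H a x y =
    (\<Sum>C | C \<in> Gr.cosets (carrier G) H \<and> (\<forall>q\<in>Q. Gr.rep C \<otimes> q \<otimes> inv (Gr.rep C) \<in> H).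
       a (\<phi> (Gr.rep C) x) (\<phi> (Gr.rep C) y))"
proof -
  let ?I = "Gr.cosets (carrier G) H"
  let ?F = "\<lambda>C. a (\<phi> (Gr.rep C) x) (\<phi> (Gr.rep C) y)"
  let ?act = "\<lambda>q C. C #> inv q"
  have HG: "H \<subseteq> carrier G" using subgroup.subset[OF H] .
  note r = Gr.rep_in[OF H Gr.subgroup_self HG]
  have xO: "x \<in> \<Omega>" "y \<in> \<Omega>" using x X_sub by auto
  have CG: "C \<subseteq> carrier G" if "C \<in> ?I" for C
    using that Gr.r_coset_subset_G[OF HG] by (auto simp: Gr.cosets_def)
  have "(\<Sum>C\<in>?I. ?F C) = (\<Sum>C | C \<in> ?I \<and> (\<forall>q\<in>carrier (G\<lparr>carrier := Q\<rparr>). ?act q C = C). ?F C)"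
  proof (rule sum_fixed_points_mod_p[OF subgroup.subgroup_is_group[OF Q_subgroup Gr.group_axioms] _ _ prime_p char_k])
    show "finite ?I" using finite_group by (rule Gr.finite_cosets)
    show "card (carrier (G\<lparr>carrier := Q\<rparr>)) = p ^ multiplicity p (card S)" using card_Q by simp
    have shift: "C #> q = H #> (Gr.rep C \<otimes> q)" if "C \<in> ?I" "q \<in> carrier G" for C q
      using Gr.coset_mult_assoc[OF HG r(1)[OF that(1)] that(2)] r(2)[OF that(1)] by simp
    show "?act q C \<in> ?I" if "q \<in> carrier (G\<lparr>carrier := Q\<rparr>)" "C \<in> ?I" for q C
    proof -
      have "inv q \<in> carrier G" using that Q_carrier by auto
      then show ?thesis using shift[OF that(2)] r(1)[OF that(2)] by (simp add: Gr.cosets_def)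
    qed
    show "?act \<one>\<^bsub>G\<lparr>carrier := Q\<rparr>\<^esub> C = C" if "C \<in> ?I" for C using CG[OF that] by simp
    show "?act (q \<otimes>\<^bsub>G\<lparr>carrier := Q\<rparr>\<^esub> t) C = ?act q (?act t C)"
      if q: "q \<in> carrier (G\<lparr>carrier := Q\<rparr>)" and t: "t \<in> carrier (G\<lparr>carrier := Q\<rparr>)" and C: "C \<in> ?I" for q t C
    proof -
      have "q \<in> carrier G" "t \<in> carrier G" using q t Q_carrier by auto
      then show ?thesis using Gr.coset_mult_assoc[OF CG[OF C], of "inv t" "inv q"] by (simp add: Gr.inv_mult_group)
    qed
    show "?F (?act q C) = ?F C" if q: "q \<in> carrier (G\<lparr>carrier := Q\<rparr>)" and C: "C \<in> ?I" for q C
    proof -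
      have iq: "inv q \<in> Q" "inv q \<in> carrier G"
        using q subgroup.m_inv_closed[OF Q_subgroup] Q_carrier by auto
      have fx: "\<phi> (inv q) x = x" "\<phi> (inv q) y = y" using S_fix x iq(1) Q_sub_S by auto
      have rC: "Gr.rep C \<otimes> inv q \<in> carrier G" using r(1)[OF C] iq(2) by simp
      have "?F (?act q C) = a (\<phi> (Gr.rep C \<otimes> inv q) x) (\<phi> (Gr.rep C \<otimes> inv q) y)"
        unfolding shift[OF C iq(2)]
        by (rule Gr.rep_invariant[OF H rC, of "\<lambda>g. a (\<phi> g x) (\<phi> g y)"]) (rule Inv_coset[OF a H _ _ xO])
      then show ?thesis using act_mult[OF r(1)[OF C] iq(2)] xO fx by simp
    qed
  qed
  also have "{C. C \<in> ?I \<and> (\<forall>q\<in>carrier (G\<lparr>carrier := Q\<rparr>). ?act q C = C)} =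
      {C. C \<in> ?I \<and> (\<forall>q\<in>Q. Gr.rep C \<otimes> q \<otimes> inv (Gr.rep C) \<in> H)}"
    using fixed_coset_iff[OF H] by auto
  finally show ?thesis using xO by (simp add: rel_trace_def)
qed

text \<open>No conjugate of \<open>Q\<close> is contained in a smaller group.\<close>

lemma restr_rel_trace_smaller:
  assumes H: "subgroup H G" "H \<subset> Q" and a: "a \<in> Inv H"
  shows "restr (rel_trace (carrier G) H a) = 0"
proof -
  have finQ: "finite Q" using finite_subset[OF Q_carrier finite_group] .
  have none: "\<not> (\<forall>q\<in>Q. g \<otimes> q \<otimes> inv g \<in> H)" if g: "g \<in> carrier G" for g
  proof
    assume conj: "\<forall>q\<in>Q. g \<otimes> q \<otimes> inv g \<in> H"
    have "inj_on (\<lambda>q. g \<otimes> q \<otimes> inv g) Q"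
    proof (rule inj_onI)
      fix q t assume q: "q \<in> Q" and t: "t \<in> Q" and eq: "g \<otimes> q \<otimes> inv g = g \<otimes> t \<otimes> inv g"
      have "q \<in> carrier G" "t \<in> carrier G" using q t Q_carrier by auto
      then show "q = t" using eq g by simp
    qed
    then have "card Q \<le> card H"
      using conj finite_subset[OF psubset_imp_subset[OF H(2)] finQ] by (intro card_inj_on_le) auto
    then show False using psubset_card_mono[OF finQ H(2)] by simp
  qed
  have "rel_trace (carrier G) H a x y = 0" if "x \<in> X" "y \<in> X" for x y
    unfolding restr_rel_trace[OF H(1) a that]
  proof (rule sum.neutral, clarify)
    fix C assume C: "C \<in> Gr.cosets (carrier G) H"
      "\<forall>q\<in>Q. Gr.rep C \<otimes> q \<otimes> inv Gr.rep C \<in> H"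
    have "Gr.rep C \<in> carrier G" using Gr.rep_in[OF H(1) Gr.subgroup_self subgroup.subset[OF H(1)] C(1)] by blast
    then show "a (\<phi> (Gr.rep C) x) (\<phi> (Gr.rep C) y) = 0" using none C(2) by blast
  qed
  then show ?thesis by (auto simp: restr_def fun_eq_iff)
qed

lemma restr_matrices: "restr a \<in> matrices X"
  by (simp add: restr_def matrices_def)

lemma B_Inv_one: "B.Inv {\<one>\<^bsub>M\<^esub>} = matrices X"
  using B.act_one by (auto simp: invariant_matrices_def)

text \<open>
  If \<open>g Q g\<^sup>-\<^sup>1 \<subseteq> S\<close>, then \<open>Q\<close> fixes \<open>g\<^sup>-\<^sup>1 X\<close> pointwise, so \<open>g\<^sup>-\<^sup>1 X \<subseteq> X\<close> and \<open>g\<close> lies in the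
  setwise stabilizer. The cosets that contribute are thus the elements of \<open>M\<^sub>X\<close>.
\<close>

lemma restr_rel_trace_S:
  assumes a: "a \<in> Inv S"
  shows "restr (rel_trace (carrier G) S a) = B.rel_trace (carrier M) {\<one>\<^bsub>M\<^esub>} (restr a)"
proof (intro ext)
  fix x y
  show "restr (rel_trace (carrier G) S a) x y = B.rel_trace (carrier M) {\<one>\<^bsub>M\<^esub>} (restr a) x y"
  proof (cases "x \<in> X \<and> y \<in> X")
    case True
    then have x: "x \<in> X" "y \<in> X" by auto
    note rN = Gr.rep_in[OF S_subgroup N_subgroup S_sub_N]
    note rG = Gr.rep_in[OF S_subgroup Gr.subgroup_self S_carrier]
    have "{C \<in> Gr.cosets (carrier G) S. \<forall>q\<in>Q. Gr.rep C \<otimes> q \<otimes> inv (Gr.rep C) \<in> S} = carrier M"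
    proof (intro Set.set_eqI iffI)
      fix C assume "C \<in> {C \<in> Gr.cosets (carrier G) S. \<forall>q\<in>Q. Gr.rep C \<otimes> q \<otimes> inv (Gr.rep C) \<in> S}"
      then have C: "C \<in> Gr.cosets (carrier G) S"
        and conj: "\<And>q. q \<in> Q \<Longrightarrow> Gr.rep C \<otimes> q \<otimes> inv (Gr.rep C) \<in> S" by auto
      let ?g = "Gr.rep C"
      have g: "?g \<in> carrier G" "S #> ?g = C" using rG[OF C] by auto
      have "inv ?g \<in> N"
      proof (rule setwise_stabilizerI)
        show "inv ?g \<in> carrier G" using g by simp
        fix z assume z: "z \<in> X"
        have zO: "z \<in> \<Omega>" using z X_sub by auto
        have iz: "\<phi> (inv ?g) z \<in> \<Omega>" using act_closed g zO by simp
        have "\<phi> q (\<phi> (inv ?g) z) = \<phi> (inv ?g) z" if q: "q \<in> Q" for q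
        proof -
          have qG: "q \<in> carrier G" using q Q_carrier by auto
          have "\<phi> (?g \<otimes> q \<otimes> inv ?g) z = z" using S_fix[OF conj[OF q] z] .
          then have "\<phi> ?g (\<phi> q (\<phi> (inv ?g) z)) = z"
            using act_mult g qG zO iz by simp
          then have "\<phi> (inv ?g) (\<phi> ?g (\<phi> q (\<phi> (inv ?g) z))) = \<phi> (inv ?g) z" by simp
          then show ?thesis using act_inv(1)[OF g(1)] act_closed[OF qG iz] by simp
        qed
        then show "\<phi> (inv ?g) z \<in> X" using iz fixed_Q by (auto simp: fixed_points_def)
      qed
      then have "?g \<in> N" using subgroup.m_inv_closed[OF N_subgroup] g by fastforce
      then show "C \<in> carrier M" unfolding carrier_M Gr.cosets_def using g by blast
    next
      fix C assume C: "C \<in> carrier M"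
      then have CN: "C \<in> Gr.cosets N S" by (simp add: carrier_M)
      let ?g = "Gr.rep C"
      have g: "?g \<in> N" "S #> ?g = C" using rN[OF CN] by auto
      have gG: "?g \<in> carrier G" using g N_carrier by auto
      have "?g \<otimes> q \<otimes> inv ?g \<in> S" if q: "q \<in> Q" for q
      proof -
        have qG: "q \<in> carrier G" using q Q_carrier by auto
        have "\<phi> (?g \<otimes> q \<otimes> inv ?g) z = z" if z: "z \<in> X" for z
        proof -
          have zO: "z \<in> \<Omega>" using z X_sub by auto
          have iz: "\<phi> (inv ?g) z \<in> X" using N_act[OF subgroup.m_inv_closed[OF N_subgroup g(1)] z] .
          have "\<phi> (?g \<otimes> q \<otimes> inv ?g) z = \<phi> ?g (\<phi> q (\<phi> (inv ?g) z))"
            using act_mult gG qG zO act_closed by simp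
          also have "\<phi> q (\<phi> (inv ?g) z) = \<phi> (inv ?g) z" using S_fix iz q Q_sub_S by auto
          finally show ?thesis using act_inv(2)[OF gG zO] by simp
        qed
        then show ?thesis using gG qG by (simp add: pointwise_stabilizer_def)
      qed
      moreover have "C \<in> Gr.cosets (carrier G) S" unfolding Gr.cosets_def using g gG by blast
      ultimately show "C \<in> {C \<in> Gr.cosets (carrier G) S. \<forall>q\<in>Q. Gr.rep C \<otimes> q \<otimes> inv (Gr.rep C) \<in> S}" by blast
    qed
    then have "rel_trace (carrier G) S a x y = (\<Sum>C\<in>carrier M. a (\<phi> (Gr.rep C) x) (\<phi> (Gr.rep C) y))"
      unfolding restr_rel_trace[OF S_subgroup a x] by simp
    also have "\<dots> = (\<Sum>C\<in>carrier M. restr a (\<psi> C x) (\<psi> C y))"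
    proof (rule sum.cong[OF refl])
      fix C assume C: "C \<in> carrier M"
      have "Gr.rep C \<in> N" using rN C carrier_M by blast
      then show "a (\<phi> (Gr.rep C) x) (\<phi> (Gr.rep C) y) = restr a (\<psi> C x) (\<psi> C y)"
        using \<psi>_rep[OF C] x N_act by (simp add: restr_def)
    qed
    also have "\<dots> = (\<Sum>D\<in>B.Gr.cosets (carrier M) {\<one>\<^bsub>M\<^esub>}. restr a (\<psi> (B.Gr.rep D) x) (\<psi> (B.Gr.rep D) y))"
      by (rule B.Gr.sum_cosets_one[OF subset_refl, symmetric])
    finally show ?thesis using x by (simp add: restr_def[of "rel_trace (carrier G) S a"] B.rel_trace_def)
  next
    case False
    then show ?thesis by (auto simp: restr_def B.rel_trace_def)
  qed
qed

definition J :: "('a \<Rightarrow> 'a \<Rightarrow> 'k) set" where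
  "J = rel_trace (carrier G) S ` Inv S"

definition J' :: "('a \<Rightarrow> 'a \<Rightarrow> 'k) set" where
  "J' = B.rel_trace (carrier M) {\<one>\<^bsub>M\<^esub>} ` B.Inv {\<one>\<^bsub>M\<^esub>}"

text \<open>Every matrix over \<open>X\<close>, extended by zero, is invariant under the pointwise stabilizer of \<open>X\<close>.\<close>

lemma restr_image: "restr ` J = J'"
proof -
  have "restr ` Inv S = matrices X"
  proof
    show "restr ` Inv S \<subseteq> matrices X" using restr_matrices by blast
    show "matrices X \<subseteq> restr ` Inv S"
    proof
      fix b :: "'a \<Rightarrow> 'a \<Rightarrow> 'k" assume b: "b \<in> matrices X"
      have "b (\<phi> s x) (\<phi> s y) = b x y" if s: "s \<in> S" and x: "x \<in> \<Omega>" "y \<in> \<Omega>" for s x y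
      proof -
        have sG: "s \<in> carrier G" using s S_carrier by auto
        have XX: "\<phi> s u = u" if "u \<in> X" for u using S_fix[OF s that] .
        have nX: "\<phi> s u \<notin> X" if u: "u \<notin> X" "u \<in> \<Omega>" for u
        proof
          assume "\<phi> s u \<in> X"
          then have "\<phi> s (\<phi> s u) = \<phi> s u" by (rule XX)
          then have "\<phi> s u = u" using act_inv(1)[OF sG] u act_closed[OF sG] by metis
          then show False using u \<open>\<phi> s u \<in> X\<close> by simp
        qed
        show ?thesis
        proof (cases "x \<in> X \<and> y \<in> X")
          case False
          then have "\<phi> s x \<notin> X \<or> \<phi> s y \<notin> X" using nX x by blast
          then show ?thesis using False b by (auto simp: matrices_def)
        qed (simp add: XX)
      qed
      moreover have "b \<in> matrices \<Omega>" using b X_sub unfolding matrices_def by blast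
      ultimately have "b \<in> Inv S" by (simp add: invariant_matrices_def)
      moreover have "restr b = b" using b by (auto simp: restr_def matrices_def fun_eq_iff)
      ultimately show "b \<in> restr ` Inv S" by (metis image_eqI)
    qed
  qed
  then have "B.rel_trace (carrier M) {\<one>\<^bsub>M\<^esub>} ` restr ` Inv S = J'" by (simp only: J'_def B_Inv_one)
  moreover have "restr ` J = B.rel_trace (carrier M) {\<one>\<^bsub>M\<^esub>} ` restr ` Inv S"
    unfolding J_def image_image by (rule image_cong[OF refl restr_rel_trace_S])
  ultimately show ?thesis by simp
qed

lemma restr_closed:
  assumes a: "a \<in> E" shows "restr a \<in> B.E"
proof -
  have "restr a (\<psi> C x) (\<psi> C y) = restr a x y" if C: "C \<in> carrier M" and x: "x \<in> X" "y \<in> X" for C x y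
  proof -
    have g: "Gr.rep C \<in> N" using Gr.rep_in[OF S_subgroup N_subgroup S_sub_N] C carrier_M by blast
    then have "Gr.rep C \<in> carrier G" using N_carrier by auto
    then show ?thesis using \<psi>_rep[OF C] x N_act[OF g] InvD[OF a, of "Gr.rep C" x y] X_sub
      by (auto simp: restr_def)
  qed
  then show ?thesis using restr_matrices by (simp add: invariant_matrices_def)
qed

sublocale Br: ideal_hom mat_scale "mat_mult \<Omega>" E "mat_one \<Omega>" "mat_unit ` (\<Omega> \<times> \<Omega>)"
    mat_scale "mat_mult X" B.E "mat_one X" "mat_unit ` (X \<times> X)" restr J J'
proof
  show "restr a \<in> B.E" if "a \<in> E" for a by (rule restr_closed[OF that])
  show "restr (a + b) = restr a + restr b" for a b by (auto simp: restr_def fun_eq_iff)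
  show "restr (mat_mult \<Omega> a b) = mat_mult X (restr a) (restr b)" if "a \<in> E" "b \<in> E" for a b
    using restr_mult[OF Q_subgroup card_Q fixed_Q] Inv_mono[OF Q_carrier] that by blast
  show "restr (mat_one \<Omega>) = mat_one X" using X_sub by (auto simp: restr_def mat_one_def fun_eq_iff)
  show "J \<subseteq> E" using rel_trace_E[OF _ S_subgroup] by (auto simp: J_def)
  show "mat_mult \<Omega> a b \<in> J" if "a \<in> E" "b \<in> J" for a b
  proof -
    obtain c where c: "c \<in> Inv S" "b = rel_trace (carrier G) S c" using \<open>b \<in> J\<close> by (auto simp: J_def)
    have "mat_mult \<Omega> a c \<in> Inv S" by (rule mat_mult_invariant[OF Inv_mono[OF S_carrier \<open>a \<in> E\<close>] c(1) S_carrier])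
    then show ?thesis unfolding J_def c(2) rel_trace_mult(1)[OF \<open>a \<in> E\<close> S_subgroup] by blast
  qed
  show "mat_mult \<Omega> a b \<in> J" if "a \<in> J" "b \<in> E" for a b
  proof -
    obtain c where c: "c \<in> Inv S" "a = rel_trace (carrier G) S c" using \<open>a \<in> J\<close> by (auto simp: J_def)
    have "mat_mult \<Omega> c b \<in> Inv S" by (rule mat_mult_invariant[OF c(1) Inv_mono[OF S_carrier \<open>b \<in> E\<close>] S_carrier])
    then show ?thesis unfolding J_def c(2) rel_trace_mult(2)[OF \<open>b \<in> E\<close> S_subgroup] by blast
  qed
  show "restr ` J = J'" by (rule restr_image)
  have one: "{\<one>\<^bsub>M\<^esub>} \<subseteq> carrier M" by simp
  show "mat_mult X a b \<in> J'" if "a \<in> B.E" "b \<in> J'" for a b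
  proof -
    obtain c where c: "c \<in> B.Inv {\<one>\<^bsub>M\<^esub>}" "b = B.rel_trace (carrier M) {\<one>\<^bsub>M\<^esub>} c" using \<open>b \<in> J'\<close> by (auto simp: J'_def)
    have "mat_mult X a c \<in> B.Inv {\<one>\<^bsub>M\<^esub>}" by (rule B.mat_mult_invariant[OF B.Inv_mono[OF one \<open>a \<in> B.E\<close>] c(1) one])
    then show ?thesis unfolding J'_def c(2) B.rel_trace_mult(1)[OF \<open>a \<in> B.E\<close> B.triv_subgroup] by blast
  qed
  show "mat_mult X a b \<in> J'" if "a \<in> J'" "b \<in> B.E" for a b
  proof -
    obtain c where c: "c \<in> B.Inv {\<one>\<^bsub>M\<^esub>}" "a = B.rel_trace (carrier M) {\<one>\<^bsub>M\<^esub>} c" using \<open>a \<in> J'\<close> by (auto simp: J'_def)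
    have "mat_mult X c b \<in> B.Inv {\<one>\<^bsub>M\<^esub>}" by (rule B.mat_mult_invariant[OF c(1) B.Inv_mono[OF one \<open>b \<in> B.E\<close>] one])
    then show ?thesis unfolding J'_def c(2) B.rel_trace_mult(2)[OF \<open>b \<in> B.E\<close> B.triv_subgroup] by blast
  qed
qed

section \<open>Vertices\<close>

lemma index_invertible:
  assumes H: "subgroup H G" and K: "subgroup K G" "H \<subseteq> K" and card: "card H = p ^ multiplicity p (card K)"
  shows "(of_nat (card (Gr.cosets K H)) :: 'k) \<noteq> 0"
proof -
  have "finite K" using finite_subset[OF subgroup.subset[OF K(1)] finite_group] .
  then have "card K > 0" using subgroup.one_closed[OF K(1)] by (auto simp: card_gt_0_iff)
  then have "\<not> p dvd card (Gr.cosets K H)"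
    using sylow_index_not_dvd[OF prime_p] Gr.card_cosets[OF H K] card by simp
  then show ?thesis using char_k by (simp add: of_nat_eq_0_iff_char_dvd)
qed

text \<open>
  A vertex is a \<open>p\<close>-group: its Sylow subgroup has invertible index, so the summand is relatively
  projective with respect to that subgroup already.
\<close>

lemma vertex_card:
  assumes e: "alg.idempotent e" and v: "is_vertex G (summand e) R"
  shows "card R = p ^ multiplicity p (card R)"
proof -
  have R: "subgroup R G" and rp: "relatively_projective G R (summand e)"
    and min: "\<And>H. subgroup H G \<Longrightarrow> H \<subset> R \<Longrightarrow> \<not> relatively_projective G H (summand e)"
    using v by (auto simp: is_vertex_def)
  have RG: "R \<subseteq> carrier G" using subgroup.subset[OF R] .
  have finR: "finite R" using finite_subset[OF RG finite_group] .
  interpret R: group "G\<lparr>carrier := R\<rparr>" using subgroup.subgroup_is_group[OF R Gr.group_axioms] .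
  have "p ^ multiplicity p (card R) dvd card R" by (rule multiplicity_dvd)
  then obtain m where m: "card R = p ^ multiplicity p (card R) * m" by blast
  then have "order (G\<lparr>carrier := R\<rparr>) = p ^ multiplicity p (card R) * m" by (simp add: order_def)
  then obtain H where H: "subgroup H (G\<lparr>carrier := R\<rparr>)" "card H = p ^ multiplicity p (card R)"
    using sylow_thm[OF prime_p R.group_axioms] finR by auto
  have HR: "H \<subseteq> R" using subgroup.subset[OF H(1)] by simp
  have HG: "subgroup H G" by (rule Gr.incl_subgroup[OF R H(1)])
  obtain a where a: "a \<in> Inv R" "rel_trace (carrier G) R a = e"
    using rp relatively_projective_iff_rel_trace[OF e R] by blast
  obtain b where "b \<in> Inv H" "rel_trace (carrier G) H b = e"
    using rel_trace_invertible_index[OF a(1) HG R HR index_invertible[OF HG R HR H(2)]] a(2) by metis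
  then have "relatively_projective G H (summand e)" using relatively_projective_iff_rel_trace[OF e HG] by blast
  then have "H = R" using min[OF HG] HR by blast
  then show ?thesis using H(2) by simp
qed

text \<open>
  Let \<open>R\<close> be a vertex with fixed point set \<open>X\<close>. Then \<open>R\<close> is contained in \<open>S\<close>, and a trace from \<open>R\<close> is
  a trace from \<open>S\<close>. If \<open>e = Tr a\<close> restricts to zero, so does \<open>c = a e\<close>, and \<open>e = Tr c\<close> as well. Expanding
  \<open>c\<close> by orbits writes \<open>e\<close> as a sum of traces from proper subgroups of \<open>R\<close>, and by Rosenberg's lemma
  \<open>e\<close> is a trace from one of them, against the minimality of \<open>R\<close>.
  
  Conversely, an idempotent of \<open>J\<close> is a trace from \<open>Q\<close>, and traces from proper subgroups of \<open>Q\<close>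
  restrict to zero.
\<close>

theorem admits_fixed_point_set_iff:
  assumes e: "alg.primitive e"
  shows "admits_fixed_point_set G \<Omega> \<phi> (summand e) X \<longleftrightarrow> e \<in> J \<and> restr e \<noteq> 0"
proof
  have ide: "alg.idempotent e" using alg.primitive_idempotent[OF e] .
  then have eE: "e \<in> E" "mat_mult \<Omega> e e = e" by (auto simp: alg.idempotent_def)
  {
    assume "admits_fixed_point_set G \<Omega> \<phi> (summand e) X"
    then obtain R where v: "is_vertex G (summand e) R" and fixR: "fixed_points \<Omega> \<phi> R = X"
      by (auto simp: admits_fixed_point_set_def)
    have R: "subgroup R G" and rp: "relatively_projective G R (summand e)"
      and min: "\<And>H. subgroup H G \<Longrightarrow> H \<subset> R \<Longrightarrow> \<not> relatively_projective G H (summand e)"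
      using v by (auto simp: is_vertex_def)
    have RG: "R \<subseteq> carrier G" using subgroup.subset[OF R] .
    have RS: "R \<subseteq> S" using RG fixR by (auto simp: fixed_points_def pointwise_stabilizer_def)
    obtain a where a: "a \<in> Inv R" "rel_trace (carrier G) R a = e"
      using rp relatively_projective_iff_rel_trace[OF ide R] by blast
    have "e \<in> J" using rel_trace_mono[OF a(1) R S_subgroup RS] a(2) unfolding J_def by (metis image_eqI)
    moreover have "restr e \<noteq> 0"
    proof
      assume e0: "restr e = 0"
      define c where "c = mat_mult \<Omega> a e"
      have eR: "e \<in> Inv R" by (rule Inv_mono[OF RG eE(1)])
      have c: "c \<in> Inv R" unfolding c_def by (rule mat_mult_invariant[OF a(1) eR RG])
      have ec: "e = rel_trace (carrier G) R c"
        unfolding c_def rel_trace_mult(2)[OF eE(1) R, symmetric] a(2) by (rule eE(2)[symmetric])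
      have rc: "restr c = 0" unfolding c_def restr_mult[OF R vertex_card[OF ide v] fixR a(1) eR] e0
        by (simp add: mat_mult_def fun_eq_iff)
      have cX: "c x y = 0" if "x \<in> X" "y \<in> X" for x y
      proof -
        have "c x y = restr c x y" using that by (simp add: restr_def)
        then show ?thesis by (simp add: rc)
      qed
      obtain Z where Z: "Z \<subseteq> \<Omega> \<times> \<Omega>" "\<forall>z\<in>Z. c (fst z) (snd z) \<noteq> 0"
        "c = (\<Sum>z\<in>Z. rel_trace R (pair_stabilizer R z) (mat_scale (c (fst z) (snd z)) (mat_unit z)))"
        by (rule invariant_orbit_expansion[OF R c])
      let ?u = "\<lambda>z. mat_scale (c (fst z) (snd z)) (mat_unit z)"
      let ?H = "pair_stabilizer R"
      have finZ: "finite Z" using finite_subset[OF Z(1)] finite_set by simp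
      have H: "subgroup (?H z) G" "?H z \<subseteq> R" "?u z \<in> Inv (?H z)" if "z \<in> Z" for z
        using pair_stabilizer_subgroup[OF R] mat_unit_invariant[OF R] that Z(1)
        by (auto simp: pair_stabilizer_def)
      have "e = (\<Sum>z\<in>Z. rel_trace (carrier G) R (rel_trace R (?H z) (?u z)))"
        using ec arg_cong[OF Z(3), of "rel_trace (carrier G) R"] unfolding rel_trace_sum by (rule trans)
      also have "\<dots> = (\<Sum>z\<in>Z. rel_trace (carrier G) (?H z) (?u z))"
        by (rule sum.cong[OF refl], rule rel_trace_trans[OF H(3) H(1) R H(2) Gr.subgroup_self RG, symmetric])
      finally have e_sum: "e = (\<Sum>z\<in>Z. rel_trace (carrier G) (?H z) (?u z))" .
      have "\<exists>z\<in>Z. e \<in> rel_trace (carrier G) (?H z) ` Inv (?H z)"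
      proof (rule alg.primitive_sum_ideals[OF e finZ e_sum])
        fix z s t assume z: "z \<in> Z" and s: "s \<in> E" and t: "t \<in> E"
        have HG: "?H z \<subseteq> carrier G" using subgroup.subset[OF H(1)[OF z]] .
        have "mat_mult \<Omega> (mat_mult \<Omega> s (?u z)) t \<in> Inv (?H z)"
          by (intro mat_mult_invariant[OF mat_mult_invariant] Inv_mono[OF HG] s t H(3)[OF z] HG)
        then show "mat_mult \<Omega> (mat_mult \<Omega> s (rel_trace (carrier G) (?H z) (?u z))) t \<in> rel_trace (carrier G) (?H z) ` Inv (?H z)"
          unfolding rel_trace_mult(1)[OF s H(1)[OF z]] rel_trace_mult(2)[OF t H(1)[OF z]] by blast
      next
        show "rel_trace (carrier G) (?H z) (?u z) \<in> E" if "z \<in> Z" for z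
          by (rule rel_trace_E[OF H(3)[OF that] H(1)[OF that]])
      qed
      then obtain z b where z: "z \<in> Z" and b: "b \<in> Inv (?H z)" "rel_trace (carrier G) (?H z) b = e" by blast
      have rpz: "relatively_projective G (?H z) (summand e)"
        using relatively_projective_iff_rel_trace[OF ide H(1)[OF z]] b by blast
      have "?H z \<noteq> R"
      proof
        assume "?H z = R"
        then have "fst z \<in> fixed_points \<Omega> \<phi> R" "snd z \<in> fixed_points \<Omega> \<phi> R"
          using z Z(1) by (auto simp: fixed_points_def pair_stabilizer_def)
        then show False using cX[of "fst z" "snd z"] bspec[OF Z(2) z] fixR by simp
      qed
      then show False using min[OF H(1)[OF z]] H(2)[OF z] rpz by blast
    qed
    ultimately show "e \<in> J \<and> restr e \<noteq> 0" by blast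
  next
    assume eJ: "e \<in> J \<and> restr e \<noteq> 0"
    then obtain a where a: "a \<in> Inv S" "rel_trace (carrier G) S a = e" by (auto simp: J_def)
    obtain b where "b \<in> Inv Q" "rel_trace (carrier G) Q b = e"
      using rel_trace_invertible_index[OF a(1) Q_subgroup S_subgroup Q_sub_S
          index_invertible[OF Q_subgroup S_subgroup Q_sub_S card_Q]] a(2) by metis
    then have "relatively_projective G Q (summand e)"
      using relatively_projective_iff_rel_trace[OF ide Q_subgroup] by blast
    moreover have "\<not> relatively_projective G H (summand e)" if H: "subgroup H G" "H \<subset> Q" for H
      using relatively_projective_iff_rel_trace[OF ide H(1)] restr_rel_trace_smaller[OF H] eJ by metis
    ultimately have "is_vertex G (summand e) Q" using Q_subgroup by (simp add: is_vertex_def)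
    then show "admits_fixed_point_set G \<Omega> \<phi> (summand e) X"
      using fixed_Q by (auto simp: admits_fixed_point_set_def)
  }
qed

section \<open>The correspondence\<close>

lemma fixed_point_set_summands_eq:
  "fixed_point_set_summands G \<Omega> \<phi> X = img ` {e. Br.visible e}"
proof -
  have "A \<in> fixed_point_set_summands G \<Omega> \<phi> X \<longleftrightarrow> (\<exists>e. Br.visible e \<and> A = img e)" for A :: "('a \<Rightarrow> 'k) set"
  proof -
    have "A \<in> fixed_point_set_summands G \<Omega> \<phi> X \<longleftrightarrow> direct_summand G k\<Omega> A \<and>
        indecomposable G (k\<Omega>\<lparr>carrier := A\<rparr>) \<and> admits_fixed_point_set G \<Omega> \<phi> (k\<Omega>\<lparr>carrier := A\<rparr>) X"
      by (simp add: fixed_point_set_summands_def k\<Omega>_eq Let_def)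
    also have "\<dots> \<longleftrightarrow> (\<exists>e. Br.visible e \<and> A = img e)"
      unfolding direct_summand_iff
      using indecomposable_iff_primitive admits_fixed_point_set_iff alg.primitive_idempotent by blast
    finally show ?thesis .
  qed
  then show ?thesis by blast
qed

lemma projective_summands_eq:
  "projective_indecomposable_summands M kX = B.img ` {f. B.alg.primitive f \<and> f \<in> J'}"
proof -
  have "A \<in> projective_indecomposable_summands M kX \<longleftrightarrow> (\<exists>f. B.alg.primitive f \<and> f \<in> J' \<and> A = B.img f)" for A
  proof -
    have p: "projective M (B.summand f) \<longleftrightarrow> f \<in> J'" if "B.alg.idempotent f" for f
      using B.projective_iff_rel_trace[OF that] unfolding J'_def by blast
    show ?thesis unfolding projective_indecomposable_summands_def B.direct_summand_iff mem_Collect_eq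
      using B.indecomposable_iff_primitive p B.alg.primitive_idempotent by blast
  qed
  then show ?thesis by blast
qed

end

lemma (in permutation_module) multiplicity_cong:
  assumes e: "alg.primitive e" and f: "alg.primitive f" and ef: "alg.equivalent e f"
  shows "summand_multiplicity G k\<Omega> (summand e) = summand_multiplicity G k\<Omega> (summand f)"
proof -
  obtain D where D: "alg.primitive_decomposition D" using alg.primitive_decomposition_exists by blast
  note i = alg.primitive_idempotent
  have "{g \<in> D. alg.equivalent g e} = {g \<in> D. alg.equivalent g f}"
  proof (rule Collect_cong, rule conj_cong[OF refl])
    fix g assume "g \<in> D"
    then have g: "alg.idempotent g" using D i by (auto simp: alg.primitive_decomposition_def)
    show "alg.equivalent g e \<longleftrightarrow> alg.equivalent g f"
      using alg.equivalent_trans[OF _ ef g i[OF e] i[OF f]]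
        alg.equivalent_trans[OF _ alg.equivalent_sym[OF ef] g i[OF f] i[OF e]] by blast
  qed
  then have "n \<le> summand_multiplicity G k\<Omega> (summand e) \<longleftrightarrow> n \<le> summand_multiplicity G k\<Omega> (summand f)" for n
    using copies_iff_multiplicity[OF e] copies_iff_multiplicity[OF f]
      alg.copies_iff_le_card[OF D e] alg.copies_iff_le_card[OF D f] by simp
  then show ?thesis by (meson order_antisym order_refl)
qed

text \<open>
  Since \<open>b\<close> preserves and reflects the relations, it induces an injection of classes, and \<open>r\<close> is an
  equivalence relation because \<open>s\<close> is one.
\<close>

lemma bij_betw_quotients:
  assumes b: "\<And>A. A \<in> \<A> \<Longrightarrow> b A \<in> \<B>"
    and r: "\<And>A A'. A \<in> \<A> \<Longrightarrow> A' \<in> \<A> \<Longrightarrow> r A A' \<longleftrightarrow> s (b A) (b A')"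
    and surj: "\<And>B. B \<in> \<B> \<Longrightarrow> \<exists>A\<in>\<A>. s (b A) B"
    and refl: "\<And>B. B \<in> \<B> \<Longrightarrow> s B B"
    and sym: "\<And>B B'. B \<in> \<B> \<Longrightarrow> B' \<in> \<B> \<Longrightarrow> s B B' \<Longrightarrow> s B' B"
    and trans: "\<And>B B' B''. B \<in> \<B> \<Longrightarrow> B' \<in> \<B> \<Longrightarrow> B'' \<in> \<B> \<Longrightarrow> s B B' \<Longrightarrow> s B' B'' \<Longrightarrow> s B B''"
  shows "bij_betw (\<lambda>C. {B \<in> \<B>. \<exists>A\<in>C. s (b A) B})
    (\<A> // {(A, A'). A \<in> \<A> \<and> A' \<in> \<A> \<and> r A A'}) (\<B> // {(B, B'). B \<in> \<B> \<and> B' \<in> \<B> \<and> s B B'})"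
proof -
  let ?R = "{(A, A'). A \<in> \<A> \<and> A' \<in> \<A> \<and> r A A'}" and ?S = "{(B, B'). B \<in> \<B> \<and> B' \<in> \<B> \<and> s B B'}"
  let ?F = "\<lambda>C. {B \<in> \<B>. \<exists>A\<in>C. s (b A) B}"
  have clsR: "?R `` {A} = {A' \<in> \<A>. s (b A) (b A')}" if "A \<in> \<A>" for A using r that by auto
  have clsS: "?S `` {B} = {B' \<in> \<B>. s B B'}" if "B \<in> \<B>" for B using that by auto
  have F: "?F (?R `` {A}) = ?S `` {b A}" if A: "A \<in> \<A>" for A
    unfolding clsR[OF A] clsS[OF b[OF A]]
  proof (intro Set.set_eqI iffI)
    fix B assume "B \<in> {B \<in> \<B>. \<exists>A'\<in>{A' \<in> \<A>. s (b A) (b A')}. s (b A') B}"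
    then obtain A' where A': "B \<in> \<B>" "A' \<in> \<A>" "s (b A) (b A')" "s (b A') B" by blast
    then show "B \<in> {B' \<in> \<B>. s (b A) B'}" using trans[OF b[OF A] b[OF A'(2)] A'(1)] by blast
  next
    fix B assume "B \<in> {B' \<in> \<B>. s (b A) B'}"
    then show "B \<in> {B \<in> \<B>. \<exists>A'\<in>{A' \<in> \<A>. s (b A) (b A')}. s (b A') B}" using A refl[OF b[OF A]] by blast
  qed
  show ?thesis unfolding bij_betw_def
  proof
    show "inj_on ?F (\<A> // ?R)"
    proof (rule inj_onI)
      fix C C' assume "C \<in> \<A> // ?R" "C' \<in> \<A> // ?R" and eq: "?F C = ?F C'"
      then obtain A A' where A: "A \<in> \<A>" "C = ?R `` {A}" and A': "A' \<in> \<A>" "C' = ?R `` {A'}"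
        by (auto simp: quotient_def)
      have "?S `` {b A} = ?S `` {b A'}" using eq F A A' by simp
      then have bb: "s (b A) (b A')" using refl[OF b[OF A'(1)]] clsS[OF b[OF A(1)]] clsS[OF b[OF A'(1)]] b[OF A'(1)] by blast
      have bb': "s (b A') (b A)" by (rule sym[OF b[OF A(1)] b[OF A'(1)] bb])
      show "C = C'" unfolding A(2) A'(2) clsR[OF A(1)] clsR[OF A'(1)]
      proof (rule Collect_cong, rule conj_cong[OF HOL.refl])
        fix D assume D: "D \<in> \<A>"
        show "s (b A) (b D) \<longleftrightarrow> s (b A') (b D)"
          using trans[OF b[OF A(1)] b[OF A'(1)] b[OF D] bb] trans[OF b[OF A'(1)] b[OF A(1)] b[OF D] bb'] by blast
      qed
    qed
    show "?F ` (\<A> // ?R) = \<B> // ?S"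
    proof
      show "?F ` (\<A> // ?R) \<subseteq> \<B> // ?S"
      proof
        fix C assume "C \<in> ?F ` (\<A> // ?R)"
        then obtain A where "A \<in> \<A>" "C = ?F (?R `` {A})" by (auto simp: quotient_def)
        then show "C \<in> \<B> // ?S" using F b by (auto simp: quotient_def)
      qed
      show "\<B> // ?S \<subseteq> ?F ` (\<A> // ?R)"
      proof
        fix C assume "C \<in> \<B> // ?S"
        then obtain B where B: "B \<in> \<B>" "C = ?S `` {B}" by (auto simp: quotient_def)
        obtain A where A: "A \<in> \<A>" "s (b A) B" using surj[OF B(1)] by blast
        have bA: "b A \<in> \<B>" by (rule b[OF A(1)])
        have Bb: "s B (b A)" by (rule sym[OF bA B(1) A(2)])
        have "C = ?S `` {b A}" unfolding B(2) clsS[OF B(1)] clsS[OF bA]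
        proof (rule Collect_cong, rule conj_cong[OF HOL.refl])
          fix D assume D: "D \<in> \<B>"
          show "s B D \<longleftrightarrow> s (b A) D"
            using trans[OF bA B(1) D A(2)] trans[OF B(1) bA D Bb] by blast
        qed
        then have "C = ?F (?R `` {A})" using F[OF A(1)] by simp
        moreover have "?R `` {A} \<in> \<A> // ?R" using A(1) by (rule quotientI)
        ultimately show "C \<in> ?F ` (\<A> // ?R)" by blast
      qed
    qed
  qed
qed

text \<open>
  The idempotent behind a summand is not unique, since it depends on the complement; choosing one is
  harmless because its equivalence class is determined by the isomorphism type.
\<close>

theorem (in closed_set) correspondence:
  "\<exists>F. bij_betw F
      (iso_types G k\<Omega> (fixed_point_set_summands G \<Omega> \<phi> X))
      (iso_types M kX (projective_indecomposable_summands M kX)) \<and>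
    (\<forall>\<C> \<in> iso_types G k\<Omega> (fixed_point_set_summands G \<Omega> \<phi> X). \<forall>A \<in> \<C>. \<forall>B \<in> F \<C>.
       summand_multiplicity G k\<Omega> (k\<Omega>\<lparr>carrier := A\<rparr>) =
       summand_multiplicity M kX (kX\<lparr>carrier := B\<rparr>))"
proof -
  let ?A = "fixed_point_set_summands G \<Omega> \<phi> X :: ('a \<Rightarrow> 'k) set set"
  let ?B = "projective_indecomposable_summands M kX"
  let ?r = "\<lambda>A A'. kG_isomorphic G (k\<Omega>\<lparr>carrier := A\<rparr>) (k\<Omega>\<lparr>carrier := A'\<rparr>)"
  let ?s = "\<lambda>B B'. kG_isomorphic M (kX\<lparr>carrier := B\<rparr>) (kX\<lparr>carrier := B'\<rparr>)"
  define idem where "idem A = (SOME e. Br.visible e \<and> A = img e)" for A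
  have idem: "Br.visible (idem A)" "img (idem A) = A" if "A \<in> ?A" for A
  proof -
    have "\<exists>e. Br.visible e \<and> A = img e" using that unfolding fixed_point_set_summands_eq by blast
    from someI_ex[OF this] show "Br.visible (idem A)" "img (idem A) = A" unfolding idem_def by auto
  qed
  define b where "b A = B.img (restr (idem A))" for A
  have prim: "B.alg.primitive (restr (idem A))" if "A \<in> ?A" for A
    by (rule Br.visible_image_primitive[OF idem(1)[OF that]])
  have inJ': "restr (idem A) \<in> J'" if "A \<in> ?A" for A
    using idem(1)[OF that] restr_image by blast
  have bB: "b A \<in> ?B" if "A \<in> ?A" for A
    unfolding projective_summands_eq b_def using prim[OF that] inJ'[OF that] by blast
  have Bf: "\<exists>f. B.alg.primitive f \<and> f \<in> J' \<and> B' = B.img f" if "B' \<in> ?B" for B'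
    using that unfolding projective_summands_eq by blast
  note ii = alg.primitive_idempotent and ib = B.alg.primitive_idempotent
  have rs: "?r A A' \<longleftrightarrow> ?s (b A) (b A')" if A: "A \<in> ?A" "A' \<in> ?A" for A A'
  proof -
    have v: "Br.visible (idem A)" "Br.visible (idem A')" using idem(1) A by auto
    have "?r A A' \<longleftrightarrow> alg.equivalent (idem A) (idem A')"
      using isomorphic_iff_equivalent[of "idem A" "idem A'"] ii v idem(2)[OF A(1)] idem(2)[OF A(2)] by simp
    also have "\<dots> \<longleftrightarrow> B.alg.equivalent (restr (idem A)) (restr (idem A'))"
      by (rule Br.equivalent_visible_iff[OF v, symmetric])
    also have "\<dots> \<longleftrightarrow> ?s (b A) (b A')"
      unfolding b_def by (rule B.isomorphic_iff_equivalent[OF ib[OF prim[OF A(1)]] ib[OF prim[OF A(2)]], symmetric])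
    finally show ?thesis .
  qed
  let ?F = "\<lambda>C. {B' \<in> ?B. \<exists>A\<in>C. ?s (b A) B'}"
  have bij: "bij_betw ?F (iso_types G k\<Omega> ?A) (iso_types M kX ?B)"
    unfolding iso_types_def
  proof (rule bij_betw_quotients)
    show "b A \<in> ?B" if "A \<in> ?A" for A by (rule bB[OF that])
    show "?r A A' \<longleftrightarrow> ?s (b A) (b A')" if "A \<in> ?A" "A' \<in> ?A" for A A' by (rule rs[OF that])
    show "\<exists>A\<in>?A. ?s (b A) B'" if B': "B' \<in> ?B" for B'
    proof -
      obtain f where f: "B.alg.primitive f" "f \<in> J'" "B' = B.img f" using Bf[OF B'] by blast
      obtain e where e: "Br.visible e" "B.alg.equivalent (restr e) f"
        using Br.primitive_of_ideal_visible[OF f(1,2)] by blast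
      have A: "img e \<in> ?A" unfolding fixed_point_set_summands_eq using e(1) by blast
      have pe: "B.alg.primitive (restr e)" by (rule Br.visible_image_primitive[OF e(1)])
      have "kG_isomorphic G (summand (idem (img e))) (summand e)"
        unfolding idem(2)[OF A] using isomorphic_iff_equivalent[of e e] alg.equivalent_refl ii e(1) by blast
      then have "alg.equivalent (idem (img e)) e"
        using isomorphic_iff_equivalent[of "idem (img e)" e] ii e(1) idem(1)[OF A] by blast
      then have "B.alg.equivalent (restr (idem (img e))) (restr e)"
        using Br.equivalent_visible_iff[OF idem(1)[OF A] e(1)] by blast
      then have "B.alg.equivalent (restr (idem (img e))) f"
        using B.alg.equivalent_trans[OF _ e(2) ib[OF prim[OF A]] ib[OF pe] ib[OF f(1)]] by blast
      then have "?s (b (img e)) B'" unfolding b_def f(3)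
        using B.isomorphic_iff_equivalent[OF ib[OF prim[OF A]] ib[OF f(1)]] by blast
      then show ?thesis using A by blast
    qed
    show "?s B' B'" if "B' \<in> ?B" for B'
      using Bf[OF that] B.isomorphic_iff_equivalent B.alg.equivalent_refl ib by blast
    show "?s B2 B1" if BB: "B1 \<in> ?B" "B2 \<in> ?B" "?s B1 B2" for B1 B2
    proof -
      obtain f g where fg: "B.alg.primitive f" "B1 = B.img f" "B.alg.primitive g" "B2 = B.img g"
        using Bf[OF BB(1)] Bf[OF BB(2)] by blast
      note I = ib[OF fg(1)] ib[OF fg(3)]
      have "B.alg.equivalent f g" using BB(3) unfolding fg B.isomorphic_iff_equivalent[OF I] .
      then show ?thesis unfolding fg B.isomorphic_iff_equivalent[OF I(2,1)] by (rule B.alg.equivalent_sym)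
    qed
    show "?s B1 B3" if BB: "B1 \<in> ?B" "B2 \<in> ?B" "B3 \<in> ?B" "?s B1 B2" "?s B2 B3" for B1 B2 B3
    proof -
      obtain f g h where fgh: "B.alg.primitive f" "B1 = B.img f" "B.alg.primitive g" "B2 = B.img g"
          "B.alg.primitive h" "B3 = B.img h"
        using Bf[OF BB(1)] Bf[OF BB(2)] Bf[OF BB(3)] by blast
      note I = ib[OF fgh(1)] ib[OF fgh(3)] ib[OF fgh(5)]
      have fg: "B.alg.equivalent f g" using BB(4) unfolding fgh B.isomorphic_iff_equivalent[OF I(1,2)] .
      have gh: "B.alg.equivalent g h" using BB(5) unfolding fgh B.isomorphic_iff_equivalent[OF I(2,3)] .
      show ?thesis unfolding fgh B.isomorphic_iff_equivalent[OF I(1,3)]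
        by (rule B.alg.equivalent_trans[OF fg gh I])
    qed
  qed
  have mult: "summand_multiplicity G k\<Omega> (k\<Omega>\<lparr>carrier := A\<rparr>) = summand_multiplicity M kX (kX\<lparr>carrier := B'\<rparr>)"
    if C: "C \<in> iso_types G k\<Omega> ?A" and A: "A \<in> C" and B': "B' \<in> ?F C" for C A B'
  proof -
    obtain A1 where A1: "A1 \<in> ?A" "C = {(A, A'). A \<in> ?A \<and> A' \<in> ?A \<and> ?r A A'} `` {A1}"
      using C by (auto simp: iso_types_def quotient_def)
    obtain A2 where A2: "A2 \<in> C" "?s (b A2) B'" and BB: "B' \<in> ?B" using B' by blast
    have AA: "A \<in> ?A" "A2 \<in> ?A" "?r A1 A" "?r A1 A2" using A A2(1) A1 by auto
    obtain f where f: "B.alg.primitive f" "B' = B.img f" using Bf[OF BB] by blast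
    note I = ib[OF prim[OF A1(1)]] ib[OF prim[OF AA(1)]] ib[OF prim[OF AA(2)]] ib[OF f(1)]
    have "B.alg.equivalent (restr (idem A1)) (restr (idem A))"
      using rs[OF A1(1) AA(1)] AA(3) B.isomorphic_iff_equivalent[OF I(1,2)] unfolding b_def by blast
    then have 1: "B.alg.equivalent (restr (idem A)) (restr (idem A1))" by (rule B.alg.equivalent_sym)
    have 2: "B.alg.equivalent (restr (idem A1)) (restr (idem A2))"
      using rs[OF A1(1) AA(2)] AA(4) B.isomorphic_iff_equivalent[OF I(1,3)] unfolding b_def by blast
    have 3: "B.alg.equivalent (restr (idem A2)) f"
      using A2(2) B.isomorphic_iff_equivalent[OF I(3,4)] unfolding b_def f(2) by blast
    have eq: "B.alg.equivalent (restr (idem A)) f"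
      using B.alg.equivalent_trans[OF B.alg.equivalent_trans[OF 1 2 I(2,1,3)] 3 I(2,3,4)] .
    have v: "Br.visible (idem A)" by (rule idem(1)[OF AA(1)])
    have pA: "alg.primitive (idem A)" using v by blast
    have "n \<le> summand_multiplicity G k\<Omega> (summand (idem A)) \<longleftrightarrow>
        n \<le> summand_multiplicity M kX (B.summand (restr (idem A)))" for n
      using Br.copies_visible_iff[OF v, of n] copies_iff_multiplicity[OF pA, of n]
        B.copies_iff_multiplicity[OF prim[OF AA(1)], of n] by blast
    then have "summand_multiplicity G k\<Omega> (summand (idem A)) =
        summand_multiplicity M kX (B.summand (restr (idem A)))" by (meson order_antisym order_refl)
    also have "\<dots> = summand_multiplicity M kX (B.summand f)"
      by (rule B.multiplicity_cong[OF prim[OF AA(1)] f(1) eq])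
    finally show ?thesis unfolding idem(2)[OF AA(1)] f(2) .
  qed
  show ?thesis using bij mult by (intro exI[of _ ?F] conjI ballI)
qed

theorem theorem2p12:
  fixes G :: "('g, 'm) monoid_scheme" and \<Omega> X :: "'a set" and \<phi> :: "'g \<Rightarrow> 'a \<Rightarrow> 'a"
    and p :: nat
    and k\<Omega> :: "('a \<Rightarrow> 'k::field, 'k, 'g) gmodule"
    and kX :: "('a \<Rightarrow> 'k, 'k, 'g set) gmodule"
  assumes "group_action G \<Omega> \<phi>" and "finite (carrier G)" and "finite \<Omega>"
    and "prime p" and "CHAR('k) = p"
    and "closed_subset p G \<Omega> \<phi> X"
    and M\<^sub>X: "M\<^sub>X = setwise_mod_pointwise G \<phi> X"
    and k\<Omega>: "k\<Omega> = perm_module G \<Omega> \<phi>"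
    and kX: "kX = perm_module M\<^sub>X X (quotient_action \<phi> X)"
  shows "\<exists>F. bij_betw F
            (iso_types G k\<Omega> (fixed_point_set_summands G \<Omega> \<phi> X))
            (iso_types M\<^sub>X kX (projective_indecomposable_summands M\<^sub>X kX)) \<and>
          (\<forall>\<C> \<in> iso_types G k\<Omega> (fixed_point_set_summands G \<Omega> \<phi> X).
             \<forall>A \<in> \<C>. \<forall>B \<in> F \<C>.
               summand_multiplicity G k\<Omega> (k\<Omega>\<lparr>carrier := A\<rparr>) =
               summand_multiplicity M\<^sub>X kX (kX\<lparr>carrier := B\<rparr>))"
proof -
  obtain Q where "sylow_subgroup_of p G (pointwise_stabilizer G \<phi> X) Q" "fixed_points \<Omega> \<phi> Q = X"
    using assms(6) by (auto simp: closed_subset_def)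
  then have "closed_set G \<Omega> \<phi> k\<Omega> p X Q"
    using assms(1-5) k\<Omega>
    by (simp add: closed_set_def closed_set_axioms_def permutation_module_def permutation_module_axioms_def)
  then show ?thesis unfolding kX M\<^sub>X by (rule closed_set.correspondence)
qed

end
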